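(* Let $(M,\{,\ldots,\})$ be a Nambu-Poisson manifold of order $n$ with associated Nambu tensor $\Pi$, $N\subset M$ a submanifold, and $i:N\hookrightarrow M$ the inclusion. Let $E\subseteq TM|_N$ be a vector subbundle such that $F:=E\cap TN$ is a regular, integrable distribution on $N$, and let $\theta_D$ be an integrable distribution on $M$ with $F\subseteq D:=\theta_D|_N\subseteq E$ which is compatible with $E$. If $$\Pi^\sharp(Ann^1E)\subseteq TN+D$$ and for any section $X\in\Gamma(\theta_D)$, $$(\mathcal L_X\Pi)|_N\subseteq E\wedge{\bigwedge}^{n-1}TM|_N,$$ then $(M,N,E)$ is reducible.
   Context: A Nambu-Poisson manifold of order $n$ is a smooth manifold $M$ ($n\le\dim M$) with an $n$-multilinear skew-symmetric bracket $\{,\ldots,\}$ on $C^\infty(M)$ satisfying the Leibniz rule $\{f_1,\ldots,f_{n-1},gh\}=g\{f_1,\ldots,f_{n-1},h\}+\{f_1,\ldots,f_{n-1},g\}h$ and the fundamental identity $\{g_1,\ldots,g_{n-1},\{f_1,\ldots,f_n\}\}=\sum_{k=1}^n\{f_1,\ldots,f_{k-1},\{g_1,\ldots,g_{n-1},f_k\},\ldots,f_n\}$. The Nambu tensor $\Pi\in\Gamma(\Lambda^nTM)$ is defined by $\Pi(df_1,\ldots,df_n)=\{f_1,\ldots,f_n\}$, and $\Pi^\sharp:\Lambda^{n-1}T^*M\to TM$ by $\langle\beta,\Pi^\sharp(\alpha_1\wedge\cdots\wedge\alpha_{n-1})\rangle=\Pi(\alpha_1,\ldots,\alpha_{n-1},\beta)$.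 $\mathcal L$ is the Lie derivative. "$F$ is a regular, integrable distribution on $N$" means that $F$ is a smooth integrable distribution of constant rank on $N$ such that the leaf space $\underline N=N/\mathcal F$ of the induced foliation $\mathcal F$ is a smooth manifold and the projection $\pi:N\to\underline N$ is a submersion. $C^\infty(M)_E$ denotes the functions on $M$ whose differential vanishes on $E$ (at points of $N$); $C^\infty(M)_{\theta_D}$ denotes the functions on $M$ whose differential vanishes on $\theta_D$ (at all points of $M$); $C^\infty(N)_F$ denotes the functions on $N$ whose differential vanishes on $F$. For $p\in N$, $Ann^1E_p=\{\eta\in\Lambda^{n-1}T_p^*M\mid i_v\eta=0\ \forall v\in E_p\}$. An integrable distribution $\theta_D$ on $M$ with $F\subseteq D:=\theta_D|_N\subseteq E$ (so $D$ is a subbundle of $TM|_N$) is compatible with $E$ if the restriction map $i^*:C^\infty(M)_E\cap C^\infty(M)_{\theta_D}\to C^\infty(N)_F$ is surjective. The condition $(\mathcal L_X\Pi)|_N\subseteq E\wedge\bigwedge^{n-1}TM|_N$ means that at every $p\in N$ the multivector $(\mathcal L_X\Pi)(p)$ lies in $E_p\wedge\bigwedge^{n-1}T_pM$. $(M,N,E)$ is (Nambu-Poisson) reducible if $\underline N$ has a Nambu-Poisson structure of order $n$ with bracket $\{,\ldots,\}_{\underline N}$ such that for all $f_1,\ldots,f_n\in C^\infty(\underline N)$ and all smooth extensions $F_1,\ldots,F_n\in C^\infty(M)_E$ of $f_1\circ\pi,\ldots,f_n\circ\pi$, one has $\pi^*\{f_1,\ldots,f_n\}_{\underline N}=i^*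\{F_1,\ldots,F_n\}$.
   Formalization: The Nambu-Poisson structure of order n on the leaf space is a bracket satisfying all the axioms, without requiring n ≤ dim of the leaf space; with that requirement the claim fails (N a point, E = θ_D = 0, Π vanishing there). *)

theory Defs
  imports "HOL-Analysis.Analysis" "HOL-Library.Function_Algebras"
begin

text \<open>Functions into a real vector space form a real vector space, so that \<^const>\<open>span\<close>,
  \<^const>\<open>subspace\<close> and \<^const>\<open>dim\<close> apply to tangent vectors and to multilinear forms.\<close>

instantiation "fun" :: (type, real_vector) real_vector
begin

definition "c *\<^sub>R f = (\<lambda>x. c *\<^sub>R f x)"

instance
  by standard (simp_all add: scaleR_fun_def fun_eq_iff scaleR_right_distrib scaleR_left_distrib)

end

lemma scaleR_fun_apply [simp]: "(c *\<^sub>R f) x = c *\<^sub>R f x"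
  by (simp add: scaleR_fun_def)


section \<open>Smooth manifolds\<close>

text \<open>An $m$-dimensional manifold is modelled on an $m$-dimensional linear subspace of a Euclidean
  space \<open>'e\<close>. In this way manifolds of different dimensions (dimension 0 included) are
  objects of one type.\<close>

record ('a, 'e) manifold =
  mtop :: "'a topology"
  model :: "'e set"
  charts :: "('a set \<times> ('a \<Rightarrow> 'e)) set"

abbreviation points :: "('a, 'e) manifold \<Rightarrow> 'a set"
  where "points M \<equiv> topspace (mtop M)"

text \<open>\<open>Ck_on k S U f\<close>: \<open>f\<close> is of class $C^k$ on \<open>U\<close>, a relatively open
  subset of the subspace \<open>S\<close>. The linear map \<open>f' x\<close> is determined on \<open>S\<close> only,
  and only its values there are used.\<close>

primrec Ck_on ::
  "nat \<Rightarrow> 'e::euclidean_space set \<Rightarrow> 'e set \<Rightarrow> ('e \<Rightarrow> 'b::real_normed_vector) \<Rightarrow> bool" where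
  "Ck_on 0 S U f \<longleftrightarrow> continuous_on U f"
| "Ck_on (Suc k) S U f \<longleftrightarrow>
     (\<exists>f'. (\<forall>x\<in>U. (f has_derivative f' x) (at x within U)) \<and> (\<forall>v\<in>S. Ck_on k S U (\<lambda>x. f' x v)))"

definition smooth_on ::
  "'e::euclidean_space set \<Rightarrow> 'e set \<Rightarrow> ('e \<Rightarrow> 'b::real_normed_vector) \<Rightarrow> bool"
  where "smooth_on S U f \<longleftrightarrow> (\<forall>k. Ck_on k S U f)"

definition smooth_manifold :: "('a, 'e::euclidean_space) manifold \<Rightarrow> bool" where
  "smooth_manifold M \<longleftrightarrow>
     Hausdorff_space (mtop M) \<and> second_countable (mtop M) \<and> subspace (model M) \<and>
     \<Union>(fst ` charts M) = points M \<and>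
     (\<forall>(U, \<phi>) \<in> charts M. openin (mtop M) U \<and> openin (top_of_set (model M)) (\<phi> ` U) \<and>
        homeomorphic_map (subtopology (mtop M) U) (top_of_set (\<phi> ` U)) \<phi>) \<and>
     (\<forall>(U, \<phi>) \<in> charts M. \<forall>(V, \<psi>) \<in> charts M.
        smooth_on (model M) (\<phi> ` (U \<inter> V)) (\<psi> \<circ> inv_into U \<phi>))"

text \<open>$C^\infty(M)$. Functions on \<open>M\<close> are normalised to be 0 off \<open>points M\<close>, so that
  equality of functions on \<open>M\<close> is equality in HOL.\<close>

definition smooth_functions :: "('a, 'e::euclidean_space) manifold \<Rightarrow> ('a \<Rightarrow> real) set" where
  "smooth_functions M = {f. (\<forall>x. x \<notin> points M \<longrightarrow> f x = 0) \<and>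
     (\<forall>(U, \<phi>) \<in> charts M. smooth_on (model M) (\<phi> ` U) (f \<circ> inv_into U \<phi>))}"

definition smooth_map ::
  "('a, 'e::euclidean_space) manifold \<Rightarrow> ('b, 'd::euclidean_space) manifold \<Rightarrow> ('a \<Rightarrow> 'b) \<Rightarrow> bool" where
  "smooth_map M M' F \<longleftrightarrow> continuous_map (mtop M) (mtop M') F \<and>
     (\<forall>(U, \<phi>) \<in> charts M. \<forall>(V, \<psi>) \<in> charts M'.
        smooth_on (model M) (\<phi> ` {x \<in> U. F x \<in> V}) (\<psi> \<circ> F \<circ> inv_into U \<phi>))"

text \<open>$F^*f$\<close>

definition pullback :: "('a, 'e) manifold \<Rightarrow> ('a \<Rightarrow> 'b) \<Rightarrow> ('b \<Rightarrow> real) \<Rightarrow> 'a \<Rightarrow> real"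
  where "pullback M F f = (\<lambda>x. if x \<in> points M then f (F x) else 0)"

abbreviation restrict_to :: "('a, 'e) manifold \<Rightarrow> ('a \<Rightarrow> real) \<Rightarrow> 'a \<Rightarrow> real"
  where "restrict_to N \<equiv> pullback N (\<lambda>x. x)"


section \<open>Tangent and cotangent vectors\<close>

text \<open>Tangent vectors at \<open>p\<close> are the derivations of $C^\infty(M)$ at \<open>p\<close>; cotangent
  vectors are the linear functionals on the tangent space. Both are normalised to be 0 outside
  their domain.\<close>

type_synonym 'a tvector = "('a \<Rightarrow> real) \<Rightarrow> real"
type_synonym 'a covector = "'a tvector \<Rightarrow> real"

definition tangent_space :: "('a, 'e::euclidean_space) manifold \<Rightarrow> 'a \<Rightarrow> 'a tvector set" where
  "tangent_space M p = {v. (\<forall>f. f \<notin> smooth_functions M \<longrightarrow> v f = 0) \<and>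
     (\<forall>f\<in>smooth_functions M. \<forall>g\<in>smooth_functions M.
        v (f + g) = v f + v g \<and> v (f * g) = f p * v g + g p * v f) \<and>
     (\<forall>c. \<forall>f\<in>smooth_functions M. v (c *\<^sub>R f) = c * v f)}"

definition cotangent_space :: "('a, 'e::euclidean_space) manifold \<Rightarrow> 'a \<Rightarrow> 'a covector set" where
  "cotangent_space M p = {\<alpha>. (\<forall>v. v \<notin> tangent_space M p \<longrightarrow> \<alpha> v = 0) \<and>
     (\<forall>u\<in>tangent_space M p. \<forall>v\<in>tangent_space M p. \<alpha> (u + v) = \<alpha> u + \<alpha> v) \<and>
     (\<forall>c. \<forall>v\<in>tangent_space M p. \<alpha> (c *\<^sub>R v) = c * \<alpha> v)}"

text \<open>$d_pf$\<close>

definition differential :: "('a, 'e::euclidean_space) manifold \<Rightarrow> 'a \<Rightarrow> ('a \<Rightarrow> real) \<Rightarrow> 'a covector"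
  where "differential M p f = (\<lambda>v. if v \<in> tangent_space M p then v f else 0)"

text \<open>The tangent map of \<open>F\<close>, from \<open>M\<close> to \<open>M'\<close>; the base point is implicit in the vector.\<close>

definition pushforward ::
  "('a, 'e) manifold \<Rightarrow> ('b, 'd::euclidean_space) manifold \<Rightarrow> ('a \<Rightarrow> 'b) \<Rightarrow> 'a tvector \<Rightarrow> 'b tvector"
  where "pushforward M M' F v = (\<lambda>f. if f \<in> smooth_functions M' then v (pullback M F f) else 0)"

text \<open>The tangent map of an inclusion.\<close>

abbreviation incl :: "('a, 'e) manifold \<Rightarrow> ('a, 'd::euclidean_space) manifold \<Rightarrow> 'a tvector \<Rightarrow> 'a tvector"
  where "incl N M \<equiv> pushforward N M (\<lambda>x. x)"

text \<open>Submanifolds carry their own topology and atlas: the inclusion is an injective immersion.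
  Embedded submanifolds are those with \<open>mtop N = subtopology (mtop M) (points N)\<close>.\<close>

definition submanifold ::
  "('a, 'e::euclidean_space) manifold \<Rightarrow> ('a, 'd::euclidean_space) manifold \<Rightarrow> bool" where
  "submanifold N M \<longleftrightarrow> smooth_manifold N \<and> smooth_manifold M \<and> points N \<subseteq> points M \<and>
     smooth_map N M (\<lambda>x. x) \<and> (\<forall>p\<in>points N. inj_on (incl N M) (tangent_space N p))"

definition submersion ::
  "('a, 'e::euclidean_space) manifold \<Rightarrow> ('b, 'd::euclidean_space) manifold \<Rightarrow> ('a \<Rightarrow> 'b) \<Rightarrow> bool" where
  "submersion M M' F \<longleftrightarrow> smooth_map M M' F \<and>
     (\<forall>p\<in>points M. pushforward M M' F ` tangent_space M p = tangent_space M' (F p))"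


section \<open>Subbundles and distributions\<close>

text \<open>Smooth sections along \<open>N\<close> of \<open>W \<subseteq> TM|\<^sub>N\<close>. For \<open>N = M\<close> these are the smooth
  vector fields on \<open>M\<close> with values in \<open>W\<close>.\<close>

definition sections ::
  "('a, 'e::euclidean_space) manifold \<Rightarrow> ('a, 'd::euclidean_space) manifold \<Rightarrow>
   ('a \<Rightarrow> 'a tvector set) \<Rightarrow> ('a \<Rightarrow> 'a tvector) set" where
  "sections M N W = {s. (\<forall>p\<in>points N. s p \<in> tangent_space M p \<and> s p \<in> W p) \<and>
     (\<forall>f\<in>smooth_functions M. (\<lambda>p. if p \<in> points N then s p f else 0) \<in> smooth_functions N)}"

text \<open>A smooth, possibly singular, family of subspaces: every vector extends to a section. By
  means of cut-off functions global sections can be required instead of local ones.\<close>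

definition smooth_family ::
  "('a, 'e::euclidean_space) manifold \<Rightarrow> ('a, 'd::euclidean_space) manifold \<Rightarrow>
   ('a \<Rightarrow> 'a tvector set) \<Rightarrow> bool" where
  "smooth_family M N W \<longleftrightarrow> (\<forall>p\<in>points N. subspace (W p) \<and> W p \<subseteq> tangent_space M p \<and>
     (\<forall>v\<in>W p. \<exists>s\<in>sections M N W. s p = v))"

text \<open>\<open>W\<close> is a vector subbundle of \<open>TM|\<^sub>N\<close>.\<close>

definition vector_subbundle ::
  "('a, 'e::euclidean_space) manifold \<Rightarrow> ('a, 'd::euclidean_space) manifold \<Rightarrow>
   ('a \<Rightarrow> 'a tvector set) \<Rightarrow> bool" where
  "vector_subbundle M N W \<longleftrightarrow> smooth_family M N W \<and> (\<exists>r. \<forall>p\<in>points N. dim (W p) = r)"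

definition integral_manifold ::
  "('a, 'e::euclidean_space) manifold \<Rightarrow> ('a \<Rightarrow> 'a tvector set) \<Rightarrow> ('a, 'e) manifold \<Rightarrow> bool" where
  "integral_manifold M \<theta> L \<longleftrightarrow> submanifold L M \<and> points L \<noteq> {} \<and> connected_space (mtop L) \<and>
     (\<forall>p\<in>points L. incl L M ` tangent_space L p = \<theta> p)"

definition integrable_distribution ::
  "('a, 'e::euclidean_space) manifold \<Rightarrow> ('a \<Rightarrow> 'a tvector set) \<Rightarrow> bool" where
  "integrable_distribution M \<theta> \<longleftrightarrow> smooth_family M M \<theta> \<and>
     (\<forall>p\<in>points M. \<exists>L. integral_manifold M \<theta> L \<and> p \<in> points L)"

text \<open>The leaves of the foliation tangent to \<open>F\<close>: two points lie on the same leaf iff they are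
  joined by a finite chain of connected integral manifolds, each meeting the next (a chain of
  plaques). For integrable \<open>F\<close> this is an equivalence relation on \<open>points N\<close>, and its classes are
  the maximal connected integral manifolds.\<close>

definition same_leaf ::
  "('a, 'e::euclidean_space) manifold \<Rightarrow> ('a \<Rightarrow> 'a tvector set) \<Rightarrow> ('a \<times> 'a) set" where
  "same_leaf N F = {(x, y). \<exists>L. integral_manifold N F L \<and> x \<in> points L \<and> y \<in> points L}\<^sup>+"

definition leaf_of ::
  "('a, 'e::euclidean_space) manifold \<Rightarrow> ('a \<Rightarrow> 'a tvector set) \<Rightarrow> 'a \<Rightarrow> 'a set"
  where "leaf_of N F p = same_leaf N F `` {p}"

text \<open>\<open>Q\<close> is the leaf space $N/\mathcal F$ with a smooth structure making the projection
  \<open>leaf_of N F\<close> a submersion. There is at most one such structure.\<close>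

definition regular_integrable_distribution ::
  "('a, 'e::euclidean_space) manifold \<Rightarrow> ('a \<Rightarrow> 'a tvector set) \<Rightarrow> ('a set, 'e) manifold \<Rightarrow> bool" where
  "regular_integrable_distribution N F Q \<longleftrightarrow>
     vector_subbundle N N F \<and> integrable_distribution N F \<and>
     smooth_manifold Q \<and> points Q = points N // same_leaf N F \<and> submersion N Q (leaf_of N F)"

text \<open>$E \cap TN$, as a distribution on \<open>N\<close>.\<close>

definition tangential_part ::
  "('a, 'e::euclidean_space) manifold \<Rightarrow> ('a, 'd::euclidean_space) manifold \<Rightarrow>
   ('a \<Rightarrow> 'a tvector set) \<Rightarrow> 'a \<Rightarrow> 'a tvector set"
  where "tangential_part M N E p = {v \<in> tangent_space N p. incl N M v \<in> E p}"

text \<open>$C^\infty(M)_W$, where the family \<open>W\<close> is given over the points of \<open>A\<close>.\<close>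

definition annihilated_functions ::
  "('a, 'e::euclidean_space) manifold \<Rightarrow> 'a set \<Rightarrow> ('a \<Rightarrow> 'a tvector set) \<Rightarrow> ('a \<Rightarrow> real) set" where
  "annihilated_functions M A W =
     {f \<in> smooth_functions M. \<forall>p\<in>A. \<forall>v\<in>W p. differential M p f v = 0}"

definition compatible ::
  "('a, 'e::euclidean_space) manifold \<Rightarrow> ('a, 'd::euclidean_space) manifold \<Rightarrow>
   ('a \<Rightarrow> 'a tvector set) \<Rightarrow> ('a \<Rightarrow> 'a tvector set) \<Rightarrow> bool" where
  "compatible M N E \<theta> \<longleftrightarrow>
     restrict_to N ` (annihilated_functions M (points N) E \<inter> annihilated_functions M (points M) \<theta>) =
     annihilated_functions N (points N) (tangential_part M N E)"


section \<open>Exterior algebra\<close>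

text \<open>A \<open>k\<close>-form (\<open>k\<close>-vector) at \<open>p\<close> is a function of lists of \<open>k\<close> tangent (cotangent) vectors
  at \<open>p\<close>, normalised to be 0 on all other lists. \<open>wedge pair V\<close> sends \<open>as\<close> to the function
  of lists over \<open>V\<close> with value \<open>det (pair (as ! i) (bs ! j))\<close> at \<open>bs\<close>.\<close>

definition wedge :: "('x \<Rightarrow> 'y \<Rightarrow> real) \<Rightarrow> 'y set \<Rightarrow> 'x list \<Rightarrow> 'y list \<Rightarrow> real" where
  "wedge pair V as = (\<lambda>bs. if length bs = length as \<and> set bs \<subseteq> V
     then \<Sum>\<sigma> | \<sigma> permutes {..<length as}.
            of_int (sign \<sigma>) * (\<Prod>i<length as. pair (as ! i) (bs ! \<sigma> i))
     else 0)"

definition wedge_covectors ::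
  "('a, 'e::euclidean_space) manifold \<Rightarrow> 'a \<Rightarrow> 'a covector list \<Rightarrow> 'a tvector list \<Rightarrow> real"
  where "wedge_covectors M p = wedge (\<lambda>\<alpha> v. \<alpha> v) (tangent_space M p)"

definition wedge_vectors ::
  "('a, 'e::euclidean_space) manifold \<Rightarrow> 'a \<Rightarrow> 'a tvector list \<Rightarrow> 'a covector list \<Rightarrow> real"
  where "wedge_vectors M p = wedge (\<lambda>v \<alpha>. \<alpha> v) (cotangent_space M p)"

text \<open>$\Lambda^k T_p^*M$\<close>

definition forms :: "('a, 'e::euclidean_space) manifold \<Rightarrow> nat \<Rightarrow> 'a \<Rightarrow> ('a tvector list \<Rightarrow> real) set" where
  "forms M k p = span {wedge_covectors M p \<alpha>s |\<alpha>s. length \<alpha>s = k \<and> set \<alpha>s \<subseteq> cotangent_space M p}"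

text \<open>$Ann^1E_p$. On 0-forms the interior product comes out as 0, as it should.\<close>

definition Ann1 ::
  "nat \<Rightarrow> ('a, 'e::euclidean_space) manifold \<Rightarrow> ('a \<Rightarrow> 'a tvector set) \<Rightarrow> 'a \<Rightarrow>
   ('a tvector list \<Rightarrow> real) set" where
  "Ann1 n M E p = {\<eta> \<in> forms M (n - 1) p. \<forall>v\<in>E p. (\<lambda>vs. \<eta> (v # vs)) = (\<lambda>vs. 0)}"

text \<open>$E_p \wedge \bigwedge^{n-1} T_pM$\<close>

definition wedge_subspace ::
  "nat \<Rightarrow> ('a, 'e::euclidean_space) manifold \<Rightarrow> ('a \<Rightarrow> 'a tvector set) \<Rightarrow> 'a \<Rightarrow>
   ('a covector list \<Rightarrow> real) set" where
  "wedge_subspace n M E p = span {wedge_vectors M p (e # ws) |e ws.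
     e \<in> E p \<and> length ws = n - 1 \<and> set ws \<subseteq> tangent_space M p}"


section \<open>Nambu-Poisson structures\<close>

text \<open>An \<open>n\<close>-ary bracket takes the list of its \<open>n\<close> arguments. \<open>fs[k := g]\<close> replaces the argument
  in position \<open>k\<close>.\<close>

type_synonym 'a bracket = "('a \<Rightarrow> real) list \<Rightarrow> ('a \<Rightarrow> real)"

definition function_lists :: "nat \<Rightarrow> ('a \<Rightarrow> real) set \<Rightarrow> ('a \<Rightarrow> real) list set"
  where "function_lists n C = {fs. length fs = n \<and> set fs \<subseteq> C}"

definition nambu_bracket ::
  "nat \<Rightarrow> ('a, 'e::euclidean_space) manifold \<Rightarrow> 'a bracket \<Rightarrow> bool" where
  "nambu_bracket n M B \<longleftrightarrow>
     (\<forall>fs\<in>function_lists n (smooth_functions M). B fs \<in> smooth_functions M) \<and>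
     \<comment> \<open>multilinearity\<close>
     (\<forall>fs\<in>function_lists n (smooth_functions M). \<forall>k<n.
        \<forall>g\<in>smooth_functions M. \<forall>h\<in>smooth_functions M. \<forall>a b.
          B (fs[k := a *\<^sub>R g + b *\<^sub>R h]) = a *\<^sub>R B (fs[k := g]) + b *\<^sub>R B (fs[k := h])) \<and>
     \<comment> \<open>skew-symmetry\<close>
     (\<forall>fs\<in>function_lists n (smooth_functions M). \<forall>i<n. \<forall>j<n. i \<noteq> j \<longrightarrow>
        B (fs[i := fs ! j, j := fs ! i]) = - B fs) \<and>
     \<comment> \<open>Leibniz rule\<close>
     (\<forall>fs\<in>function_lists (n - 1) (smooth_functions M).
        \<forall>g\<in>smooth_functions M. \<forall>h\<in>smooth_functions M.
          B (fs @ [g * h]) = g * B (fs @ [h]) + B (fs @ [g]) * h) \<and>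
     \<comment> \<open>fundamental identity\<close>
     (\<forall>gs\<in>function_lists (n - 1) (smooth_functions M).
        \<forall>fs\<in>function_lists n (smooth_functions M).
          B (gs @ [B fs]) = (\<Sum>k<n. B (fs[k := B (gs @ [fs ! k])])))"

definition nambu_poisson_manifold ::
  "nat \<Rightarrow> ('a, 'e::euclidean_space) manifold \<Rightarrow> 'a bracket \<Rightarrow> bool" where
  "nambu_poisson_manifold n M B \<longleftrightarrow>
     smooth_manifold M \<and> 1 \<le> n \<and> n \<le> dim (model M) \<and> nambu_bracket n M B"

text \<open>Multivector fields are determined by their values on differentials of functions. Every
  covector at \<open>p\<close> is the differential of a function; \<open>primitive M p \<alpha>\<close> is some such function, and the
  multivector fields below do not depend on the choice.\<close>

definition primitive ::
  "('a, 'e::euclidean_space) manifold \<Rightarrow> 'a \<Rightarrow> 'a covector \<Rightarrow> ('a \<Rightarrow> real)"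
  where "primitive M p \<alpha> = (SOME f. f \<in> smooth_functions M \<and> differential M p f = \<alpha>)"

type_synonym 'a multivector_field = "'a \<Rightarrow> 'a covector list \<Rightarrow> real"

text \<open>$\Pi(df_1, \ldots, df_n) = \{f_1, \ldots, f_n\}$\<close>

definition nambu_tensor ::
  "nat \<Rightarrow> ('a, 'e::euclidean_space) manifold \<Rightarrow> 'a bracket \<Rightarrow> 'a multivector_field" where
  "nambu_tensor n M B p \<alpha>s =
     (if length \<alpha>s = n \<and> set \<alpha>s \<subseteq> cotangent_space M p then B (map (primitive M p) \<alpha>s) p else 0)"

text \<open>The graph of $\Pi^\sharp_p : \Lambda^{n-1}T_p^*M \to T_pM$, the linear map given on decomposable
  forms by $\langle\beta, \Pi^\sharp(\alpha_1 \wedge \cdots \wedge \alpha_{n-1})\rangle =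
  \Pi(\alpha_1, \ldots, \alpha_{n-1}, \beta)$; as a derivation this vector is
  $f \mapsto \Pi(\alpha_1, \ldots, \alpha_{n-1}, d_pf)$. Decomposable forms span, so the graph is the linear
  span of these pairs.\<close>

definition sharp_graph ::
  "nat \<Rightarrow> ('a, 'e::euclidean_space) manifold \<Rightarrow> 'a multivector_field \<Rightarrow> 'a \<Rightarrow>
   (('a tvector list \<Rightarrow> real) \<times> 'a tvector) set" where
  "sharp_graph n M T p = span
     {(wedge_covectors M p \<alpha>s,
       \<lambda>f. if f \<in> smooth_functions M then T p (\<alpha>s @ [differential M p f]) else 0) |\<alpha>s.
      length \<alpha>s = n - 1 \<and> set \<alpha>s \<subseteq> cotangent_space M p}"

text \<open>\<open>X f\<close>\<close>

definition apply_field ::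
  "('a, 'e) manifold \<Rightarrow> ('a \<Rightarrow> 'a tvector) \<Rightarrow> ('a \<Rightarrow> real) \<Rightarrow> 'a \<Rightarrow> real"
  where "apply_field M X f = (\<lambda>p. if p \<in> points M then X p f else 0)"

text \<open>The Lie derivative of an \<open>n\<close>-vector field,
  $(\mathcal L_XT)(\alpha_1, \ldots, \alpha_n) = X(T(\alpha_1, \ldots, \alpha_n)) -
  \sum_k T(\alpha_1, \ldots, \mathcal L_X\alpha_k, \ldots, \alpha_n)$ for 1-forms $\alpha_i$, evaluated on
  $\alpha_i = df_i$, for which $\mathcal L_Xdf_i = d(Xf_i)$.\<close>

definition lie_derivative ::
  "nat \<Rightarrow> ('a, 'e::euclidean_space) manifold \<Rightarrow> ('a \<Rightarrow> 'a tvector) \<Rightarrow> 'a multivector_field \<Rightarrow>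
   'a multivector_field" where
  "lie_derivative n M X T p \<alpha>s =
     (if length \<alpha>s = n \<and> set \<alpha>s \<subseteq> cotangent_space M p
      then let fs = map (primitive M p) \<alpha>s in
        X p (\<lambda>q. if q \<in> points M then T q (map (differential M q) fs) else 0) -
        (\<Sum>k<n. T p (map (differential M p) (fs[k := apply_field M X (fs ! k)])))
      else 0)"

text \<open>\<open>Q\<close> is the leaf space of $F = E \cap TN$. The dimension of \<open>Q\<close> may be less
  than \<open>n\<close>, the bracket then being zero.\<close>

definition reducible ::
  "nat \<Rightarrow> ('a, 'e::euclidean_space) manifold \<Rightarrow> 'a bracket \<Rightarrow> ('a, 'e) manifold \<Rightarrow>
   ('a \<Rightarrow> 'a tvector set) \<Rightarrow> ('a set, 'e) manifold \<Rightarrow> bool" where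
  "reducible n M B N E Q \<longleftrightarrow> (\<exists>B'. nambu_bracket n Q B' \<and>
     (\<forall>fs\<in>function_lists n (smooth_functions Q).
      \<forall>Fs\<in>function_lists n (annihilated_functions M (points N) E).
        (\<forall>k<n. restrict_to N (Fs ! k) = pullback N (leaf_of N (tangential_part M N E)) (fs ! k)) \<longrightarrow>
        pullback N (leaf_of N (tangential_part M N E)) (B' fs) = restrict_to N (B Fs)))"

end

theory Submission
  imports Defs
begin

text \<open>
  Write \<open>F = E \<inter> TN\<close>. The functions on the leaf space are the functions on \<open>N\<close> annihilated by \<open>F\<close>
  (lemmas \<open>pullback_kills\<close>, \<open>descend\<close>). So the reduced bracket has to be the restriction to \<open>N\<close> of
  $\{F_1, \ldots, F_n\}$ for extensions $F_i$ annihilated by \<open>E\<close>, and by compatibility the $F_i$ can be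
  taken to be annihilated by \<open>\<theta>\<close> on all of \<open>M\<close> as well. Three observations make this work.

  First, let \<open>X\<close> be a section of \<open>\<theta>\<close>. Since $X F_i = 0$ on \<open>M\<close>, the Lie derivative of the Nambu tensor
  evaluated on $dF_1, \ldots, dF_n$ is $X\{F_1, \ldots, F_n\}$; on \<open>N\<close> it is 0, because it lies in
  $E \wedge \bigwedge^{n-1} TM$ and the $dF_i$ vanish on \<open>E\<close>. So the bracket of such extensions is
  annihilated by \<open>D\<close> along \<open>N\<close> (\<open>bracket_C_D\<close>), hence its restriction by \<open>F\<close>, and it descends.

  Second, if $G_1, \ldots, G_{n-1}$ are annihilated by \<open>E\<close>, then $dG_1 \wedge \cdots \wedge dG_{n-1}$ lies
  in $Ann^1 E$, and the vector $\{G_1, \ldots, G_{n-1}, \cdot\}$ lies in \<open>TN + D\<close>. It does not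
  distinguish functions that agree on \<open>N\<close> and are annihilated by \<open>D\<close> (\<open>bracket_last_restrict\<close>). So the
  reduced bracket does not depend on the extensions (\<open>bracket_restrict_cong\<close>).

  Third, $\{F_1, \ldots, F_n\}$ is in general not annihilated by \<open>E\<close>, so it is not an admissible
  extension of the reduced bracket. But it is annihilated by \<open>D\<close>, and this is all that the second
  observation asks for; thus the fundamental identity passes from \<open>M\<close> to the leaf space
  (\<open>reduced_nambu\<close>).

  The analytic work goes into the leaf space. A function on \<open>N\<close> annihilated by \<open>F\<close> is constant on the
  leaves, and the induced function on the leaf space is smooth since a submersion has smooth local sections
  (\<open>smooth_local_section\<close>, a consequence of the inverse function theorem). As tangent vectors are
  derivations of the algebra of global smooth functions, the surjectivity of the tangent map of a submersion
  has to be translated into surjectivity of a coordinate derivative (\<open>submersion_coord_onto\<close>); this uses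
  Hadamard's lemma and bump functions.
\<close>

section \<open>Functions of finite differentiability order\<close>

lemma Ck_on_subset:
  assumes "Ck_on k S U f" "V \<subseteq> U" "T \<subseteq> S"
  shows "Ck_on k T V f"
  using assms(1)
proof (induction k arbitrary: f)
  case 0
  then show ?case using assms(2) by (auto intro: continuous_on_subset)
next
  case (Suc k)
  then obtain f' where f': "\<And>x. x \<in> U \<Longrightarrow> (f has_derivative f' x) (at x within U)"
    and Ck: "\<And>v. v \<in> S \<Longrightarrow> Ck_on k S U (\<lambda>x. f' x v)" by auto
  show ?case unfolding Ck_on.simps
    using assms(2,3) by (intro exI[of _ f'] conjI ballI Suc.IH Ck)
      (auto intro: has_derivative_subset[OF f'])
qed

lemma Ck_on_cong:
  assumes "Ck_on k S U f" "\<And>x. x \<in> U \<Longrightarrow> f x = g x"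
  shows "Ck_on k S U g"
proof (cases k)
  case 0
  with assms show ?thesis by (simp cong: continuous_on_cong)
next
  case (Suc j)
  with assms(1) obtain f' where f': "\<And>x. x \<in> U \<Longrightarrow> (f has_derivative f' x) (at x within U)"
    and Ck: "\<And>v. v \<in> S \<Longrightarrow> Ck_on j S U (\<lambda>x. f' x v)" by auto
  have "(g has_derivative f' x) (at x within U)" if "x \<in> U" for x
    by (rule has_derivative_transform[OF that _ f'[OF that]]) (simp add: assms(2))
  with Ck Suc show ?thesis by auto
qed

lemma Ck_on_Suc_imp: "Ck_on (Suc k) S U f \<Longrightarrow> Ck_on k S U f"
proof (induction k arbitrary: f)
  case 0
  then show ?case
    by (auto intro: has_derivative_continuous_on)
next
  case (Suc k)
  from Suc.prems obtain f' where f': "\<And>x. x \<in> U \<Longrightarrow> (f has_derivative f' x) (at x within U)"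
    and Ck: "\<And>v. v \<in> S \<Longrightarrow> Ck_on (Suc k) S U (\<lambda>x. f' x v)"
    by (auto simp only: Ck_on.simps)
  then show ?case unfolding Ck_on.simps
    using Suc.IH by (intro exI[of _ f']) auto
qed

lemma Ck_on_const: "Ck_on k S U (\<lambda>x. c)"
proof (induction k arbitrary: c)
  case (Suc k)
  show ?case unfolding Ck_on.simps
    by (intro exI[of _ "\<lambda>x v. 0"] conjI ballI has_derivative_const Suc)
qed auto

lemma Ck_on_bounded_linear:
  assumes "bounded_linear L"
  shows "Ck_on k S U L"
proof (cases k)
  case 0
  then show ?thesis
    by (simp add: assms linear_continuous_on)
next
  case (Suc j)
  then show ?thesis unfolding Suc Ck_on.simps
    by (intro exI[of _ "\<lambda>x. L"] conjI ballI Ck_on_const bounded_linear_imp_has_derivative assms)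
qed

lemma Ck_on_add:
  assumes "Ck_on k S U f" "Ck_on k S U g"
  shows "Ck_on k S U (\<lambda>x. f x + g x)"
  using assms
proof (induction k arbitrary: f g)
  case 0
  then show ?case by (simp add: continuous_on_add)
next
  case (Suc k)
  from Suc.prems(1) obtain f' where f': "\<And>x. x \<in> U \<Longrightarrow> (f has_derivative f' x) (at x within U)"
    "\<And>v. v \<in> S \<Longrightarrow> Ck_on k S U (\<lambda>x. f' x v)" by auto
  from Suc.prems(2) obtain g' where g': "\<And>x. x \<in> U \<Longrightarrow> (g has_derivative g' x) (at x within U)"
    "\<And>v. v \<in> S \<Longrightarrow> Ck_on k S U (\<lambda>x. g' x v)" by auto
  show ?case unfolding Ck_on.simps
    by (intro exI[of _ "\<lambda>x v. f' x v + g' x v"] conjI ballI has_derivative_add f' g' Suc.IH)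
qed

lemma Ck_on_sum:
  assumes "\<And>i. i \<in> I \<Longrightarrow> Ck_on k S U (f i)"
  shows "Ck_on k S U (\<lambda>x. \<Sum>i\<in>I. f i x)"
  using assms by (induction I rule: infinite_finite_induct) (auto intro: Ck_on_const Ck_on_add)

lemma Ck_on_bilinear:
  assumes "bounded_bilinear pr" "Ck_on k S U f" "Ck_on k S U g"
  shows "Ck_on k S U (\<lambda>x. pr (f x) (g x))"
  using assms(2,3)
proof (induction k arbitrary: f g)
  case 0
  then show ?case by (simp add: bounded_bilinear.continuous_on[OF assms(1)])
next
  case (Suc k)
  from Suc.prems(1) obtain f' where f': "\<And>x. x \<in> U \<Longrightarrow> (f has_derivative f' x) (at x within U)"
    "\<And>v. v \<in> S \<Longrightarrow> Ck_on k S U (\<lambda>x. f' x v)" by auto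
  from Suc.prems(2) obtain g' where g': "\<And>x. x \<in> U \<Longrightarrow> (g has_derivative g' x) (at x within U)"
    "\<And>v. v \<in> S \<Longrightarrow> Ck_on k S U (\<lambda>x. g' x v)" by auto
  note fg = Suc.prems[THEN Ck_on_Suc_imp]
  show ?case unfolding Ck_on.simps
    by (intro exI[of _ "\<lambda>x v. pr (f x) (g' x v) + pr (f' x v) (g x)"] conjI ballI
        bounded_bilinear.FDERIV[OF assms(1)] f' g' Suc.IH Ck_on_add fg)
qed

lemmas Ck_on_scaleR = Ck_on_bilinear[OF bounded_bilinear_scaleR]
lemmas Ck_on_mult = Ck_on_bilinear[OF bounded_bilinear_mult]
lemmas Ck_on_inner = Ck_on_bilinear[OF bounded_bilinear_inner]

lemma Ck_on_linear_comp:
  assumes "bounded_linear L" "Ck_on k S U f"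
  shows "Ck_on k S U (\<lambda>x. L (f x))"
  using assms(2)
proof (induction k arbitrary: f)
  case 0
  then show ?case using assms(1) by (simp add: bounded_linear.continuous_on)
next
  case (Suc k)
  from Suc.prems obtain f' where f': "\<And>x. x \<in> U \<Longrightarrow> (f has_derivative f' x) (at x within U)"
    "\<And>v. v \<in> S \<Longrightarrow> Ck_on k S U (\<lambda>x. f' x v)" by auto
  show ?case unfolding Ck_on.simps
    by (intro exI[of _ "\<lambda>x v. L (f' x v)"] conjI ballI
        bounded_linear.has_derivative[OF assms(1)] f' Suc.IH)
qed

text \<open>Chain rule: the directional derivatives of \<open>g \<circ> f\<close> are combinations of products of directional
  derivatives of \<open>f\<close> with partial derivatives of \<open>g\<close> at \<open>f\<close>, so that the induction on the order
  closes.\<close>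

lemma Ck_on_compose:
  fixes f :: "'e::euclidean_space \<Rightarrow> 'd::euclidean_space"
  assumes "Ck_on k S U f" "Ck_on k UNIV V g" "f ` U \<subseteq> V"
  shows "Ck_on k S U (\<lambda>x. g (f x))"
  using assms(1,2)
proof (induction k arbitrary: g)
  case 0
  then show ?case using assms(3) by (auto intro: continuous_on_compose2)
next
  case (Suc k)
  from Suc.prems(1) obtain f' where f': "\<And>x. x \<in> U \<Longrightarrow> (f has_derivative f' x) (at x within U)"
    "\<And>v. v \<in> S \<Longrightarrow> Ck_on k S U (\<lambda>x. f' x v)" by auto
  from Suc.prems(2) obtain g' where g': "\<And>x. x \<in> V \<Longrightarrow> (g has_derivative g' x) (at x within V)"
    "\<And>v. Ck_on k UNIV V (\<lambda>x. g' x v)" by (auto simp only: Ck_on.simps)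
  let ?D = "\<lambda>x v. \<Sum>b\<in>Basis. (f' x v \<bullet> b) *\<^sub>R g' (f x) b"
  have "((\<lambda>x. g (f x)) has_derivative ?D x) (at x within U)" if "x \<in> U" for x
  proof -
    have fx: "f x \<in> V" using assms(3) that by auto
    have "(g has_derivative g' (f x)) (at (f x) within f ` U)"
      using g'(1)[OF fx] assms(3) by (rule has_derivative_subset)
    then have "((\<lambda>x. g (f x)) has_derivative (\<lambda>v. g' (f x) (f' x v))) (at x within U)"
      by (rule has_derivative_in_compose[OF f'(1)[OF that]])
    moreover have "linear (g' (f x))"
      using g'(1)[OF fx] by (rule has_derivative_linear)
    then have "g' (f x) (\<Sum>b\<in>Basis. (w \<bullet> b) *\<^sub>R b) = (\<Sum>b\<in>Basis. (w \<bullet> b) *\<^sub>R g' (f x) b)" for w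
      by (simp only: linear_sum linear_scale)
    then have "g' (f x) w = (\<Sum>b\<in>Basis. (w \<bullet> b) *\<^sub>R g' (f x) b)" for w
      unfolding euclidean_representation .
    then have "(\<lambda>v. g' (f x) (f' x v)) = ?D x" by (rule ext)
    ultimately show ?thesis by (simp only:)
  qed
  moreover have "Ck_on k S U (\<lambda>x. ?D x v)" if "v \<in> S" for v
    by (intro Ck_on_sum Ck_on_scaleR Ck_on_inner f'(2) that Ck_on_const
        Suc.IH[OF Ck_on_Suc_imp[OF Suc.prems(1)]] g'(2))
  ultimately show ?case unfolding Ck_on.simps by (intro exI[of _ ?D] conjI ballI)
qed

lemma Ck_on_open_Suc:
  assumes "open U"
  shows "Ck_on (Suc k) UNIV U f \<longleftrightarrow> (\<forall>x\<in>U. f differentiable at x) \<and>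
           (\<forall>v. Ck_on k UNIV U (\<lambda>x. frechet_derivative f (at x) v))"
    (is "?L = ?R")
proof
  assume ?L
  then obtain f' where f': "\<And>x. x \<in> U \<Longrightarrow> (f has_derivative f' x) (at x)"
    and Ck: "\<And>v. Ck_on k UNIV U (\<lambda>x. f' x v)"
    using at_within_open[OF _ assms] by auto
  have "f' x = frechet_derivative f (at x)" if "x \<in> U" for x
    using frechet_derivative_at f' that by blast
  then have "Ck_on k UNIV U (\<lambda>x. frechet_derivative f (at x) v)" for v
    by (intro Ck_on_cong[OF Ck]) simp
  with f' show ?R by (auto simp: differentiable_def)
next
  assume ?R
  then have "(f has_derivative frechet_derivative f (at x)) (at x within U)" if "x \<in> U" for x
    using that frechet_derivative_works has_derivative_at_withinI by blast
  with \<open>?R\<close> show ?L unfolding Ck_on.simps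
    by (intro exI[of _ "\<lambda>x. frechet_derivative f (at x)"] conjI ballI) blast+
qed

lemma Ck_on_local:
  assumes "open U" "\<And>x. x \<in> U \<Longrightarrow> \<exists>V. open V \<and> x \<in> V \<and> Ck_on k UNIV (U \<inter> V) f"
  shows "Ck_on k UNIV U f"
  using assms(2)
proof (induction k arbitrary: f)
  case 0
  have "isCont f x" if x: "x \<in> U" for x
  proof -
    obtain V where "open V" "x \<in> V" "continuous_on (U \<inter> V) f"
      using 0[OF x] by auto
    then show ?thesis
      using assms(1) x continuous_on_eq_continuous_at[of "U \<inter> V" f] by blast
  qed
  then show ?case using assms(1) by (simp add: continuous_on_eq_continuous_at)
next
  case (Suc k)
  show ?case unfolding Ck_on_open_Suc[OF assms(1)]
  proof (intro conjI ballI allI Suc.IH)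
    fix x assume "x \<in> U"
    then show "f differentiable at x"
      using Suc.prems[of x] assms(1) by (metis Ck_on_open_Suc IntI open_Int)
  next
    fix v x assume "x \<in> U"
    then show "\<exists>V. open V \<and> x \<in> V \<and> Ck_on k UNIV (U \<inter> V) (\<lambda>x. frechet_derivative f (at x) v)"
      using Suc.prems[of x] assms(1) by (metis Ck_on_open_Suc open_Int)
  qed
qed

text \<open>Calculus on a relatively open subset of a subspace is reduced to calculus on an open set by
  composing with a linear retraction onto the subspace.\<close>

definition retr :: "'e::euclidean_space set \<Rightarrow> 'e \<Rightarrow> 'e" where
  "retr S = (SOME P. linear P \<and> range P \<subseteq> S \<and> (\<forall>x\<in>S. P x = x))"

lemma retr:
  assumes "subspace S"
  shows linear_retr: "linear (retr S)" and retr_in: "retr S x \<in> S"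
    and retr_eq: "x \<in> S \<Longrightarrow> retr S x = x"
proof -
  have "linear (id :: 'a \<Rightarrow> 'a)"
    by (rule linearI) simp_all
  from linear_exists_left_inverse_on[OF this assms]
  obtain P where "range P \<subseteq> S" "linear P" "\<forall>x\<in>S. P (id x) = x" by force
  then have "\<exists>P. linear P \<and> range P \<subseteq> S \<and> (\<forall>x\<in>S. P x = x)"
    by (metis id_apply)
  then have "linear (retr S) \<and> range (retr S) \<subseteq> S \<and> (\<forall>x\<in>S. retr S x = x)"
    unfolding retr_def by (rule someI_ex)
  then show "linear (retr S)" "retr S x \<in> S" "x \<in> S \<Longrightarrow> retr S x = x" by auto
qed

lemma Ck_on_retr:
  assumes S: "subspace S" and U: "U \<subseteq> S"
  shows "Ck_on k S U f \<longleftrightarrow> Ck_on k UNIV (retr S -` U) (\<lambda>x. f (retr S x))"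
proof
  have bl: "bounded_linear (retr S)"
    using linear_retr[OF S] by (rule linear_conv_bounded_linear[THEN iffD1])
  show "Ck_on k UNIV (retr S -` U) (\<lambda>x. f (retr S x))" if "Ck_on k S U f"
    using that
  proof (induction k arbitrary: f)
    case 0
    then show ?case
      using bounded_linear.continuous_on[OF bl continuous_on_id]
      by (auto intro: continuous_on_compose2)
  next
    case (Suc k)
    then obtain f' where f': "\<And>x. x \<in> U \<Longrightarrow> (f has_derivative f' x) (at x within U)"
      and Ck: "\<And>v. v \<in> S \<Longrightarrow> Ck_on k S U (\<lambda>x. f' x v)" by auto
    have "((\<lambda>x. f (retr S x)) has_derivative (\<lambda>v. f' (retr S x) (retr S v)))
        (at x within retr S -` U)" if "x \<in> retr S -` U" for x
      using that by (intro has_derivative_in_compose[OF bounded_linear_imp_has_derivative[OF bl]]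
          has_derivative_subset[OF f']) auto
    with Suc.IH[OF Ck[OF retr_in[OF S]]] show ?case
      unfolding Ck_on.simps
      by (intro exI[of _ "\<lambda>x v. f' (retr S x) (retr S v)"] conjI ballI)
  qed
  assume "Ck_on k UNIV (retr S -` U) (\<lambda>x. f (retr S x))"
  moreover have "U \<subseteq> retr S -` U" using U retr_eq[OF S] by auto
  ultimately have "Ck_on k S U (\<lambda>x. f (retr S x))"
    by (rule Ck_on_subset) simp
  then show "Ck_on k S U f"
    by (rule Ck_on_cong) (use U retr_eq[OF S] in auto)
qed

lemma open_vimage_retr:
  assumes "subspace S" "openin (top_of_set S) U"
  shows "open (retr S -` U)"
proof -
  obtain T where T: "open T" "U = S \<inter> T" using assms(2) openin_open by blast
  have "retr S -` U = retr S -` T" using T retr_in[OF assms(1)] by auto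
  moreover have "continuous_on UNIV (retr S)"
    using linear_retr[OF assms(1)] by (simp add: linear_continuous_on linear_conv_bounded_linear)
  ultimately show ?thesis using T(1) by (simp add: open_vimage)
qed

section \<open>Smooth functions on open sets\<close>

abbreviation smooth :: "'e::euclidean_space set \<Rightarrow> ('e \<Rightarrow> 'b::real_normed_vector) \<Rightarrow> bool"
  where "smooth \<equiv> smooth_on UNIV"

lemma smooth_on_const: "smooth_on S U (\<lambda>x. c)"
  and smooth_on_add: "smooth_on S U f \<Longrightarrow> smooth_on S U g \<Longrightarrow> smooth_on S U (\<lambda>x. f x + g x)"
  and smooth_on_linear_comp: "bounded_linear L \<Longrightarrow> smooth_on S U f \<Longrightarrow> smooth_on S U (\<lambda>x. L (f x))"
  and smooth_on_bounded_linear: "bounded_linear M \<Longrightarrow> smooth_on S U M"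
  and smooth_on_inner: "smooth_on S U p \<Longrightarrow> smooth_on S U q \<Longrightarrow> smooth_on S U (\<lambda>x. p x \<bullet> q x)"
  and smooth_on_mult: "smooth_on S U a \<Longrightarrow> smooth_on S U b \<Longrightarrow> smooth_on S U (\<lambda>x. a x * b x :: real)"
  and smooth_on_subset: "smooth_on S U f \<Longrightarrow> V \<subseteq> U \<Longrightarrow> smooth_on S V f"
  and smooth_on_cong: "smooth_on S U f \<Longrightarrow> (\<And>x. x \<in> U \<Longrightarrow> f x = g x) \<Longrightarrow> smooth_on S U g"
  by (auto simp: smooth_on_def intro: Ck_on_const Ck_on_add Ck_on_linear_comp
      Ck_on_bounded_linear Ck_on_inner Ck_on_mult Ck_on_subset Ck_on_cong)

lemma smooth_on_compose:
  fixes f :: "'e::euclidean_space \<Rightarrow> 'd::euclidean_space"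
  shows "smooth_on S U f \<Longrightarrow> smooth V g \<Longrightarrow> f ` U \<subseteq> V \<Longrightarrow> smooth_on S U (\<lambda>x. g (f x))"
  by (auto simp: smooth_on_def intro: Ck_on_compose)

lemma smooth_on_diff:
  "smooth_on S U f \<Longrightarrow> smooth_on S U g \<Longrightarrow> smooth_on S U (\<lambda>x. f x - g x)"
  using smooth_on_add[OF _ smooth_on_linear_comp[of uminus S U g]]
  by (simp add: bounded_linear_minus)

lemma smooth_on_retr:
  assumes "subspace S" "U \<subseteq> S"
  shows "smooth_on S U f \<longleftrightarrow> smooth (retr S -` U) (\<lambda>x. f (retr S x))"
  unfolding smooth_on_def Ck_on_retr[OF assms] ..

lemma smooth_local:
  assumes "open U" "\<And>x. x \<in> U \<Longrightarrow> \<exists>V. open V \<and> x \<in> V \<and> smooth (U \<inter> V) f"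
  shows "smooth U f"
  unfolding smooth_on_def
proof
  fix k show "Ck_on k UNIV U f"
    using assms(2) unfolding smooth_on_def by (intro Ck_on_local[OF assms(1)]) metis
qed

lemma smooth_differentiable:
  assumes "open U" "smooth U f" "x \<in> U"
  shows "(f has_derivative frechet_derivative f (at x)) (at x)"
proof -
  have "Ck_on (Suc 0) UNIV U f" using assms(2) unfolding smooth_on_def ..
  then show ?thesis unfolding Ck_on_open_Suc[OF assms(1)]
    using assms(3) frechet_derivative_works by blast
qed

lemma smooth_frechet:
  assumes "open U" "smooth U f"
  shows "smooth U (\<lambda>x. frechet_derivative f (at x) v)"
  unfolding smooth_on_def
proof
  fix k
  have "Ck_on (Suc k) UNIV U f" using assms(2) unfolding smooth_on_def ..
  then show "Ck_on k UNIV U (\<lambda>x. frechet_derivative f (at x) v)"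
    unfolding Ck_on_open_Suc[OF assms(1)] by blast
qed

lemma smooth_continuous: "smooth_on S U f \<Longrightarrow> continuous_on U f"
  unfolding smooth_on_def using Ck_on.simps(1) by blast

section \<open>A bump function\<close>

definition flat :: "nat \<Rightarrow> real \<Rightarrow> real"
  where "flat j t = (if t > 0 then inverse t ^ j * exp (- inverse t) else 0)"

lemma flat_tendsto: "(flat j \<longlongrightarrow> 0) (at 0)"
proof (rule filterlim_split_at)
  have "(flat j \<longlongrightarrow> 0) (at_left 0) \<longleftrightarrow> ((\<lambda>t. 0::real) \<longlongrightarrow> 0) (at_left (0::real))"
    by (intro tendsto_cong) (auto simp: flat_def eventually_at_filter)
  then show "(flat j \<longlongrightarrow> 0) (at_left 0)" by simp
  have "((\<lambda>t. inverse t ^ j / exp (inverse t)) \<longlongrightarrow> 0) (at_right (0::real))"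
    by (rule filterlim_compose[OF tendsto_power_div_exp_0 filterlim_inverse_at_top_right])
  moreover have "(flat j \<longlongrightarrow> 0) (at_right 0) \<longleftrightarrow>
      ((\<lambda>t. inverse t ^ j / exp (inverse t)) \<longlongrightarrow> 0) (at_right (0::real))"
    by (intro tendsto_cong) (auto simp: flat_def eventually_at_filter exp_minus divide_inverse)
  ultimately show "(flat j \<longlongrightarrow> 0) (at_right 0)" by simp
qed

text \<open>The family is closed under differentiation, which makes every member smooth.\<close>

lemma flat_deriv:
  "(flat j has_real_derivative (- real j * flat (j + 1) t + flat (j + 2) t)) (at t)"
proof -
  consider "t > 0" | "t < 0" | "t = 0" by linarith
  then show ?thesis
  proof cases
    case 1
    have "((\<lambda>t. inverse t ^ j * exp (- inverse t)) has_real_derivative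
       (- real j * flat (j + 1) t + flat (j + 2) t)) (at t)"
    proof (cases j)
      case 0
      then show ?thesis using 1
        by (auto intro!: derivative_eq_intros simp: flat_def field_simps power2_eq_square)
    next
      case (Suc i)
      have "((\<lambda>t. inverse t ^ j) has_real_derivative - (real j * inverse t ^ (j + 1))) (at t)"
        using DERIV_power[OF DERIV_inverse'[OF DERIV_ident, of t UNIV], of j] 1 Suc
        by (simp add: algebra_simps)
      moreover have "((\<lambda>t. exp (- inverse t)) has_real_derivative exp (- inverse t) * (inverse t)\<^sup>2) (at t)"
        using 1 by (auto intro!: derivative_eq_intros simp: power2_eq_square)
      ultimately show ?thesis
        using 1 by (auto dest: DERIV_mult simp: flat_def algebra_simps power2_eq_square)
    qed
    then show ?thesis
      by (rule has_field_derivative_transform_within_open[where S = "{0<..}"])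
        (use 1 in \<open>auto simp: flat_def\<close>)
  next
    case 2
    have "((\<lambda>t. 0) has_real_derivative (- real j * flat (j + 1) t + flat (j + 2) t)) (at t)"
      using 2 by (simp add: flat_def)
    then show ?thesis
      by (rule has_field_derivative_transform_within_open[where S = "{..<0}"])
        (use 2 in \<open>auto simp: flat_def\<close>)
  next
    case 3
    have "((\<lambda>h. (flat j (0 + h) - flat j 0) / h) \<longlongrightarrow> 0) (at 0) \<longleftrightarrow> (flat (j + 1) \<longlongrightarrow> 0) (at 0)"
      by (intro tendsto_cong) (auto simp: flat_def eventually_at_filter divide_inverse)
    then have "(flat j has_real_derivative 0) (at 0)"
      unfolding DERIV_def using flat_tendsto by blast
    then show ?thesis using 3 by (simp add: flat_def)
  qed
qed

lemma smooth_flat: "smooth U (flat j)"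
proof -
  have "Ck_on k UNIV UNIV (flat j)" for k
  proof (induction k arbitrary: j)
    case 0
    show ?case
      using flat_deriv DERIV_isCont continuous_at_imp_continuous_on by (metis Ck_on.simps(1))
  next
    case (Suc k)
    have "Ck_on k UNIV UNIV (\<lambda>x. v * (- real j * flat (j + 1) x + flat (j + 2) x))" for v
      by (intro Ck_on_mult Ck_on_add Ck_on_const Suc)
    then show ?case
      unfolding Ck_on.simps using flat_deriv[of j, unfolded has_field_derivative_def]
      by (intro exI[of _ "\<lambda>x v. v * (- real j * flat (j + 1) x + flat (j + 2) x)"])
        (auto simp: mult_commute_abs)
  qed
  then have "smooth UNIV (flat j)" by (simp add: smooth_on_def)
  then show ?thesis by (rule smooth_on_subset) simp
qed

definition bump :: "'e::euclidean_space \<Rightarrow> real \<Rightarrow> 'e \<Rightarrow> real"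
  where "bump x0 r x = flat 0 (r\<^sup>2 - (x - x0) \<bullet> (x - x0)) / flat 0 (r\<^sup>2)"

lemma smooth_bump: "smooth U (bump x0 r)"
proof -
  have "smooth U (\<lambda>x. x - x0)"
    by (intro smooth_on_diff smooth_on_const smooth_on_bounded_linear[OF bounded_linear_ident])
  then have "smooth U (\<lambda>x. r\<^sup>2 - (x - x0) \<bullet> (x - x0))"
    by (intro smooth_on_diff[of _ _ "\<lambda>x. r\<^sup>2"] smooth_on_const smooth_on_inner)
  then have "smooth U (\<lambda>x. flat 0 (r\<^sup>2 - (x - x0) \<bullet> (x - x0)))"
    by (rule smooth_on_compose[OF _ smooth_flat[of UNIV]]) simp
  then have "smooth U (\<lambda>x. flat 0 (r\<^sup>2 - (x - x0) \<bullet> (x - x0)) * inverse (flat 0 (r\<^sup>2)))"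
    by (intro smooth_on_mult smooth_on_const)
  then show ?thesis by (simp add: bump_def[abs_def] divide_inverse)
qed

lemma bump_center: "r > 0 \<Longrightarrow> bump x0 r x0 = 1"
  by (simp add: bump_def flat_def)

lemma bump_outside:
  assumes "0 \<le> r" "x \<notin> ball x0 r"
  shows "bump x0 r x = 0"
proof -
  have "r \<le> norm (x - x0)" using assms(2) by (simp add: dist_norm norm_minus_commute)
  then have "r\<^sup>2 \<le> (norm (x - x0))\<^sup>2" using assms(1) by (intro power_mono)
  then show ?thesis by (simp add: bump_def flat_def dot_square_norm)
qed

section \<open>Hadamard's lemma\<close>

lemma segment_in_ball:
  fixes x0 :: "'e::real_normed_vector"
  assumes "x \<in> ball x0 r" "t \<in> {0..1::real}"
  shows "x0 + t *\<^sub>R (x - x0) \<in> ball x0 r"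
proof -
  have "norm (t *\<^sub>R (x - x0)) \<le> norm (x - x0)"
    using assms(2) by (simp add: mult_left_le_one_le)
  then show ?thesis using assms(1) by (simp add: dist_norm norm_minus_commute)
qed

text \<open>Hadamard's lemma integrates along the segments issuing from the centre of a ball.\<close>

lemma continuous_on_segments:
  fixes f :: "'e::real_normed_vector \<Rightarrow> 'b::topological_space"
  assumes "continuous_on (ball x0 r) f"
  shows "continuous_on (ball x0 r \<times> cbox 0 (1::real)) (\<lambda>p. f (x0 + snd p *\<^sub>R (fst p - x0)))"
    and "x \<in> ball x0 r \<Longrightarrow> continuous_on (cbox 0 (1::real)) (\<lambda>t. f (x0 + t *\<^sub>R (x - x0)))"
proof -
  show "continuous_on (ball x0 r \<times> cbox 0 (1::real)) (\<lambda>p. f (x0 + snd p *\<^sub>R (fst p - x0)))"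
  proof (rule continuous_on_compose2[OF assms])
    show "(\<lambda>p. x0 + snd p *\<^sub>R (fst p - x0)) ` (ball x0 r \<times> cbox 0 (1::real)) \<subseteq> ball x0 r"
      by (auto simp del: mem_ball intro: segment_in_ball)
  qed (intro continuous_intros)
  assume "x \<in> ball x0 r"
  then show "continuous_on (cbox 0 (1::real)) (\<lambda>t. f (x0 + t *\<^sub>R (x - x0)))"
    by (intro continuous_on_compose2[OF assms] continuous_intros)
       (auto simp del: mem_ball intro: segment_in_ball)
qed

lemma Ck_on_continuous: "Ck_on k S U f \<Longrightarrow> continuous_on U f"
  by (induction k) (simp, blast dest: Ck_on_Suc_imp)

text \<open>Each differentiation in \<open>x\<close> brings out one more factor \<open>t\<close>; the weights \<open>t ^ j\<close> make the statement
  strong enough for the induction on the order.\<close>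

lemma Ck_radial_mean:
  fixes h :: "'e::euclidean_space \<Rightarrow> real"
  assumes "Ck_on k UNIV (ball x0 r) h"
  shows "Ck_on k UNIV (ball x0 r) (\<lambda>x. integral (cbox 0 1) (\<lambda>t. t ^ j * h (x0 + t *\<^sub>R (x - x0))))"
  using assms
proof (induction k arbitrary: h j)
  case 0
  have "continuous_on (ball x0 r \<times> cbox 0 1) (\<lambda>p. snd p ^ j * h (x0 + snd p *\<^sub>R (fst p - x0)))"
    using 0 by (intro continuous_intros continuous_on_segments) simp
  then show ?case
    using integral_continuous_on_param[of "ball x0 r" 0 1 "\<lambda>x t. t ^ j * h (x0 + t *\<^sub>R (x - x0))"]
    by (simp add: split_beta)
next
  case (Suc k)
  let ?B = "ball x0 r"
  let ?D = "\<lambda>y. frechet_derivative h (at y)"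
  let ?H = "\<lambda>y. Blinfun (?D y)"
  let ?s = "\<lambda>x t. x0 + t *\<^sub>R (x - x0)"
  have der: "(h has_derivative ?D y) (at y)" and CkD: "Ck_on k UNIV ?B (\<lambda>x. ?D x v)"
    if "y \<in> ?B" for y v
    using Suc.prems[unfolded Ck_on_open_Suc[OF open_ball]] that frechet_derivative_works by blast+
  have bl: "blinfun_apply (?H y) = ?D y" if "y \<in> ?B" for y
    using der[OF that] by (intro bounded_linear_Blinfun_apply has_derivative_bounded_linear)
  have contD: "continuous_on ?B (\<lambda>y. ?D y v)" for v
  proof (cases "?B = {}")
    case False
    then obtain y where "y \<in> ?B" by blast
    from CkD[OF this] show ?thesis by (rule Ck_on_continuous)
  next
    case True
    then show ?thesis by (simp only: continuous_on_empty)
  qed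
  have contH: "continuous_on ?B ?H"
  proof (rule continuous_on_blinfun_componentwise)
    fix i :: 'e
    show "continuous_on ?B (\<lambda>y. ?H y i)"
      using contD[of i] by (rule continuous_on_eq) (simp add: bl)
  qed
  have conth: "continuous_on ?B h"
    using Suc.prems by (rule Ck_on_continuous)
  let ?fx = "\<lambda>x t. t ^ Suc j *\<^sub>R ?H (?s x t)"
  have derF: "((\<lambda>x. integral (cbox 0 1) (\<lambda>t. t ^ j * h (?s x t))) has_derivative
      integral (cbox 0 1) (?fx x)) (at x within ?B)" if x: "x \<in> ?B" for x
  proof (rule leibniz_rule[OF _ _ _ x])
    fix x and t :: real assume xt: "x \<in> ?B" "t \<in> cbox 0 1"
    then have s: "?s x t \<in> ?B" using segment_in_ball[of x x0 r t] by simp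
    have "((\<lambda>x. ?s x t) has_derivative (\<lambda>v. t *\<^sub>R v)) (at x)"
      by (auto intro!: derivative_eq_intros)
    then have "((\<lambda>x. h (?s x t)) has_derivative (\<lambda>v. ?D (?s x t) (t *\<^sub>R v))) (at x)"
      by (rule has_derivative_compose) (rule der[OF s])
    then have "((\<lambda>x. t ^ j * h (?s x t)) has_derivative (\<lambda>v. t ^ j * ?D (?s x t) (t *\<^sub>R v))) (at x)"
      by (rule has_derivative_mult_right)
    moreover have "?D (?s x t) (t *\<^sub>R v) = t * ?D (?s x t) v" for v
      using linear_scale[OF has_derivative_linear[OF der[OF s]]] by simp
    then have "(\<lambda>v. t ^ j * ?D (?s x t) (t *\<^sub>R v)) = blinfun_apply (?fx x t)"
      by (simp add: fun_eq_iff scaleR_blinfun.rep_eq bl[OF s])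
    ultimately show "((\<lambda>x. t ^ j * h (?s x t)) has_derivative blinfun_apply (?fx x t)) (at x within ?B)"
      by (simp add: has_derivative_at_withinI)
  next
    fix x assume "x \<in> ?B"
    then have "continuous_on (cbox 0 1) (\<lambda>t. t ^ j * h (?s x t))"
      by (intro continuous_on_mult continuous_on_power continuous_on_id
          continuous_on_segments(2)[OF conth])
    then show "(\<lambda>t. t ^ j * h (?s x t)) integrable_on cbox 0 1"
      by (rule integrable_continuous)
  next
    show "continuous_on (?B \<times> cbox 0 1) (\<lambda>(x, t). ?fx x t)"
      unfolding split_beta by (intro continuous_intros continuous_on_segments contH)
  qed simp
  have app: "integral (cbox 0 1) (?fx x) v = integral (cbox 0 1) (\<lambda>t. t ^ Suc j * ?D (?s x t) v)"
    if x: "x \<in> ?B" for x v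
  proof -
    have "continuous_on (cbox 0 1) (?fx x)"
      using x by (intro continuous_on_scaleR continuous_on_power continuous_on_id
          continuous_on_segments(2)[OF contH])
    then have "integral (cbox 0 1) (?fx x) v = integral (cbox 0 1) (\<lambda>t. ?fx x t v)"
      by (intro blinfun_apply_integral integrable_continuous)
    also have "\<dots> = integral (cbox 0 1) (\<lambda>t. t ^ Suc j * ?D (?s x t) v)"
      using segment_in_ball[OF x] by (intro integral_cong) (simp add: scaleR_blinfun.rep_eq bl)
    finally show ?thesis .
  qed
  show ?case unfolding Ck_on.simps
  proof (intro exI[of _ "\<lambda>x. blinfun_apply (integral (cbox 0 1) (?fx x))"] conjI ballI derF)
    fix v :: 'e
    show "Ck_on k UNIV ?B (\<lambda>x. integral (cbox 0 1) (?fx x) v)"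
    proof (cases "?B = {}")
      case False
      then obtain y where "y \<in> ?B" by blast
      from Suc.IH[OF CkD[OF this], of "Suc j" v] show ?thesis
        by (rule Ck_on_cong) (erule app[symmetric])
    next
      case True
      have "Ck_on k UNIV {} (\<lambda>x::'e. 0::real)" by (rule Ck_on_const)
      then show ?thesis unfolding True by (rule Ck_on_cong) simp
    qed
  qed assumption
qed

text \<open>The factor \<open>g b\<close> is the mean of the partial derivative in direction \<open>b\<close> over the segment from
  \<open>x0\<close>, and the formula is the fundamental theorem of calculus on that segment.\<close>

lemma hadamard:
  fixes h :: "'e::euclidean_space \<Rightarrow> real"
  assumes "smooth (ball x0 r) h" "r > 0"
  obtains g where "\<And>b. smooth (ball x0 r) (g b)" "\<And>b. g b x0 = frechet_derivative h (at x0) b"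
    "\<And>x. x \<in> ball x0 r \<Longrightarrow> h x = h x0 + (\<Sum>b\<in>Basis. ((x - x0) \<bullet> b) * g b x)"
proof
  let ?B = "ball x0 r"
  let ?D = "\<lambda>y. frechet_derivative h (at y)"
  let ?g = "\<lambda>b x. integral (cbox 0 1) (\<lambda>t::real. ?D (x0 + t *\<^sub>R (x - x0)) b)"
  note smD = smooth_frechet[OF open_ball assms(1)]
  note der = smooth_differentiable[OF open_ball assms(1)]
  show "smooth ?B (?g b)" for b
    using smD[of b] Ck_radial_mean[of _ x0 r "\<lambda>y. ?D y b" 0] by (simp add: smooth_on_def)
  show "?g b x0 = ?D x0 b" for b by simp
  fix x assume x: "x \<in> ?B"
  let ?s = "\<lambda>t. x0 + t *\<^sub>R (x - x0)"
  have s: "?s t \<in> ?B" if "t \<in> {0..1}" for t using segment_in_ball[OF x that] .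
  have D: "?D (?s t) (x - x0) = (\<Sum>b\<in>Basis. ((x - x0) \<bullet> b) * ?D (?s t) b)" if "t \<in> {0..1}" for t
  proof -
    have "linear (?D (?s t))" using der[OF s[OF that]] by (rule has_derivative_linear)
    then have "?D (?s t) (\<Sum>b\<in>Basis. ((x - x0) \<bullet> b) *\<^sub>R b) = (\<Sum>b\<in>Basis. ((x - x0) \<bullet> b) *\<^sub>R ?D (?s t) b)"
      by (simp only: linear_sum linear_scale)
    then show ?thesis unfolding euclidean_representation by simp
  qed
  have "((\<lambda>t. ?D (?s t) (x - x0)) has_integral (h (?s 1) - h (?s 0))) {0..1}"
  proof (rule fundamental_theorem_of_calculus)
    fix t :: real assume t: "t \<in> {0..1}"
    have "(?s has_derivative (\<lambda>u. u *\<^sub>R (x - x0))) (at t within {0..1})"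
      by (auto intro!: derivative_eq_intros)
    then have "((\<lambda>t. h (?s t)) has_derivative (\<lambda>u. ?D (?s t) (u *\<^sub>R (x - x0)))) (at t within {0..1})"
      by (rule has_derivative_compose) (rule der[OF s[OF t]])
    then show "((\<lambda>t. h (?s t)) has_vector_derivative ?D (?s t) (x - x0)) (at t within {0..1})"
      unfolding has_vector_derivative_def
      using linear_scale[OF has_derivative_linear[OF der[OF s[OF t]]]] by simp
  qed simp
  then have "h x - h x0 = integral (cbox 0 1) (\<lambda>t. ?D (?s t) (x - x0))"
    by (simp add: integral_unique)
  also have "\<dots> = integral (cbox 0 1) (\<lambda>t. \<Sum>b\<in>Basis. ((x - x0) \<bullet> b) * ?D (?s t) b)"
    by (intro integral_cong D) simp
  also have "\<dots> = (\<Sum>b\<in>Basis. integral (cbox 0 1) (\<lambda>t. ((x - x0) \<bullet> b) * ?D (?s t) b))"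
  proof (rule integral_sum)
    fix b :: 'e
    have "continuous_on ?B (\<lambda>y. ?D y b)" by (rule smooth_continuous[OF smD])
    then show "(\<lambda>t. ((x - x0) \<bullet> b) * ?D (?s t) b) integrable_on cbox 0 1"
      using x by (intro integrable_continuous continuous_intros continuous_on_segments)
  qed simp
  also have "\<dots> = (\<Sum>b\<in>Basis. ((x - x0) \<bullet> b) * ?g b x)" by simp
  finally show "h x = h x0 + (\<Sum>b\<in>Basis. ((x - x0) \<bullet> b) * ?g b x)" by simp
qed

section \<open>Smoothness of local inverses\<close>

text \<open>The resolvent identity $A(x) - A(x_0) = A(x)\,(L(x_0) - L(x))\,A(x_0)$ first bounds the norm of
  $A(x)$ by twice that of $A(x_0)$ near $x_0$ and then yields the continuity.\<close>

lemma isCont_blinfun_inverse: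
  fixes L A :: "'e::euclidean_space \<Rightarrow> 'e \<Rightarrow>\<^sub>L 'e"
  assumes U: "open U" "x0 \<in> U" and L: "continuous_on U L"
    and inv: "\<And>x. x \<in> U \<Longrightarrow> A x o\<^sub>L L x = id_blinfun" "\<And>x. x \<in> U \<Longrightarrow> L x o\<^sub>L A x = id_blinfun"
  shows "isCont A x0"
proof -
  have L0: "(L \<longlongrightarrow> L x0) (at x0)"
    using L U by (meson continuous_on_eq_continuous_at isContD)
  have *: "A x - A x0 = A x o\<^sub>L (L x0 - L x) o\<^sub>L A x0" if "x \<in> U" for x
  proof (rule blinfun_eqI)
    fix w
    have "A x0 (L x0 w) = w" "L x0 (A x0 w) = w" "A x (L x (A x0 w)) = A x0 w"
      using inv[OF that] inv[OF U(2)] by (metis blinfun_apply_blinfun_compose blinfun_apply_id_blinfun)+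
    then show "(A x - A x0) w = (A x o\<^sub>L (L x0 - L x) o\<^sub>L A x0) w"
      by (simp add: blinfun.diff_left blinfun.diff_right)
  qed
  have n: "norm (A x - A x0) \<le> norm (A x) * norm (L x0 - L x) * norm (A x0)" if "x \<in> U" for x
    unfolding *[OF that]
    by (meson dual_order.trans mult_right_mono norm_blinfun_compose norm_ge_zero)
  have d0: "((\<lambda>x. norm (L x0 - L x) * norm (A x0)) \<longlongrightarrow> 0) (at x0)"
  proof -
    have "((\<lambda>x. norm (L x0 - L x) * norm (A x0)) \<longlongrightarrow> norm (L x0 - L x0) * norm (A x0)) (at x0)"
      by (intro tendsto_intros L0)
    then show ?thesis by simp
  qed
  have ev: "\<forall>\<^sub>F x in at x0. norm (A x - A x0) \<le> 2 * norm (A x0) * (norm (L x0 - L x) * norm (A x0))"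
  proof -
    have "\<forall>\<^sub>F x in at x0. norm (L x0 - L x) * norm (A x0) < 1/2"
      using order_tendstoD(2)[OF d0, of "1/2"] by simp
    moreover have "\<forall>\<^sub>F x in at x0. x \<in> U"
      using U by (rule eventually_at_in_open')
    ultimately show ?thesis
    proof eventually_elim
      case (elim x)
      let ?d = "norm (L x0 - L x) * norm (A x0)"
      have nx: "norm (A x - A x0) \<le> norm (A x) * ?d" using n elim(2) by (simp add: mult.assoc)
      also have "\<dots> \<le> norm (A x) * (1/2)" using elim(1) by (intro mult_left_mono) auto
      finally have "norm (A x) \<le> 2 * norm (A x0)"
        using norm_triangle_sub[of "A x" "A x0"] by simp
      then have "norm (A x) * ?d \<le> 2 * norm (A x0) * ?d" by (intro mult_right_mono) auto
      with nx show ?case by linarith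
    qed
  qed
  have "((\<lambda>x. A x - A x0) \<longlongrightarrow> 0) (at x0)"
    by (rule Lim_null_comparison[OF ev]) (use tendsto_mult_left[OF d0] in auto)
  then show ?thesis by (simp add: isCont_def LIM_zero_iff)
qed

text \<open>A product rule in which the operator factor is only continuous: the other factor vanishes at
  the point.\<close>

lemma has_derivative_blinfun_apply_zero:
  fixes A :: "'e::euclidean_space \<Rightarrow> 'd::real_normed_vector \<Rightarrow>\<^sub>L 'c::real_normed_vector"
  assumes A: "isCont A x0" and p: "(p has_derivative D) (at x0)" "p x0 = 0"
  shows "((\<lambda>x. A x (p x)) has_derivative (\<lambda>v. A x0 (D v))) (at x0)"
proof -
  have D: "bounded_linear D" using p(1) by (rule has_derivative_bounded_linear)
  have "((\<lambda>x. (A x - A x0) (p x)) has_derivative (\<lambda>v. 0)) (at x0)"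
    unfolding has_derivative_iff_norm
  proof
    have lim: "((\<lambda>x. norm (A x - A x0) * (norm (p x - D (x - x0)) / norm (x - x0) + onorm D)) \<longlongrightarrow> 0) (at x0)"
    proof -
      have "((\<lambda>x. norm (p x - D (x - x0)) / norm (x - x0)) \<longlongrightarrow> 0) (at x0)"
        using p by (simp add: has_derivative_iff_norm)
      moreover have "((\<lambda>x. norm (A x - A x0)) \<longlongrightarrow> 0) (at x0)"
        using A by (simp add: isCont_def LIM_zero_iff tendsto_norm_zero_iff)
      ultimately have "((\<lambda>x. norm (A x - A x0) * (norm (p x - D (x - x0)) / norm (x - x0) + onorm D)) \<longlongrightarrow> 0 * (0 + onorm D)) (at x0)"
        by (intro tendsto_intros)
      then show ?thesis by simp
    qed
    have "norm (norm ((A x - A x0) (p x) - (A x0 - A x0) (p x0) - 0) / norm (x - x0))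
       \<le> norm (A x - A x0) * (norm (p x - D (x - x0)) / norm (x - x0) + onorm D)" if "x \<noteq> x0" for x
    proof -
      have "norm (p x) \<le> norm (p x - D (x - x0)) + norm (D (x - x0))"
        using norm_triangle_sub by (simp add: add.commute)
      also have "norm (D (x - x0)) \<le> onorm D * norm (x - x0)" by (rule onorm[OF D])
      finally have "norm (p x) / norm (x - x0) \<le> norm (p x - D (x - x0)) / norm (x - x0) + onorm D"
        using that by (simp add: field_simps)
      moreover have "norm ((A x - A x0) (p x)) / norm (x - x0) \<le> norm (A x - A x0) * (norm (p x) / norm (x - x0))"
        using norm_blinfun[of "A x - A x0" "p x"] by (simp add: divide_right_mono)
      ultimately have "norm ((A x - A x0) (p x)) / norm (x - x0)
          \<le> norm (A x - A x0) * (norm (p x - D (x - x0)) / norm (x - x0) + onorm D)"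
        by (meson dual_order.trans mult_left_mono norm_ge_zero)
      then show ?thesis by simp
    qed
    then show "((\<lambda>x. norm ((A x - A x0) (p x) - (A x0 - A x0) (p x0) - 0) / norm (x - x0)) \<longlongrightarrow> 0) (at x0)"
      by (intro Lim_null_comparison[OF _ lim]) (auto simp: eventually_at_filter)
  qed simp
  moreover have "((\<lambda>x. A x0 (p x)) has_derivative (\<lambda>v. A x0 (D v))) (at x0)"
    by (rule bounded_linear.has_derivative[OF blinfun.bounded_linear_right p(1)])
  ultimately have "((\<lambda>x. (A x - A x0) (p x) + A x0 (p x)) has_derivative (\<lambda>v. 0 + A x0 (D v))) (at x0)"
    by (rule has_derivative_add)
  then show ?thesis by (simp add: blinfun.diff_left)
qed

text \<open>Differentiating the inverse operator in direction \<open>v\<close> gives \<open>- A \<circ> \<partial>\<^sub>v L \<circ> A\<close>; written out in a basis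
  this involves the entries of \<open>A\<close> only through products, and the order of differentiability can be
  raised step by step.\<close>

lemma smooth_blinfun_inverse:
  fixes L A :: "'e::euclidean_space \<Rightarrow> 'e \<Rightarrow>\<^sub>L 'e"
  assumes U: "open U" and L: "\<And>v. smooth U (\<lambda>x. L x v)"
    and inv: "\<And>x. x \<in> U \<Longrightarrow> A x o\<^sub>L L x = id_blinfun" "\<And>x. x \<in> U \<Longrightarrow> L x o\<^sub>L A x = id_blinfun"
  shows "smooth U (\<lambda>x. A x w)"
proof -
  have contL: "continuous_on U L"
    by (intro continuous_on_blinfun_componentwise smooth_continuous[OF L])
  let ?d = "\<lambda>b x v. frechet_derivative (\<lambda>y. L y b) (at x) v"
  let ?D = "\<lambda>w x v. - (\<Sum>b\<in>Basis. \<Sum>c\<in>Basis. ((A x w \<bullet> b) * (?d b x v \<bullet> c)) *\<^sub>R A x c)"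
  have expand: "T v = (\<Sum>b\<in>Basis. (v \<bullet> b) *\<^sub>R T b)" for T :: "'e \<Rightarrow>\<^sub>L 'e" and v
  proof -
    have "T (\<Sum>b\<in>Basis. (v \<bullet> b) *\<^sub>R b) = (\<Sum>b\<in>Basis. (v \<bullet> b) *\<^sub>R T b)"
      by (simp only: blinfun.sum_right blinfun.scaleR_right)
    then show ?thesis unfolding euclidean_representation .
  qed
  have der: "((\<lambda>x. A x w) has_derivative ?D w x0) (at x0)" if x0: "x0 \<in> U" for x0 w
  proof -
    let ?a = "A x0 w"
    let ?p = "\<lambda>x. w - (\<Sum>b\<in>Basis. (?a \<bullet> b) *\<^sub>R L x b)"
    have p: "?p x = w - L x ?a" for x using expand[of "L x" ?a] by simp
    have d: "(?p has_derivative (\<lambda>v. 0 - (\<Sum>b\<in>Basis. (?a \<bullet> b) *\<^sub>R ?d b x0 v))) (at x0)"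
      by (intro has_derivative_diff has_derivative_const has_derivative_sum
          has_derivative_scaleR_right smooth_differentiable[OF U L x0])
    have z: "?p x0 = 0"
      unfolding p using inv(2)[OF x0] by (metis blinfun_apply_blinfun_compose blinfun_apply_id_blinfun diff_self)
    have c: "isCont A x0"
      by (rule isCont_blinfun_inverse[OF U x0 contL]) (erule inv)+
    have "((\<lambda>x. A x (?p x)) has_derivative (\<lambda>v. A x0 (0 - (\<Sum>b\<in>Basis. (?a \<bullet> b) *\<^sub>R ?d b x0 v)))) (at x0)"
      by (rule has_derivative_blinfun_apply_zero[OF c d z])
    then have "((\<lambda>x. ?a + A x (?p x)) has_derivative (\<lambda>v. 0 + A x0 (0 - (\<Sum>b\<in>Basis. (?a \<bullet> b) *\<^sub>R ?d b x0 v)))) (at x0)"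
      by (intro has_derivative_add has_derivative_const)
    moreover have "0 + A x0 (0 - (\<Sum>b\<in>Basis. (?a \<bullet> b) *\<^sub>R ?d b x0 v)) = ?D w x0 v" for v
    proof -
      have "A x0 (?d b x0 v) = (\<Sum>c\<in>Basis. (?d b x0 v \<bullet> c) *\<^sub>R A x0 c)" for b by (rule expand)
      then show ?thesis
        by (simp add: blinfun.sum_right blinfun.scaleR_right blinfun.minus_right scaleR_sum_right)
    qed
    ultimately have "((\<lambda>x. ?a + A x (?p x)) has_derivative ?D w x0) (at x0)" by simp
    moreover have "?a + A x (?p x) = A x w" if "x \<in> U" for x
    proof -
      have "A x (L x ?a) = ?a"
        using inv(1)[OF that] by (metis blinfun_apply_blinfun_compose blinfun_apply_id_blinfun)
      then show ?thesis unfolding p by (simp add: blinfun.diff_right)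
    qed
    ultimately show ?thesis
      by (rule has_derivative_transform_within_open[OF _ U x0])
  qed
  have "Ck_on k UNIV U (\<lambda>x. A x w)" for k
  proof (induction k arbitrary: w)
    case 0
    show ?case unfolding Ck_on.simps
      by (intro continuous_at_imp_continuous_on ballI has_derivative_continuous[OF der])
  next
    case (Suc k)
    have d: "Ck_on k UNIV U (\<lambda>x. ?d b x v)" for b v
      using smooth_frechet[OF U L] by (simp add: smooth_on_def)
    have "Ck_on k UNIV U (\<lambda>x. \<Sum>b\<in>Basis. \<Sum>c\<in>Basis. ((A x w \<bullet> b) * (?d b x v \<bullet> c)) *\<^sub>R A x c)" for v
      by (intro Ck_on_sum Ck_on_scaleR Ck_on_mult Ck_on_inner Ck_on_const Suc d)
    then have "Ck_on k UNIV U (\<lambda>x. ?D w x v)" for v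
      by (rule Ck_on_linear_comp[OF bounded_linear_minus[OF bounded_linear_ident]])
    then show ?case unfolding Ck_on.simps
      by (intro exI[of _ "?D w"] conjI ballI has_derivative_at_withinI[OF der])
  qed
  then show ?thesis by (simp add: smooth_on_def)
qed

text \<open>The inverse function theorem provides a differentiable local inverse \<open>g\<close> with
  $g'(y) = f'(g(y))^{-1}$. As operator inversion is smooth, this equation raises the order of
  differentiability of \<open>g\<close> by one at a time.\<close>

lemma smooth_inverse_function:
  fixes f :: "'e::euclidean_space \<Rightarrow> 'e"
  assumes U: "open U" and f: "smooth U f" and x0: "x0 \<in> U"
    and id: "frechet_derivative f (at x0) = (\<lambda>v. v)"
  obtains V g where "open V" "f x0 \<in> V" "smooth V g" "g ` V \<subseteq> U" "g (f x0) = x0"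
    "\<And>y. y \<in> V \<Longrightarrow> f (g y) = y"
proof -
  let ?L = "\<lambda>x. Blinfun (frechet_derivative f (at x))"
  note der = smooth_differentiable[OF U f]
  have L: "blinfun_apply (?L x) = frechet_derivative f (at x)" if "x \<in> U" for x
    using der[OF that] by (intro bounded_linear_Blinfun_apply has_derivative_bounded_linear)
  have smL: "smooth U (\<lambda>x. ?L x v)" for v
    using smooth_frechet[OF U f] by (rule smooth_on_cong) (simp add: L)
  have contL: "continuous_on U ?L"
    by (intro continuous_on_blinfun_componentwise smooth_continuous[OF smL])
  have "id_blinfun o\<^sub>L ?L x0 = id_blinfun"
    by (rule blinfun_eqI) (simp add: L[OF x0, unfolded id] id)
  then obtain U' V g g' where U': "open U'" "U' \<subseteq> U" "x0 \<in> U'" and V: "open V" "f x0 \<in> V"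
    and hom: "homeomorphism U' V f g"
    and g: "\<And>y. y \<in> V \<Longrightarrow> (g has_derivative (g' y)) (at y)"
    and g': "\<And>y. y \<in> V \<Longrightarrow> g' y = inv (blinfun_apply (?L (g y)))"
    and bij: "\<And>y. y \<in> V \<Longrightarrow> bij (blinfun_apply (?L (g y)))"
    using inverse_function_theorem[OF U _ contL x0, of f id_blinfun] der L by metis
  have gU: "g y \<in> U'" "f (g y) = y" if "y \<in> V" for y
    using hom that unfolding homeomorphism_def by auto
  have gf: "g (f x) = x" "f x \<in> V" if "x \<in> U'" for x
    using hom that unfolding homeomorphism_def by auto
  let ?A = "\<lambda>x. Blinfun (inv (blinfun_apply (?L x)))"
  have A: "blinfun_apply (?A x) = inv (blinfun_apply (?L x))"
    and bijL: "bij (blinfun_apply (?L x))" if "x \<in> U'" for x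
  proof -
    have "bounded_linear (g' (f x))"
      using g[OF gf(2)[OF that]] by (rule has_derivative_bounded_linear)
    then show "blinfun_apply (?A x) = inv (blinfun_apply (?L x))"
      using g'[OF gf(2)[OF that]] gf(1)[OF that] by (simp add: bounded_linear_Blinfun_apply)
    show "bij (blinfun_apply (?L x))"
      using bij[OF gf(2)[OF that]] gf(1)[OF that] by simp
  qed
  have smA: "smooth U' (\<lambda>x. ?A x w)" for w
  proof (rule smooth_blinfun_inverse[OF U'(1), where L = ?L])
    show "smooth U' (\<lambda>x. ?L x v)" for v using smL U'(2) by (rule smooth_on_subset)
    show "?A x o\<^sub>L ?L x = id_blinfun" if "x \<in> U'" for x
      by (rule blinfun_eqI) (simp add: A[OF that] inv_f_f[OF bij_is_inj[OF bijL[OF that]]])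
    show "?L x o\<^sub>L ?A x = id_blinfun" if "x \<in> U'" for x
      by (rule blinfun_eqI) (simp add: A[OF that] surj_f_inv_f[OF bij_is_surj[OF bijL[OF that]]])
  qed
  have "Ck_on k UNIV V g" for k
  proof (induction k)
    case 0
    show ?case unfolding Ck_on.simps
      by (intro continuous_at_imp_continuous_on ballI has_derivative_continuous[OF g])
  next
    case (Suc k)
    have "Ck_on k UNIV V (\<lambda>y. ?A (g y) w)" for w
      using smA[of w] gU(1) by (intro Ck_on_compose[OF Suc, of U']) (auto simp: smooth_on_def)
    then have "Ck_on k UNIV V (\<lambda>y. g' y w)" for w
      by (rule Ck_on_cong) (simp add: A gU(1) g')
    then show ?case unfolding Ck_on.simps
      by (intro exI[of _ g'] conjI ballI has_derivative_at_withinI[OF g])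
  qed
  then have "smooth V g" by (simp add: smooth_on_def)
  with that V show thesis
    using gU gf(1)[OF U'(3)] U'(2) by (meson image_subsetI subset_iff)
qed

text \<open>A smooth map with values in a subspace \<open>S\<close> whose derivative at a point is onto \<open>S\<close> has a
  smooth local section: restrict it along a linear right inverse of the derivative and add the
  identity on a complement of \<open>S\<close>; the result has the identity as derivative and is locally
  invertible.\<close>

lemma smooth_local_section:
  fixes P :: "'e::euclidean_space \<Rightarrow> 'e"
  assumes W: "open W" and P: "smooth W P" and x0: "x0 \<in> W"
    and S: "subspace S" and PS: "P ` W \<subseteq> S"
    and onto: "S \<subseteq> range (frechet_derivative P (at x0))"
  obtains V s where "open V" "P x0 \<in> V" "smooth V s" "s ` V \<subseteq> W" "s (P x0) = x0"
    "\<And>y. y \<in> V \<inter> S \<Longrightarrow> P (s y) = y"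
proof -
  let ?T = "frechet_derivative P (at x0)"
  let ?y0 = "P x0"
  note der = smooth_differentiable[OF W P]
  have T: "linear ?T" using der[OF x0] by (rule has_derivative_linear)
  obtain R where R: "linear R" "\<And>w. w \<in> S \<Longrightarrow> ?T (R w) = w"
  proof -
    obtain R where "linear R" "\<forall>v\<in>range ?T. ?T (R v) = v"
      using linear_exists_right_inverse_on[OF T subspace_UNIV] by auto
    then show ?thesis using that onto by blast
  qed
  let ?Q = "retr S"
  let ?a = "\<lambda>z. x0 + R (?Q (z - ?y0))"
  let ?f = "\<lambda>z. P (?a z) + (z - ?Q z)"
  have y0: "?y0 \<in> S" using PS x0 by blast
  have lQ: "linear ?Q" and lRQ: "linear (\<lambda>z. R (?Q z))"
    using linear_retr[OF S] linear_compose[OF linear_retr[OF S] R(1)] by (simp_all add: o_def)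
  note blQ = lQ[unfolded linear_conv_bounded_linear] and blRQ = lRQ[unfolded linear_conv_bounded_linear]
  have sma: "smooth U ?a" for U
    unfolding linear_diff[OF lRQ] linear_diff[OF lQ] linear_diff[OF R(1)]
    by (intro smooth_on_add smooth_on_diff smooth_on_const smooth_on_bounded_linear blRQ)
  let ?U = "?a -` W"
  have U: "open ?U"
    using smooth_continuous[OF sma[of UNIV]] W by (rule open_vimage[rotated])
  have y0U: "?y0 \<in> ?U" and a0: "?a ?y0 = x0"
    using x0 linear_0[OF lRQ] by simp_all
  have smf: "smooth ?U ?f"
  proof (intro smooth_on_add smooth_on_diff)
    show "smooth ?U (\<lambda>z. P (?a z))" by (rule smooth_on_compose[OF sma P]) auto
  qed (intro smooth_on_bounded_linear blQ bounded_linear_ident)+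
  have "(?f has_derivative (\<lambda>v. ?T (R (?Q v)) + (v - ?Q v))) (at ?y0)"
  proof (intro has_derivative_add has_derivative_diff has_derivative_ident
      bounded_linear_imp_has_derivative blQ)
    have "((\<lambda>z. R (?Q (z - ?y0))) has_derivative (\<lambda>v. R (?Q (v - 0)))) (at ?y0)"
      by (intro bounded_linear.has_derivative[OF blRQ] has_derivative_diff has_derivative_ident has_derivative_const)
    then have "(?a has_derivative (\<lambda>v. 0 + R (?Q (v - 0)))) (at ?y0)"
      by (intro has_derivative_add has_derivative_const)
    then have "(?a has_derivative (\<lambda>v. R (?Q v))) (at ?y0)" by simp
    then show "((\<lambda>z. P (?a z)) has_derivative (\<lambda>v. ?T (R (?Q v)))) (at ?y0)"
      by (rule has_derivative_compose) (use der[OF x0] a0 in simp)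
  qed
  moreover have "(\<lambda>v. ?T (R (?Q v)) + (v - ?Q v)) = (\<lambda>v. v)"
    using R(2)[OF retr_in[OF S]] by simp
  ultimately have "frechet_derivative ?f (at ?y0) = (\<lambda>v. v)"
    by (metis frechet_derivative_at)
  from smooth_inverse_function[OF U smf y0U this]
  obtain V g where V: "open V" "?f ?y0 \<in> V" "smooth V g" "g ` V \<subseteq> ?U" "g (?f ?y0) = ?y0"
    and fg: "\<And>y. y \<in> V \<Longrightarrow> ?f (g y) = y" by blast
  have f0: "?f ?y0 = ?y0" using a0 retr_eq[OF S y0] by simp
  show thesis
  proof
    show "open V" "?y0 \<in> V" using V f0 by simp_all
    show "smooth V (\<lambda>y. ?a (g y))"
      by (rule smooth_on_compose[OF V(3) sma[of UNIV]]) simp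
    show "(\<lambda>y. ?a (g y)) ` V \<subseteq> W" using V(4) by auto
    show "?a (g ?y0) = x0" using V(5) f0 a0 by simp
    fix y assume y: "y \<in> V \<inter> S"
    \<comment> \<open>The component of the equation in the complement of \<open>S\<close> says that \<open>g y\<close> lies in \<open>S\<close>.\<close>
    have Pa: "P (?a (g y)) \<in> S" using y V(4) PS by auto
    then have "g y - ?Q (g y) = y - P (?a (g y))" using fg[of y] y by (simp add: algebra_simps)
    also have "\<dots> \<in> S" using y Pa S by (simp add: subspace_diff)
    finally have "?Q (g y - ?Q (g y)) = g y - ?Q (g y)" by (rule retr_eq[OF S])
    then have "g y - ?Q (g y) = 0"
      by (simp add: linear_diff[OF lQ] retr_eq[OF S retr_in[OF S]])
    then show "P (?a (g y)) = y" using fg[of y] y by simp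
  qed
qed

lemma sum_fun_apply: "(\<Sum>i\<in>I. f i) x = (\<Sum>i\<in>I. f i x :: 'b::comm_monoid_add)"
  by (induction I rule: infinite_finite_induct) simp_all

section \<open>Charts and smooth functions\<close>

text \<open>Composition with the retraction onto the model space turns coordinate expressions into functions on
  open subsets of the surrounding Euclidean space, where derivatives are unique.\<close>

definition coord_rep :: "('a, 'e::euclidean_space) manifold \<Rightarrow> 'a set \<Rightarrow> ('a \<Rightarrow> 'e) \<Rightarrow> ('a \<Rightarrow> 'b) \<Rightarrow> 'e \<Rightarrow> 'b"
  where "coord_rep M U \<phi> f x = f (inv_into U \<phi> (retr (model M) x))"

definition coord_dom :: "('a, 'e::euclidean_space) manifold \<Rightarrow> ('a \<Rightarrow> 'e) \<Rightarrow> 'a set \<Rightarrow> 'e set"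
  where "coord_dom M \<phi> A = retr (model M) -` (\<phi> ` A)"

locale chart =
  fixes M :: "('a, 'e::euclidean_space) manifold" and U :: "'a set" and \<phi> :: "'a \<Rightarrow> 'e"
  assumes M: "smooth_manifold M" and chart: "(U, \<phi>) \<in> charts M"
begin

lemma model: "subspace (model M)"
  using M by (simp add: smooth_manifold_def)

lemma openin_U: "openin (mtop M) U" and openin_img: "openin (top_of_set (model M)) (\<phi> ` U)"
  and homeo: "homeomorphic_map (subtopology (mtop M) U) (top_of_set (\<phi> ` U)) \<phi>"
  using M chart by (auto simp: smooth_manifold_def)

lemma transition:
  "(V, \<psi>) \<in> charts M \<Longrightarrow> smooth_on (model M) (\<phi> ` (U \<inter> V)) (\<lambda>x. \<psi> (inv_into U \<phi> x))"
  using M chart by (fastforce simp: smooth_manifold_def o_def)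

lemma U_points: "U \<subseteq> points M"
  using openin_U by (rule openin_subset)

lemma img_model: "\<phi> ` U \<subseteq> model M"
  using openin_img by (auto dest: openin_imp_subset)

lemma inj: "inj_on \<phi> U"
  using homeomorphic_imp_injective_map[OF homeo] U_points by (simp add: Int_absorb1)

lemma openin_image: "openin (mtop M) A \<Longrightarrow> openin (top_of_set (model M)) (\<phi> ` (U \<inter> A))"
  using homeomorphic_map_openness[OF homeo, of "U \<inter> A"] openin_img U_points
  by (metis Int_commute inf_le1 inf_le2 le_inf_iff openin_subtopology_Int2 openin_trans
      topspace_subtopology Int_absorb1)

lemma open_dom: "openin (mtop M) A \<Longrightarrow> open (coord_dom M \<phi> (U \<inter> A))"
  unfolding coord_dom_def by (rule open_vimage_retr[OF model openin_image])

lemma open_dom_U: "open (coord_dom M \<phi> U)"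
  using open_dom[OF openin_U] by simp

lemma retr_chart: "p \<in> U \<Longrightarrow> retr (model M) (\<phi> p) = \<phi> p"
  using retr_eq[OF model] img_model by blast

lemma in_dom: "p \<in> U \<Longrightarrow> p \<in> A \<Longrightarrow> \<phi> p \<in> coord_dom M \<phi> A"
  by (simp add: coord_dom_def retr_chart)

lemma coord_rep_chart: "p \<in> U \<Longrightarrow> coord_rep M U \<phi> f (\<phi> p) = f p"
  by (simp add: coord_rep_def retr_chart inj)

lemma domE:
  assumes "x \<in> coord_dom M \<phi> A" "A \<subseteq> U"
  obtains q where "q \<in> A" "retr (model M) x = \<phi> q" "inv_into U \<phi> (retr (model M) x) = q"
    "\<And>f. coord_rep M U \<phi> f x = f q"
proof -
  obtain q where q: "q \<in> A" "retr (model M) x = \<phi> q"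
    using assms(1) by (auto simp: coord_dom_def)
  with assms(2) have "inv_into U \<phi> (retr (model M) x) = q" using inj by auto
  with q that show thesis by (simp add: coord_rep_def)
qed

lemma openin_preimage:
  assumes "open W"
  shows "openin (mtop M) {q \<in> U. \<phi> q \<in> W}"
proof -
  have "continuous_map (subtopology (mtop M) U) euclidean \<phi>"
    using homeomorphic_imp_continuous_map[OF homeo] by (rule continuous_map_into_fulltopology)
  from openin_continuous_map_preimage[OF this, of W] assms
  have "openin (subtopology (mtop M) U) {q \<in> U. \<phi> q \<in> W}"
    using U_points by (simp add: Int_absorb1)
  then show ?thesis using openin_trans_full[OF _ openin_U] by blast
qed

lemma domD:
  assumes "x \<in> coord_dom M \<phi> A" "A \<subseteq> U"
  shows "\<exists>q\<in>A. retr (model M) x = \<phi> q \<and> coord_rep M U \<phi> f x = f q"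
  using assms by (rule domE) blast

lemma smooth_function_chart:
  "f \<in> smooth_functions M \<Longrightarrow> smooth (coord_dom M \<phi> U) (coord_rep M U \<phi> f)"
  using chart smooth_on_retr[OF model img_model, of "f \<circ> inv_into U \<phi>"]
  by (auto simp: smooth_functions_def coord_dom_def coord_rep_def[abs_def])

end

text \<open>Smoothness can be tested near each point in a single chart.\<close>

definition smooth_near :: "('a, 'e::euclidean_space) manifold \<Rightarrow> ('a \<Rightarrow> real) \<Rightarrow> 'a \<Rightarrow> bool" where
  "smooth_near M f p \<longleftrightarrow> (\<exists>(U, \<phi>) \<in> charts M. p \<in> U \<and>
     (\<exists>W. open W \<and> \<phi> p \<in> W \<and> smooth W (coord_rep M U \<phi> f)))"

lemma smooth_nearI:
  "(U, \<phi>) \<in> charts M \<Longrightarrow> p \<in> U \<Longrightarrow> open W \<Longrightarrow> \<phi> p \<in> W \<Longrightarrow> smooth W (coord_rep M U \<phi> f) \<Longrightarrow>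
    smooth_near M f p"
  unfolding smooth_near_def by blast

lemma smooth_functionsI:
  assumes M: "smooth_manifold M" and f: "\<And>p. p \<notin> points M \<Longrightarrow> f p = 0"
    "\<And>p. p \<in> points M \<Longrightarrow> smooth_near M f p"
  shows "f \<in> smooth_functions M"
  unfolding smooth_functions_def
proof (intro CollectI conjI allI impI ballI, erule f(1), clarify)
  fix V \<psi> assume V: "(V, \<psi>) \<in> charts M"
  interpret V: chart M V \<psi> using M V by unfold_locales
  let ?c = "coord_rep M V \<psi> f"
  have "smooth (coord_dom M \<psi> V) ?c"
  proof (rule smooth_local[OF V.open_dom_U])
    fix x assume "x \<in> coord_dom M \<psi> V"
    then obtain q where q: "q \<in> V" "retr (model M) x = \<psi> q" by (rule V.domE) simp
    then obtain U \<phi> W where U: "(U, \<phi>) \<in> charts M" "q \<in> U"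
      and W: "open W" "\<phi> q \<in> W" "smooth W (coord_rep M U \<phi> f)"
      using f(2)[of q] V.U_points unfolding smooth_near_def by blast
    interpret U: chart M U \<phi> using M U by unfold_locales
    let ?D = "coord_dom M \<psi> (V \<inter> U)"
    let ?t = "coord_rep M V \<psi> \<phi>"
    have D: "open ?D" by (rule V.open_dom[OF U.openin_U])
    have t: "smooth ?D ?t"
    proof -
      have sub: "\<psi> ` (V \<inter> U) \<subseteq> model M" using V.img_model by blast
      from V.transition[OF U(1)] show ?thesis
        unfolding smooth_on_retr[OF V.model sub] by (simp add: coord_dom_def coord_rep_def[abs_def])
    qed
    let ?T = "?D \<inter> ?t -` W"
    have "open ?T"
      using smooth_continuous[OF t] D W(1) by (auto simp: continuous_on_open_vimage Int_commute)
    moreover have "x \<in> ?T"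
      using q U(2) W(2) V.inj by (auto simp: coord_dom_def coord_rep_def)
    moreover have "smooth ?T (\<lambda>z. coord_rep M U \<phi> f (?t z))"
      by (rule smooth_on_compose[OF smooth_on_subset[OF t] W(3)]) auto
    then have "smooth ?T ?c"
    proof (rule smooth_on_cong)
      fix z assume "z \<in> ?T"
      then obtain q' where q': "q' \<in> V \<inter> U" "\<And>h. coord_rep M V \<psi> h z = (h q' :: real)"
        "\<And>h. coord_rep M V \<psi> h z = (h q' :: 'b)"
        using V.domE[of z "V \<inter> U"] by (metis IntD1 coord_rep_def inf_le1)
      then show "coord_rep M U \<phi> f (?t z) = ?c z"
        using U.coord_rep_chart by auto
    qed
    then have "smooth (coord_dom M \<psi> V \<inter> ?T) ?c" by (rule smooth_on_subset) auto
    ultimately show "\<exists>T. open T \<and> x \<in> T \<and> smooth (coord_dom M \<psi> V \<inter> T) ?c" by blast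
  qed
  then show "smooth_on (model M) (\<psi> ` V) (f \<circ> inv_into V \<psi>)"
    using smooth_on_retr[OF V.model V.img_model, of "f \<circ> inv_into V \<psi>"]
    by (simp add: coord_dom_def coord_rep_def[abs_def])
qed

lemma chart_at:
  assumes "smooth_manifold M" "p \<in> points M"
  obtains U \<phi> where "chart M U \<phi>" "p \<in> U"
proof -
  have "p \<in> \<Union>(fst ` charts M)" using assms by (simp add: smooth_manifold_def)
  then obtain U \<phi> where "(U, \<phi>) \<in> charts M" "p \<in> U" by auto
  with that assms(1) show thesis by (simp add: chart_def)
qed

lemma smooth_function_off: "f \<in> smooth_functions M \<Longrightarrow> p \<notin> points M \<Longrightarrow> f p = 0"
  by (simp add: smooth_functions_def)

lemma smooth_functions_pointwise:
  assumes M: "smooth_manifold M"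
    and op: "\<And>U \<phi>. chart M U \<phi> \<Longrightarrow> smooth (coord_dom M \<phi> U) (coord_rep M U \<phi> h)"
    and off: "\<And>p. p \<notin> points M \<Longrightarrow> h p = 0"
  shows "h \<in> smooth_functions M"
proof (rule smooth_functionsI[OF M off])
  fix p assume "p \<in> points M"
  then obtain U \<phi> where U: "chart M U \<phi>" "p \<in> U" using chart_at[OF M] by metis
  interpret chart M U \<phi> by fact
  show "smooth_near M h p"
    by (rule smooth_nearI[OF chart U(2) open_dom_U in_dom[OF U(2) U(2)] op[OF U(1)]])
qed

definition const_fun :: "('a, 'e) manifold \<Rightarrow> real \<Rightarrow> 'a \<Rightarrow> real"
  where "const_fun M c = (\<lambda>p. if p \<in> points M then c else 0)"

context
  fixes M :: "('a, 'e::euclidean_space) manifold"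
  assumes M: "smooth_manifold M"
begin

lemma smooth_functions_add:
  assumes "f \<in> smooth_functions M" "g \<in> smooth_functions M"
  shows "f + g \<in> smooth_functions M"
proof (rule smooth_functions_pointwise[OF M])
  fix U \<phi> assume "chart M U \<phi>"
  then interpret chart M U \<phi> .
  show "smooth (coord_dom M \<phi> U) (coord_rep M U \<phi> (f + g))"
    using smooth_on_add[OF assms[THEN smooth_function_chart]]
    by (simp add: coord_rep_def[abs_def])
qed (use assms smooth_function_off in \<open>simp add: smooth_function_off\<close>)

lemma smooth_functions_mult:
  assumes "f \<in> smooth_functions M" "g \<in> smooth_functions M"
  shows "f * g \<in> smooth_functions M"
proof (rule smooth_functions_pointwise[OF M])
  fix U \<phi> assume "chart M U \<phi>"
  then interpret chart M U \<phi> .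
  show "smooth (coord_dom M \<phi> U) (coord_rep M U \<phi> (f * g))"
    using smooth_on_mult[OF assms[THEN smooth_function_chart]]
    by (simp add: coord_rep_def[abs_def])
qed (use assms smooth_function_off in \<open>simp add: smooth_function_off\<close>)

lemma smooth_functions_const: "const_fun M c \<in> smooth_functions M"
proof (rule smooth_functions_pointwise[OF M])
  fix U \<phi> assume "chart M U \<phi>"
  then interpret chart M U \<phi> .
  have "smooth (coord_dom M \<phi> U) (\<lambda>x. c)" by (rule smooth_on_const)
  then show "smooth (coord_dom M \<phi> U) (coord_rep M U \<phi> (const_fun M c))"
    by (rule smooth_on_cong) (metis domE const_fun_def U_points subset_iff subset_refl)
qed (simp add: const_fun_def)

lemma smooth_functions_scale:
  assumes "f \<in> smooth_functions M"
  shows "c *\<^sub>R f \<in> smooth_functions M"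
proof -
  have "const_fun M c * f = c *\<^sub>R f"
    using assms by (auto simp: const_fun_def fun_eq_iff smooth_function_off)
  then show ?thesis using smooth_functions_mult[OF smooth_functions_const assms] by metis
qed

lemma smooth_functions_zero: "0 \<in> smooth_functions M"
  using smooth_functions_const[of 0] by (simp add: const_fun_def zero_fun_def)

lemma smooth_functions_diff:
  "f \<in> smooth_functions M \<Longrightarrow> g \<in> smooth_functions M \<Longrightarrow> f - g \<in> smooth_functions M"
  using smooth_functions_add[OF _ smooth_functions_scale, of f g "- 1"]
  by (simp add: fun_diff_def plus_fun_def scaleR_fun_def)

lemma smooth_functions_sum:
  "(\<And>i. i \<in> I \<Longrightarrow> f i \<in> smooth_functions M) \<Longrightarrow> sum f I \<in> smooth_functions M"
  by (induction I rule: infinite_finite_induct) (auto intro: smooth_functions_add smooth_functions_zero)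

end

text \<open>The coordinate expression of a smooth map in a pair of charts.\<close>

lemma smooth_map_chart:
  assumes "chart N U \<phi>" "chart M V \<psi>" and F: "smooth_map N M F"
  defines "D \<equiv> coord_dom N \<phi> {x \<in> U. F x \<in> V}" and "t \<equiv> coord_rep N U \<phi> (\<lambda>x. \<psi> (F x))"
  shows "open D" and "smooth D t"
    and "z \<in> D \<Longrightarrow> \<exists>q\<in>U. F q \<in> V \<and> retr (model N) z = \<phi> q \<and> t z = \<psi> (F q) \<and> coord_rep N U \<phi> h z = h q"
proof -
  interpret U: chart N U \<phi> by fact
  interpret V: chart M V \<psi> by fact
  let ?A = "{x \<in> U. F x \<in> V}"
  have cont: "continuous_map (mtop N) (mtop M) F" using F by (simp add: smooth_map_def)
  have UA: "U \<inter> {x \<in> points N. F x \<in> V} = ?A" using U.U_points by auto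
  show "open D"
    using U.open_dom[OF openin_continuous_map_preimage[OF cont V.openin_U]] unfolding UA D_def .
  have sub: "\<phi> ` ?A \<subseteq> model N" using U.img_model by blast
  have "smooth_on (model N) (\<phi> ` ?A) (\<psi> \<circ> F \<circ> inv_into U \<phi>)"
    using F U.chart V.chart unfolding smooth_map_def by blast
  then show "smooth D t"
    unfolding smooth_on_retr[OF U.model sub] D_def t_def
    by (simp add: coord_dom_def coord_rep_def[abs_def])
  assume z: "z \<in> D"
  have "?A \<subseteq> U" by blast
  from U.domE[OF z[unfolded D_def] this]
  obtain q where "q \<in> ?A" "retr (model N) z = \<phi> q" "inv_into U \<phi> (retr (model N) z) = q" by metis
  then show "\<exists>q\<in>U. F q \<in> V \<and> retr (model N) z = \<phi> q \<and> t z = \<psi> (F q) \<and> coord_rep N U \<phi> h z = h q"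
    by (auto simp: t_def coord_rep_def)
qed

lemma pullback_smooth:
  assumes N: "smooth_manifold N" and M: "smooth_manifold M"
    and F: "smooth_map N M F" and f: "f \<in> smooth_functions M"
  shows "pullback N F f \<in> smooth_functions N"
proof (rule smooth_functionsI[OF N])
  fix p assume p: "p \<in> points N"
  have "continuous_map (mtop N) (mtop M) F" using F by (simp add: smooth_map_def)
  then have Fp: "F p \<in> points M" using p by (auto simp: continuous_map_def)
  obtain U \<phi> where U: "chart N U \<phi>" "p \<in> U" using chart_at[OF N p] .
  obtain V \<psi> where V: "chart M V \<psi>" "F p \<in> V" using chart_at[OF M Fp] .
  interpret U: chart N U \<phi> by fact
  interpret V: chart M V \<psi> by fact
  let ?A = "{x \<in> U. F x \<in> V}"
  let ?D = "coord_dom N \<phi> ?A"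
  let ?t = "coord_rep N U \<phi> (\<lambda>x. \<psi> (F x))"
  note t = smooth_map_chart[OF U(1) V(1) F]
  have tV: "?t ` ?D \<subseteq> coord_dom M \<psi> V"
  proof (rule image_subsetI)
    fix z assume "z \<in> ?D"
    from t(3)[OF this] show "?t z \<in> coord_dom M \<psi> V" using V.in_dom by metis
  qed
  have "smooth ?D (\<lambda>z. coord_rep M V \<psi> f (?t z))"
    by (rule smooth_on_compose[OF t(2) V.smooth_function_chart[OF f] tV])
  then have sm: "smooth ?D (coord_rep N U \<phi> (pullback N F f))"
  proof (rule smooth_on_cong)
    fix z assume "z \<in> ?D"
    from t(3)[OF this, of "pullback N F f"] obtain q where "q \<in> U" "F q \<in> V" "?t z = \<psi> (F q)"
      "coord_rep N U \<phi> (pullback N F f) z = pullback N F f q" by blast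
    then show "coord_rep M V \<psi> f (?t z) = coord_rep N U \<phi> (pullback N F f) z"
      using U.U_points by (auto simp: V.coord_rep_chart pullback_def)
  qed
  have "p \<in> ?A" using U(2) V(2) by simp
  then show "smooth_near N (pullback N F f) p"
    by (intro smooth_nearI[OF U.chart U(2) t(1) _ sm] U.in_dom U(2))
qed (simp add: pullback_def)

section \<open>Tangent vectors in a chart\<close>

context chart
begin

text \<open>The derivation $f \mapsto D(f \circ \phi^{-1})(\phi(p))\,w$.\<close>

definition coord_vector :: "'a \<Rightarrow> 'e \<Rightarrow> 'a tvector" where
  "coord_vector p w = (\<lambda>f. if f \<in> smooth_functions M
     then frechet_derivative (coord_rep M U \<phi> f) (at (\<phi> p)) w else 0)"

lemma coord_derivative:
  assumes "f \<in> smooth_functions M" "p \<in> U"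
  shows "(coord_rep M U \<phi> f has_derivative frechet_derivative (coord_rep M U \<phi> f) (at (\<phi> p))) (at (\<phi> p))"
  using smooth_differentiable[OF open_dom_U smooth_function_chart in_dom] assms by blast

lemma coord_vector_tangent:
  assumes p: "p \<in> U"
  shows "coord_vector p w \<in> tangent_space M p"
proof -
  let ?r = "\<lambda>f. coord_rep M U \<phi> f"
  let ?D = "\<lambda>f. frechet_derivative (?r f) (at (\<phi> p))"
  have add: "?D (f + g) = (\<lambda>w. ?D f w + ?D g w)"
    if "f \<in> smooth_functions M" "g \<in> smooth_functions M" for f g :: "'a \<Rightarrow> real"
  proof -
    have "(?r (f + g) has_derivative (\<lambda>w. ?D f w + ?D g w)) (at (\<phi> p))"
      using has_derivative_add[OF that[THEN coord_derivative[OF _ p]]]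
      by (simp add: coord_rep_def[abs_def])
    then show ?thesis by (rule frechet_derivative_at[symmetric])
  qed
  have mult: "?D (f * g) = (\<lambda>w. f p * ?D g w + ?D f w * g p)"
    if "f \<in> smooth_functions M" "g \<in> smooth_functions M" for f g :: "'a \<Rightarrow> real"
  proof -
    have "(?r (f * g) has_derivative (\<lambda>w. ?r f (\<phi> p) * ?D g w + ?D f w * ?r g (\<phi> p))) (at (\<phi> p))"
      using has_derivative_mult[OF that[THEN coord_derivative[OF _ p]]]
      by (simp add: coord_rep_def[abs_def])
    then show ?thesis unfolding coord_rep_chart[OF p] by (rule frechet_derivative_at[symmetric])
  qed
  have scale: "?D (c *\<^sub>R f) = (\<lambda>w. c * ?D f w)"
    if "f \<in> smooth_functions M" for c and f :: "'a \<Rightarrow> real"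
  proof -
    have "(?r (c *\<^sub>R f) has_derivative (\<lambda>w. c * ?D f w)) (at (\<phi> p))"
      using has_derivative_mult_right[OF coord_derivative[OF that p], of c]
      by (simp add: coord_rep_def[abs_def])
    then show ?thesis by (rule frechet_derivative_at[symmetric])
  qed
  show ?thesis
    unfolding tangent_space_def coord_vector_def
    using smooth_functions_add[OF M] smooth_functions_mult[OF M] smooth_functions_scale[OF M]
    by (simp add: add mult scale)
qed

lemma coord_rep_retr: "coord_rep M U \<phi> f (retr (model M) x) = coord_rep M U \<phi> f x"
  by (simp add: coord_rep_def retr_eq[OF model retr_in[OF model]])

lemma coord_derivative_retr:
  fixes f :: "'a \<Rightarrow> real"
  assumes f: "f \<in> smooth_functions M" and p: "p \<in> U"
  shows "frechet_derivative (coord_rep M U \<phi> f) (at (\<phi> p)) w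
    = frechet_derivative (coord_rep M U \<phi> f) (at (\<phi> p)) (retr (model M) w)"
proof -
  let ?H = "coord_rep M U \<phi> f" and ?P = "retr (model M)"
  have "(?P has_derivative ?P) (at (\<phi> p))"
    using linear_retr[OF model]
    by (intro bounded_linear_imp_has_derivative) (simp add: linear_conv_bounded_linear)
  moreover have "(?H has_derivative frechet_derivative ?H (at (\<phi> p))) (at (?P (\<phi> p)))"
    unfolding retr_chart[OF p] by (rule coord_derivative[OF f p])
  ultimately have "((\<lambda>x. ?H (?P x)) has_derivative (\<lambda>u. frechet_derivative ?H (at (\<phi> p)) (?P u))) (at (\<phi> p))"
    by (rule has_derivative_compose[where f = ?P and g = ?H])
  then have "frechet_derivative ?H (at (\<phi> p)) = (\<lambda>u. frechet_derivative ?H (at (\<phi> p)) (?P u))"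
    unfolding coord_rep_retr by (rule frechet_derivative_at[symmetric])
  then show ?thesis by (rule fun_cong)
qed

lemma ball_in_dom:
  assumes "p \<in> U"
  obtains r where "r > 0" "ball (\<phi> p) r \<subseteq> coord_dom M \<phi> U"
  using open_dom_U in_dom[OF assms assms] open_contains_ball by blast

text \<open>A function given in the chart is made global by multiplication with a bump function; arguments
  with jets at \<open>p\<close> use that its value there is 1.\<close>

definition cutoff :: "'a \<Rightarrow> real \<Rightarrow> ('e \<Rightarrow> real) \<Rightarrow> 'a \<Rightarrow> real" where
  "cutoff p r g q = (if q \<in> U \<and> \<phi> q \<in> ball (\<phi> p) r then bump (\<phi> p) (r / 2) (\<phi> q) * g (\<phi> q) else 0)"

text \<open>The Hausdorff property enters here: the compact support of the cut-off function in the chart is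
  closed in \<open>M\<close>, so that the extension by zero is smooth.\<close>

lemma cutoff_smooth:
  assumes p: "p \<in> U" and r: "r > 0" "ball (\<phi> p) r \<subseteq> coord_dom M \<phi> U"
    and g: "smooth (ball (\<phi> p) r) g"
  shows "cutoff p r g \<in> smooth_functions M"
proof (rule smooth_functionsI[OF M])
  show "cutoff p r g q = 0" if "q \<notin> points M" for q
    using that U_points by (auto simp: cutoff_def)
  fix q assume q: "q \<in> points M"
  let ?P = "retr (model M)"
  show "smooth_near M (cutoff p r g) q"
  proof (cases "q \<in> U \<and> \<phi> q \<in> ball (\<phi> p) r")
    case True
    let ?W = "coord_dom M \<phi> U \<inter> ?P -` ball (\<phi> p) r"
    have blP: "bounded_linear ?P"
      using linear_retr[OF model] by (simp add: linear_conv_bounded_linear)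
    have "open ?W"
      by (intro open_Int open_dom_U open_vimage open_ball linear_continuous_on blP)
    moreover have "\<phi> q \<in> ?W" using True retr_chart in_dom by simp
    moreover have "smooth ?W (\<lambda>x. bump (\<phi> p) (r / 2) (?P x) * g (?P x))"
    proof (intro smooth_on_mult)
      show "smooth ?W (\<lambda>x. bump (\<phi> p) (r / 2) (?P x))"
        by (rule smooth_on_compose[OF smooth_on_bounded_linear[OF blP] smooth_bump[of UNIV]]) simp
      show "smooth ?W (\<lambda>x. g (?P x))"
        by (rule smooth_on_compose[OF smooth_on_bounded_linear[OF blP] g]) auto
    qed
    then have "smooth ?W (coord_rep M U \<phi> (cutoff p r g))"
    proof (rule smooth_on_cong)
      fix x assume x: "x \<in> ?W"
      obtain q' where "q' \<in> U" "?P x = \<phi> q'" "coord_rep M U \<phi> (cutoff p r g) x = cutoff p r g q'"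
        using domE[of x U] x by (metis IntD1 subset_refl)
      then show "bump (\<phi> p) (r / 2) (?P x) * g (?P x) = coord_rep M U \<phi> (cutoff p r g) x"
        using x by (simp add: cutoff_def)
    qed
    ultimately show ?thesis using chart True by (intro smooth_nearI) auto
  next
    case False
    let ?K = "inv_into U \<phi> ` (model M \<inter> cball (\<phi> p) (r / 2))"
    have sub: "model M \<inter> cball (\<phi> p) (r / 2) \<subseteq> \<phi> ` U"
    proof
      fix x assume x: "x \<in> model M \<inter> cball (\<phi> p) (r / 2)"
      then have "x \<in> ball (\<phi> p) r" using r(1) by auto
      then have "?P x \<in> \<phi> ` U" using r(2) by (auto simp: coord_dom_def)
      then show "x \<in> \<phi> ` U" using retr_eq[OF model] x by simp
    qed
    obtain \<psi> where "homeomorphic_maps (subtopology (mtop M) U) (top_of_set (\<phi> ` U)) \<phi> \<psi>"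
      using homeo by (auto simp: homeomorphic_map_maps)
    then have \<psi>: "continuous_map (top_of_set (\<phi> ` U)) (subtopology (mtop M) U) \<psi>"
      and \<psi>\<phi>: "\<And>q. q \<in> U \<Longrightarrow> \<psi> (\<phi> q) = q"
      using U_points by (auto simp: homeomorphic_maps_def)
    have "compactin (top_of_set (\<phi> ` U)) (model M \<inter> cball (\<phi> p) (r / 2))"
      using sub model by (simp add: compactin_subtopology closed_Int_compact closed_subspace)
    then have "compactin (subtopology (mtop M) U) (\<psi> ` (model M \<inter> cball (\<phi> p) (r / 2)))"
      by (rule image_compactin[OF _ \<psi>])
    moreover have "\<psi> ` (model M \<inter> cball (\<phi> p) (r / 2)) = ?K"
    proof (rule image_cong[OF refl])
      fix x assume "x \<in> model M \<inter> cball (\<phi> p) (r / 2)"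
      then obtain q where "q \<in> U" "x = \<phi> q" using sub by blast
      then show "\<psi> x = inv_into U \<phi> x" using \<psi>\<phi> inj by simp
    qed
    ultimately have "compactin (mtop M) ?K" by (simp add: compactin_subtopology)
    then have K: "closedin (mtop M) ?K"
      using M by (intro compactin_imp_closedin) (simp add: smooth_manifold_def)
    let ?A = "points M - ?K"
    have A: "openin (mtop M) ?A" using K by blast
    have "q' \<in> U \<and> \<phi> q' \<in> ball (\<phi> p) r" if K: "q' \<in> ?K" for q'
    proof -
      obtain x where x: "x \<in> model M \<inter> cball (\<phi> p) (r / 2)" "q' = inv_into U \<phi> x" using K by blast
      then have "x \<in> \<phi> ` U" "x \<in> ball (\<phi> p) r" using sub r(1) by auto
      then show ?thesis by (simp add: x(2) inv_into_into f_inv_into_f)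
    qed
    with False q have qA: "q \<in> ?A" by blast
    obtain V \<psi> where V: "chart M V \<psi>" "q \<in> V" using chart_at[OF M q] .
    interpret V: chart M V \<psi> by fact
    have zero: "cutoff p r g q' = 0" if "q' \<in> ?A" for q'
    proof (cases "q' \<in> U \<and> \<phi> q' \<in> ball (\<phi> p) r")
      case True
      have "\<phi> q' \<notin> cball (\<phi> p) (r / 2)"
      proof
        assume "\<phi> q' \<in> cball (\<phi> p) (r / 2)"
        moreover have "\<phi> q' \<in> model M" using True img_model by blast
        ultimately have "inv_into U \<phi> (\<phi> q') \<in> ?K" by blast
        then show False using that True inj by simp
      qed
      then have "bump (\<phi> p) (r / 2) (\<phi> q') = 0" using r(1) by (intro bump_outside) auto
      then show ?thesis by (simp add: cutoff_def)
    next
      case False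
      then show ?thesis unfolding cutoff_def by (rule if_not_P)
    qed
    have "smooth (coord_dom M \<psi> (V \<inter> ?A)) (\<lambda>x. 0)" by (rule smooth_on_const)
    then have sm: "smooth (coord_dom M \<psi> (V \<inter> ?A)) (coord_rep M V \<psi> (cutoff p r g))"
    proof (rule smooth_on_cong)
      fix x assume x: "x \<in> coord_dom M \<psi> (V \<inter> ?A)"
      then obtain q' where q': "q' \<in> V \<inter> ?A" "coord_rep M V \<psi> (cutoff p r g) x = cutoff p r g q'"
        using V.domD[OF x Int_lower1, of "cutoff p r g"] by (elim bexE conjE)
      from zero[OF IntD2[OF q'(1)]] show "0 = coord_rep M V \<psi> (cutoff p r g) x"
        unfolding q'(2) by (rule sym)
    qed
    show ?thesis
      by (rule smooth_nearI[OF V.chart V(2) V.open_dom[OF A] V.in_dom[OF V(2) IntI[OF V(2) qA]] sm])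
  qed
qed

text \<open>Cut off the function $x \mapsto w \cdot (x - \phi(p))$: it vanishes at \<open>p\<close>, so the derivative of
  the bump function does not contribute.\<close>

lemma exists_linear_function:
  assumes p: "p \<in> U"
  obtains f where "f \<in> smooth_functions M" "\<And>u. u \<in> model M \<Longrightarrow> coord_vector p u f = w \<bullet> u"
proof -
  obtain r where r: "r > 0" "ball (\<phi> p) r \<subseteq> coord_dom M \<phi> U" by (rule ball_in_dom[OF p])
  let ?g = "\<lambda>x. w \<bullet> (x - \<phi> p)"
  let ?P = "retr (model M)"
  let ?f = "cutoff p r ?g"
  have smg: "smooth S ?g" for S
    by (intro smooth_on_inner[of _ _ "\<lambda>x. w"] smooth_on_diff smooth_on_const
        smooth_on_bounded_linear[OF bounded_linear_ident])
  have f: "?f \<in> smooth_functions M" by (rule cutoff_smooth[OF p r smg])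
  have blP: "bounded_linear ?P"
    using linear_retr[OF model] by (simp add: linear_conv_bounded_linear)
  let ?b = "bump (\<phi> p) (r / 2)"
  have b: "((\<lambda>x. ?b (?P x)) has_derivative frechet_derivative (\<lambda>x. ?b (?P x)) (at (\<phi> p))) (at (\<phi> p))"
    by (rule smooth_differentiable[OF open_UNIV
          smooth_on_compose[OF smooth_on_bounded_linear[OF blP] smooth_bump[of UNIV]]]) simp_all
  have g: "((\<lambda>x. ?g (?P x)) has_derivative (\<lambda>u. w \<bullet> ?P u)) (at (\<phi> p))"
    by (auto intro!: derivative_eq_intros bounded_linear_imp_has_derivative[OF blP])
  have "((\<lambda>x. ?b (?P x) * ?g (?P x)) has_derivative (\<lambda>u. w \<bullet> ?P u)) (at (\<phi> p))"
    using has_derivative_mult[OF b g] r(1) by (simp add: retr_chart[OF p] bump_center)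
  then have "(coord_rep M U \<phi> ?f has_derivative (\<lambda>u. w \<bullet> ?P u)) (at (\<phi> p))"
  proof (rule has_derivative_transform_within_open)
    let ?W = "coord_dom M \<phi> U \<inter> ?P -` ball (\<phi> p) r"
    show "open ?W"
      by (intro open_Int open_dom_U open_vimage open_ball linear_continuous_on blP)
    show "\<phi> p \<in> ?W" using p retr_chart in_dom r(1) by simp
    fix x assume x: "x \<in> ?W"
    obtain q' where "q' \<in> U" "?P x = \<phi> q'" "coord_rep M U \<phi> ?f x = ?f q'"
      using domE[of x U] x by (metis IntD1 subset_refl)
    then show "?b (?P x) * ?g (?P x) = coord_rep M U \<phi> ?f x"
      using x by (simp add: cutoff_def)
  qed
  then have "frechet_derivative (coord_rep M U \<phi> ?f) (at (\<phi> p)) = (\<lambda>u. w \<bullet> ?P u)"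
    by (rule frechet_derivative_at[symmetric])
  with that[OF f] f show thesis by (simp add: coord_vector_def retr_eq[OF model])
qed

end

context
  fixes M :: "('a, 'e::euclidean_space) manifold" and p :: 'a and v :: "'a tvector"
  assumes M: "smooth_manifold M" and v: "v \<in> tangent_space M p"
begin

lemma tangent_add: "f \<in> smooth_functions M \<Longrightarrow> g \<in> smooth_functions M \<Longrightarrow> v (f + g) = v f + v g"
  and tangent_mult: "f \<in> smooth_functions M \<Longrightarrow> g \<in> smooth_functions M \<Longrightarrow> v (f * g) = f p * v g + g p * v f"
  and tangent_scale: "f \<in> smooth_functions M \<Longrightarrow> v (c *\<^sub>R f) = c * v f"
  using v by (auto simp: tangent_space_def)

lemma tangent_zero: "v 0 = 0"
  using tangent_scale[OF smooth_functions_zero[OF M], of 0] by simp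

lemma tangent_diff: "f \<in> smooth_functions M \<Longrightarrow> g \<in> smooth_functions M \<Longrightarrow> v (f - g) = v f - v g"
  using tangent_add[of "f - g" g] smooth_functions_diff[OF M] by simp

lemma tangent_sum:
  "(\<And>i. i \<in> I \<Longrightarrow> f i \<in> smooth_functions M) \<Longrightarrow> v (sum f I) = (\<Sum>i\<in>I. v (f i))"
  by (induction I rule: infinite_finite_induct)
    (simp_all add: tangent_zero tangent_add smooth_functions_sum[OF M])

lemma tangent_const:
  assumes p: "p \<in> points M"
  shows "v (const_fun M c) = 0"
proof -
  let ?e = "const_fun M 1"
  have "?e * ?e = ?e" "const_fun M c = c *\<^sub>R ?e" by (simp_all add: const_fun_def fun_eq_iff)
  then show ?thesis
    using tangent_mult[of ?e ?e] tangent_scale[of ?e c] smooth_functions_const[OF M, of 1] p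
    by (simp add: const_fun_def)
qed

end

text \<open>By Hadamard's lemma a function whose coordinate derivative vanishes at \<open>p\<close> is, up to a constant
  and after multiplication by a cut-off function, a sum of products of functions vanishing at \<open>p\<close>, and
  these are killed by every derivation. So abstract tangent vectors see coordinate derivatives only.\<close>

lemma (in chart) tangent_kills:
  assumes p: "p \<in> U" and v: "v \<in> tangent_space M p" and h: "h \<in> smooth_functions M"
    and zero: "\<And>w. w \<in> model M \<Longrightarrow> coord_vector p w h = 0"
  shows "v h = 0"
proof -
  let ?H = "coord_rep M U \<phi> h" and ?P = "retr (model M)"
  have pM: "p \<in> points M" using p U_points by blast
  obtain r where r: "r > 0" "ball (\<phi> p) r \<subseteq> coord_dom M \<phi> U" by (rule ball_in_dom[OF p])
  have smH: "smooth (ball (\<phi> p) r) ?H"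
    by (rule smooth_on_subset[OF smooth_function_chart[OF h] r(2)])
  obtain g where g: "\<And>b. smooth (ball (\<phi> p) r) (g b)"
      "\<And>b. g b (\<phi> p) = frechet_derivative ?H (at (\<phi> p)) b"
      "\<And>x. x \<in> ball (\<phi> p) r \<Longrightarrow> ?H x = ?H (\<phi> p) + (\<Sum>b\<in>Basis. ((x - \<phi> p) \<bullet> b) * g b x)"
    by (rule hadamard[OF smH r(1)]) (rule that)
  have g0: "g b (\<phi> p) = 0" for b
    using g(2) coord_derivative_retr[OF h p, of b] zero[OF retr_in[OF model], of b] h
    by (simp add: coord_vector_def)
  let ?k = "h - const_fun M (h p)"
  let ?c = "cutoff p r (\<lambda>x. 1)"
  let ?X = "\<lambda>b. cutoff p r (\<lambda>x. (x - \<phi> p) \<bullet> b)" and ?Y = "\<lambda>b. cutoff p r (g b)"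
  have smX: "smooth S (\<lambda>x. (x - \<phi> p) \<bullet> b)" for S and b :: 'e
    by (intro smooth_on_inner[of _ _ _ "\<lambda>x. b"] smooth_on_diff smooth_on_const
        smooth_on_bounded_linear[OF bounded_linear_ident])
  have sm: "?k \<in> smooth_functions M" "?c \<in> smooth_functions M"
    "?X b \<in> smooth_functions M" "?Y b \<in> smooth_functions M" for b
    by (intro smooth_functions_diff[OF M] h smooth_functions_const[OF M]
        cutoff_smooth[OF p r] smooth_on_const smX g(1))+
  note smm = smooth_functions_mult[OF M]
  have eq: "?c * ?c * ?k = (\<Sum>b\<in>Basis. ?X b * ?Y b)"
  proof
    fix q
    show "(?c * ?c * ?k) q = (\<Sum>b\<in>Basis. ?X b * ?Y b) q"
    proof (cases "q \<in> U \<and> \<phi> q \<in> ball (\<phi> p) r")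
      case True
      then have q: "q \<in> U" "\<phi> q \<in> ball (\<phi> p) r" by blast+
      have "h q = h p + (\<Sum>b\<in>Basis. ((\<phi> q - \<phi> p) \<bullet> b) * g b (\<phi> q))"
        using g(3)[OF q(2)] unfolding coord_rep_chart[OF p] coord_rep_chart[OF q(1)] .
      then have "?k q = (\<Sum>b\<in>Basis. ((\<phi> q - \<phi> p) \<bullet> b) * g b (\<phi> q))"
        using subsetD[OF U_points q(1)] by (simp add: const_fun_def)
      moreover have "?c q = bump (\<phi> p) (r / 2) (\<phi> q)"
        "?X b q = bump (\<phi> p) (r / 2) (\<phi> q) * ((\<phi> q - \<phi> p) \<bullet> b)"
        "?Y b q = bump (\<phi> p) (r / 2) (\<phi> q) * g b (\<phi> q)" for b
        unfolding cutoff_def if_P[OF True] by simp_all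
      ultimately show ?thesis
        by (simp add: sum_fun_apply sum_distrib_left mult.assoc mult.left_commute)
    next
      case False
      then have "?c q = 0" "\<And>b. ?X b q = 0" by (auto simp: cutoff_def)
      then show ?thesis by (simp add: sum_fun_apply)
    qed
  qed
  have at_p: "?c p = 1" "?k p = 0" "?X b p = 0" "?Y b p = 0" for b
    using p r(1) pM g0 by (simp_all add: cutoff_def const_fun_def bump_center)
  have "v (?c * ?c * ?k) = v ?k"
    unfolding tangent_mult[OF M v smm[OF sm(2) sm(2)] sm(1)] at_p(2) by (simp add: at_p(1))
  then have "v ?k = v (\<Sum>b\<in>Basis. ?X b * ?Y b)" unfolding eq by (rule sym)
  also have "\<dots> = (\<Sum>b\<in>Basis. v (?X b * ?Y b))"
    by (rule tangent_sum[OF M v smm[OF sm(3,4)]])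
  also have "\<dots> = 0"
    unfolding tangent_mult[OF M v sm(3,4)] by (simp add: at_p)
  finally have "v ?k = 0" .
  then show ?thesis
    using tangent_diff[OF M v h smooth_functions_const[OF M]] tangent_const[OF M v pM] by simp
qed

section \<open>Functions without differential, and descent along submersions\<close>

text \<open>The coordinate vectors are tangent vectors. Hence all derivatives vanish in every chart, the function
  is locally constant, and its level sets are open and closed.\<close>

lemma constant_of_zero_differential:
  assumes M: "smooth_manifold M" and conn: "connected_space (mtop M)"
    and f: "f \<in> smooth_functions M"
    and zero: "\<And>p v. p \<in> points M \<Longrightarrow> v \<in> tangent_space M p \<Longrightarrow> v f = 0"
    and pq: "p \<in> points M" "q \<in> points M"
  shows "f p = f q"
proof -
  have loc: "\<exists>A. openin (mtop M) A \<and> x \<in> A \<and> (\<forall>y\<in>A. f y = f x)" if x: "x \<in> points M" for x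
  proof -
    obtain U \<phi> where U: "chart M U \<phi>" "x \<in> U" using chart_at[OF M x] .
    interpret chart M U \<phi> by fact
    obtain r where r: "r > 0" "ball (\<phi> x) r \<subseteq> coord_dom M \<phi> U" by (rule ball_in_dom[OF U(2)])
    let ?S = "ball (\<phi> x) r \<inter> model M"
    have "(coord_rep M U \<phi> f has_derivative (\<lambda>u. 0)) (at z within ?S)" if z: "z \<in> ?S" for z
    proof -
      have "z \<in> coord_dom M \<phi> U" using z r by blast
      then obtain y where y: "y \<in> U" "z = \<phi> y"
        using z retr_eq[OF model] by (auto simp: coord_dom_def)
      have "coord_vector y u f = 0" for u
        using zero coord_vector_tangent[OF y(1)] y(1) U_points by blast
      then have "frechet_derivative (coord_rep M U \<phi> f) (at (\<phi> y)) = (\<lambda>u. 0)"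
        using f by (simp add: coord_vector_def fun_eq_iff)
      then have "(coord_rep M U \<phi> f has_derivative (\<lambda>u. 0)) (at z)"
        using coord_derivative[OF f y(1)] y(2) by simp
      then show ?thesis by (rule has_derivative_at_withinI)
    qed
    moreover have "convex ?S" using subspace_imp_convex[OF model] by (simp add: convex_Int)
    ultimately obtain c where c: "\<And>z. z \<in> ?S \<Longrightarrow> coord_rep M U \<phi> f z = c"
      using has_derivative_zero_constant[of ?S "coord_rep M U \<phi> f"] by metis
    let ?O = "{y \<in> U. \<phi> y \<in> ball (\<phi> x) r}"
    have fc: "f y = c" if "y \<in> ?O" for y
    proof -
      have "y \<in> U" "\<phi> y \<in> ?S" using that img_model by auto
      with c[OF this(2)] show ?thesis by (simp add: coord_rep_chart)
    qed
    have "x \<in> ?O" using U(2) r(1) by simp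
    with fc have "\<forall>y\<in>?O. f y = f x" by simp
    with \<open>x \<in> ?O\<close> openin_preimage[OF open_ball] show ?thesis by blast
  qed
  have opn: "openin (mtop M) {x \<in> points M. f x \<in> C}" for C
  proof (subst openin_subopen, rule ballI)
    fix x assume x: "x \<in> {x \<in> points M. f x \<in> C}"
    then obtain O' where O': "openin (mtop M) O'" "x \<in> O'" "\<forall>y\<in>O'. f y = f x" using loc by blast
    have "y \<in> {x \<in> points M. f x \<in> C}" if "y \<in> O'" for y
    proof -
      have "f y = f x" "y \<in> points M" using O'(3) openin_subset[OF O'(1)] that by blast+
      then show ?thesis using x by simp
    qed
    then have "O' \<subseteq> {x \<in> points M. f x \<in> C}" by (rule subsetI)
    with O' show "\<exists>T. openin (mtop M) T \<and> x \<in> T \<and> T \<subseteq> {x \<in> points M. f x \<in> C}" by blast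
  qed
  let ?T = "{x \<in> points M. f x \<in> {f p}}"
  have "points M - ?T = {x \<in> points M. f x \<in> - {f p}}" by blast
  then have "closedin (mtop M) ?T"
    using opn[of "- {f p}"] by (simp add: closedin_def)
  then have "?T = {} \<or> ?T = points M"
    using conn opn[of "{f p}"] unfolding connected_space_clopen_in by blast
  moreover have "p \<in> ?T" using pq by simp
  ultimately have "q \<in> ?T" using pq by blast
  then show ?thesis by simp
qed

text \<open>A covector annihilating the image of the coordinate derivative of a submersion is realised by a
  function \<open>f\<close> on the base. Then the coordinate derivative of \<open>f \<circ> \<pi>\<close> vanishes, hence so does every
  tangent vector on \<open>f \<circ> \<pi>\<close>; but tangent vectors lift along \<open>\<pi>\<close>.\<close>

lemma submersion_coord_onto:
  assumes N: "chart N U \<phi>" and Q: "chart Q V \<psi>" and sub: "submersion N Q \<pi>"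
    and p: "p \<in> U" "\<pi> p \<in> V"
  shows "model Q \<subseteq> range (frechet_derivative (coord_rep N U \<phi> (\<lambda>x. \<psi> (\<pi> x))) (at (\<phi> p)))"
proof (rule ccontr)
  interpret N: chart N U \<phi> by fact
  interpret Q: chart Q V \<psi> by fact
  have F: "smooth_map N Q \<pi>" using sub by (simp add: submersion_def)
  let ?D = "coord_dom N \<phi> {x \<in> U. \<pi> x \<in> V}"
  let ?t = "coord_rep N U \<phi> (\<lambda>x. \<psi> (\<pi> x))"
  let ?T = "frechet_derivative ?t (at (\<phi> p))"
  let ?R = "retr (model Q)"
  note t = smooth_map_chart[OF N Q F]
  have pD: "\<phi> p \<in> ?D" using p by (intro N.in_dom) simp_all
  have T: "(?t has_derivative ?T) (at (\<phi> p))" by (rule smooth_differentiable[OF t(1,2) pD])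
  have linT: "linear ?T" using T by (rule has_derivative_linear)
  have t0: "?t (\<phi> p) = \<psi> (\<pi> p)" by (rule N.coord_rep_chart[OF p(1)])
  have TQ: "?T u \<in> model Q" for u
  proof -
    have "((\<lambda>z. ?R (?t z)) has_derivative (\<lambda>u. ?R (?T u))) (at (\<phi> p))"
      using linear_retr[OF Q.model]
      by (intro bounded_linear.has_derivative[OF _ T]) (simp add: linear_conv_bounded_linear)
    then have "(?t has_derivative (\<lambda>u. ?R (?T u))) (at (\<phi> p))"
    proof (rule has_derivative_transform_within_open[OF _ t(1) pD])
      fix z assume "z \<in> ?D"
      from t(3)[OF this] show "?R (?t z) = ?t z" using Q.retr_chart by metis
    qed
    then have "?T = (\<lambda>u. ?R (?T u))" using T by (rule has_derivative_unique[rotated])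
    then have "?T u = ?R (?T u)" by (rule fun_cong)
    then show ?thesis using retr_in[OF Q.model] by metis
  qed
  assume "\<not> model Q \<subseteq> range ?T"
  then have "span (range ?T) \<subset> span (model Q)"
    using TQ Q.model linear_subspace_image[OF linT subspace_UNIV]
    by (auto simp: span_eq_iff[THEN iffD2])
  then obtain w where w: "w \<noteq> 0" "w \<in> span (model Q)" "\<And>y. y \<in> span (range ?T) \<Longrightarrow> orthogonal w y"
    using orthogonal_to_subspace_exists_gen by metis
  have wQ: "w \<in> model Q" using w(2) Q.model by (simp add: span_eq_iff[THEN iffD2])
  have wT: "w \<bullet> ?T u = 0" for u
    using w(3)[OF span_base[OF rangeI]] by (simp add: orthogonal_def)
  obtain f where f: "f \<in> smooth_functions Q" "\<And>u. u \<in> model Q \<Longrightarrow> Q.coord_vector (\<pi> p) u f = w \<bullet> u"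
    by (rule Q.exists_linear_function[OF p(2)]) (rule that)
  have pN: "p \<in> points N" using p N.U_points by blast
  have "Q.coord_vector (\<pi> p) w \<in> pushforward N Q \<pi> ` tangent_space N p"
    using sub Q.coord_vector_tangent[OF p(2)] pN unfolding submersion_def by blast
  then obtain v where v: "v \<in> tangent_space N p" "Q.coord_vector (\<pi> p) w = pushforward N Q \<pi> v" by blast
  let ?h = "pullback N \<pi> f"
  have h: "?h \<in> smooth_functions N" by (rule pullback_smooth[OF N.M Q.M F f(1)])
  have "v ?h = 0"
  proof (rule N.tangent_kills[OF p(1) v(1) h])
    fix u
    let ?G = "frechet_derivative (coord_rep Q V \<psi> f) (at (\<psi> (\<pi> p)))"
    have "(coord_rep Q V \<psi> f has_derivative ?G) (at (?t (\<phi> p)))"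
      unfolding t0 by (rule Q.coord_derivative[OF f(1) p(2)])
    with T have "((\<lambda>z. coord_rep Q V \<psi> f (?t z)) has_derivative (\<lambda>u. ?G (?T u))) (at (\<phi> p))"
      by (rule has_derivative_compose)
    then have "(coord_rep N U \<phi> ?h has_derivative (\<lambda>u. ?G (?T u))) (at (\<phi> p))"
    proof (rule has_derivative_transform_within_open[OF _ t(1) pD])
      fix z assume "z \<in> ?D"
      from t(3)[OF this, of ?h] obtain q where "q \<in> U" "\<pi> q \<in> V" "?t z = \<psi> (\<pi> q)"
        "coord_rep N U \<phi> ?h z = ?h q" by blast
      then show "coord_rep Q V \<psi> f (?t z) = coord_rep N U \<phi> ?h z"
        using N.U_points by (auto simp: Q.coord_rep_chart pullback_def)
    qed
    then have "frechet_derivative (coord_rep N U \<phi> ?h) (at (\<phi> p)) = (\<lambda>u. ?G (?T u))"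
      by (rule frechet_derivative_at[symmetric])
    moreover have "?G (?T u) = 0"
      using f(2)[OF TQ, of u] f(1) wT by (simp add: Q.coord_vector_def)
    ultimately show "N.coord_vector p u ?h = 0" by (simp add: N.coord_vector_def)
  qed
  moreover have "v ?h = w \<bullet> w"
    using fun_cong[OF v(2), of f] f(2)[OF wQ] f(1) by (simp add: pushforward_def)
  ultimately show False using w(1) by simp
qed

text \<open>Near each point of the base, \<open>f\<close> is the composition of \<open>f \<circ> \<pi>\<close> with a smooth local section of
  \<open>\<pi>\<close>.\<close>

lemma descend_smooth:
  fixes N :: "('a, 'e::euclidean_space) manifold" and Q :: "('b, 'e) manifold"
  assumes N: "smooth_manifold N" and Q: "smooth_manifold Q" and sub: "submersion N Q \<pi>"
    and onto: "points Q \<subseteq> \<pi> ` points N"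
    and off: "\<And>c. c \<notin> points Q \<Longrightarrow> f c = 0"
    and h: "pullback N \<pi> f \<in> smooth_functions N"
  shows "f \<in> smooth_functions Q"
proof (rule smooth_functionsI[OF Q off])
  have F: "smooth_map N Q \<pi>" using sub by (simp add: submersion_def)
  fix c assume "c \<in> points Q"
  then obtain p where p: "p \<in> points N" "c = \<pi> p" "\<pi> p \<in> points Q" using onto by blast
  obtain U \<phi> where U: "chart N U \<phi>" "p \<in> U" using chart_at[OF N p(1)] .
  obtain V \<psi> where V: "chart Q V \<psi>" "\<pi> p \<in> V" using chart_at[OF Q p(3)] .
  interpret U: chart N U \<phi> by fact
  interpret V: chart Q V \<psi> by fact
  let ?D = "coord_dom N \<phi> {x \<in> U. \<pi> x \<in> V}"
  let ?t = "coord_rep N U \<phi> (\<lambda>x. \<psi> (\<pi> x))"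
  let ?R = "retr (model Q)" and ?h = "pullback N \<pi> f"
  note t = smooth_map_chart[OF U(1) V(1) F]
  have pD: "\<phi> p \<in> ?D" using U(2) V(2) by (intro U.in_dom) simp_all
  have tQ: "?t ` ?D \<subseteq> model Q"
  proof (rule image_subsetI)
    fix z assume "z \<in> ?D"
    from t(3)[OF this] show "?t z \<in> model Q" using V.img_model by blast
  qed
  have t0: "?t (\<phi> p) = \<psi> (\<pi> p)" by (rule U.coord_rep_chart[OF U(2)])
  obtain V' s where V': "open V'" "?t (\<phi> p) \<in> V'" "smooth V' s" "s ` V' \<subseteq> ?D"
    "s (?t (\<phi> p)) = \<phi> p" "\<And>y. y \<in> V' \<inter> model Q \<Longrightarrow> ?t (s y) = y"
    by (rule smooth_local_section[OF t(1,2) pD V.model tQ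
          submersion_coord_onto[OF U(1) V(1) sub U(2) V(2)]]) (rule that)
  have blR: "bounded_linear ?R"
    using linear_retr[OF V.model] by (simp add: linear_conv_bounded_linear)
  let ?W = "?R -` V' \<inter> coord_dom Q \<psi> V"
  have "open ?W"
    by (intro open_Int V.open_dom_U open_vimage V'(1) linear_continuous_on blR)
  moreover have "\<psi> c \<in> ?W"
    using V'(2) V(2) V.in_dom[OF V(2) V(2)] V.retr_chart[OF V(2)] unfolding t0 p(2) by simp
  moreover have "smooth ?W (coord_rep Q V \<psi> f)"
  proof (rule smooth_on_cong)
    have sR: "smooth ?W (\<lambda>y. s (?R y))"
      by (rule smooth_on_compose[OF smooth_on_bounded_linear[OF blR] V'(3)]) blast
    show "smooth ?W (\<lambda>y. coord_rep N U \<phi> ?h (s (?R y)))"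
    proof (rule smooth_on_compose[OF sR U.smooth_function_chart[OF h]])
      have "?D \<subseteq> coord_dom N \<phi> U" by (auto simp: coord_dom_def)
      then show "(\<lambda>y. s (?R y)) ` ?W \<subseteq> coord_dom N \<phi> U" using V'(4) by blast
    qed
    fix y assume y: "y \<in> ?W"
    then have z: "s (?R y) \<in> ?D" using V'(4) by blast
    from t(3)[OF z, of ?h] obtain q where q: "q \<in> U" "\<pi> q \<in> V" "?t (s (?R y)) = \<psi> (\<pi> q)"
      "coord_rep N U \<phi> ?h (s (?R y)) = ?h q" by blast
    have "?R y = \<psi> (\<pi> q)"
      using V'(6)[of "?R y"] y q(3) retr_in[OF V.model] by auto
    then have "coord_rep Q V \<psi> f y = f (\<pi> q)"
      using q(2) V.inj by (simp add: coord_rep_def)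
    then show "coord_rep N U \<phi> ?h (s (?R y)) = coord_rep Q V \<psi> f y"
      using q(1,4) U.U_points by (auto simp: pullback_def)
  qed
  ultimately show "smooth_near Q f c"
    by (intro smooth_nearI[OF V.chart]) (use V(2) p(2) in auto)
qed

section \<open>Functions on the leaf space\<close>

lemma pullback_inclusion: "x \<in> points L \<Longrightarrow> pullback L (\<lambda>x. x) f x = f x"
  by (simp add: pullback_def)

lemma incl_apply:
  "f \<in> smooth_functions M \<Longrightarrow> incl L M u f = u (pullback L (\<lambda>x. x) f)"
  by (simp add: pushforward_def)

locale foliation =
  fixes N :: "('a, 'e::euclidean_space) manifold" and F :: "'a \<Rightarrow> 'a tvector set"
    and Q :: "('a set, 'e) manifold"
  assumes N: "smooth_manifold N" and reg: "regular_integrable_distribution N F Q"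
begin

abbreviation proj :: "'a \<Rightarrow> 'a set"
  where "proj \<equiv> leaf_of N F"

lemma Q: "smooth_manifold Q" and points_Q: "points Q = points N // same_leaf N F"
  and subm: "submersion N Q proj"
  using reg by (simp_all add: regular_integrable_distribution_def)

lemma integral_manifold_at:
  assumes "p \<in> points N"
  obtains L where "integral_manifold N F L" "p \<in> points L"
  using reg assms unfolding regular_integrable_distribution_def integrable_distribution_def by blast

lemma F_tangent: "p \<in> points N \<Longrightarrow> F p \<subseteq> tangent_space N p"
  using reg unfolding regular_integrable_distribution_def vector_subbundle_def smooth_family_def
  by blast

lemma same_leaf_refl: "p \<in> points N \<Longrightarrow> (p, p) \<in> same_leaf N F"
  unfolding same_leaf_def by (rule integral_manifold_at) (auto intro: r_into_trancl)

lemma same_leaf_sym: "(x, y) \<in> same_leaf N F \<Longrightarrow> (y, x) \<in> same_leaf N F"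
proof -
  have "sym {(x, y). \<exists>L. integral_manifold N F L \<and> x \<in> points L \<and> y \<in> points L}"
    by (auto simp: sym_def)
  then have "sym (same_leaf N F)" unfolding same_leaf_def by (rule sym_trancl)
  then show "(x, y) \<in> same_leaf N F \<Longrightarrow> (y, x) \<in> same_leaf N F" by (rule symD)
qed

lemma proj_eq: "(x, y) \<in> same_leaf N F \<Longrightarrow> proj x = proj y"
  using same_leaf_sym unfolding leaf_of_def same_leaf_def by (auto intro: trancl_trans)

lemma proj_points: "p \<in> points N \<Longrightarrow> proj p \<in> points Q"
  unfolding points_Q leaf_of_def by (rule quotientI)

lemma points_Q_image: "points Q \<subseteq> proj ` points N"
  unfolding points_Q leaf_of_def by (auto elim: quotientE)

text \<open>A vector in \<open>F\<close> is tangent to an integral manifold, on which functions coming from the leaf space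
  are constant. Conversely a function annihilated by \<open>F\<close> has no differential on any integral manifold,
  and is constant there by connectedness.\<close>

lemma pullback_kills:
  assumes f: "f \<in> smooth_functions Q"
  shows "pullback N proj f \<in> annihilated_functions N (points N) F"
proof -
  let ?h = "pullback N proj f"
  have h: "?h \<in> smooth_functions N"
    using pullback_smooth[OF N Q _ f] subm by (simp add: submersion_def)
  have "v ?h = 0" if p: "p \<in> points N" and v: "v \<in> F p" for p v
  proof -
    obtain L where L: "integral_manifold N F L" "p \<in> points L" using integral_manifold_at[OF p] .
    then have "F p = incl L N ` tangent_space L p" and smL: "smooth_manifold L"
      and LN: "points L \<subseteq> points N"
      by (auto simp: integral_manifold_def submanifold_def)
    then obtain u where u: "u \<in> tangent_space L p" "v = incl L N u" using v by blast
    have "pullback L (\<lambda>x. x) ?h = const_fun L (f (proj p))"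
    proof
      fix x
      have "proj x = proj p" if "x \<in> points L"
        using L that by (intro proj_eq) (auto simp: same_leaf_def)
      then show "pullback L (\<lambda>x. x) ?h x = const_fun L (f (proj p)) x"
        using LN by (auto simp: pullback_def const_fun_def)
    qed
    then show ?thesis
      using tangent_const[OF smL u(1) L(2)] by (simp add: u(2) incl_apply[OF h])
  qed
  with h show ?thesis by (simp add: annihilated_functions_def differential_def)
qed

lemma constant_on_leaves:
  assumes g: "g \<in> annihilated_functions N (points N) F" and xy: "(x, y) \<in> same_leaf N F"
  shows "g x = g y"
proof -
  have sm: "g \<in> smooth_functions N" using g by (simp add: annihilated_functions_def)
  have on_plaque: "g x = g y" if "integral_manifold N F L" "x \<in> points L" "y \<in> points L" for x y L
  proof -
    have L: "smooth_manifold L" "smooth_manifold N" "smooth_map L N (\<lambda>x. x)" "points L \<subseteq> points N"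
      "connected_space (mtop L)" "\<And>p. p \<in> points L \<Longrightarrow> incl L N ` tangent_space L p = F p"
      using that by (auto simp: integral_manifold_def submanifold_def)
    have "pullback L (\<lambda>x. x) g x = pullback L (\<lambda>x. x) g y"
    proof (rule constant_of_zero_differential[OF L(1,5) pullback_smooth[OF L(1-3) sm] _ that(2,3)])
      fix p v assume p: "p \<in> points L" and v: "v \<in> tangent_space L p"
      have "incl L N v \<in> F p" using L(6)[OF p] v by blast
      moreover have "p \<in> points N" using L(4) p by blast
      ultimately have "differential N p g (incl L N v) = 0" "incl L N v \<in> tangent_space N p"
        using g F_tangent by (auto simp: annihilated_functions_def)
      then show "v (pullback L (\<lambda>x. x) g) = 0"
        by (simp add: differential_def incl_apply[OF sm])
    qed
    then show ?thesis using that by (simp add: pullback_inclusion)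
  qed
  from xy show ?thesis unfolding same_leaf_def
  proof (induction rule: trancl_induct)
    case (base y)
    then show ?case using on_plaque by blast
  next
    case (step y z)
    then show ?case using on_plaque[of _ y z] by auto
  qed
qed

text \<open>So the functions on the leaf space are exactly the functions on \<open>N\<close> annihilated by \<open>F\<close>.\<close>

lemma descend:
  assumes g: "g \<in> annihilated_functions N (points N) F"
  shows "\<exists>f\<in>smooth_functions Q. pullback N proj f = g"
proof -
  let ?f = "\<lambda>c. if c \<in> points Q then g (SOME x. x \<in> c) else 0"
  have sm: "g \<in> smooth_functions N" using g by (simp add: annihilated_functions_def)
  have eq: "pullback N proj ?f = g"
  proof
    fix p
    show "pullback N proj ?f p = g p"
    proof (cases "p \<in> points N")
      case True
      have "p \<in> proj p" using same_leaf_refl[OF True] by (simp add: leaf_of_def)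
      then have "(SOME x. x \<in> proj p) \<in> proj p" by (rule someI)
      then have "(p, SOME x. x \<in> proj p) \<in> same_leaf N F" by (simp add: leaf_of_def)
      from constant_on_leaves[OF g this] show ?thesis
        using True proj_points[OF True] by (simp add: pullback_def)
    qed (simp add: pullback_def smooth_function_off[OF sm])
  qed
  have "?f \<in> smooth_functions Q"
    by (rule descend_smooth[OF N Q subm points_Q_image]) (simp_all add: eq sm)
  with eq show ?thesis by blast
qed

lemma pullback_inj:
  assumes "f \<in> smooth_functions Q" "f' \<in> smooth_functions Q"
    and "pullback N proj f = pullback N proj f'"
  shows "f = f'"
proof
  fix c
  show "f c = f' c"
  proof (cases "c \<in> points Q")
    case True
    then obtain p where "p \<in> points N" "c = proj p" using points_Q_image by blast
    then show ?thesis using fun_cong[OF assms(3), of p] by (simp add: pullback_def)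
  qed (simp add: smooth_function_off[OF assms(1)] smooth_function_off[OF assms(2)])
qed

end

section \<open>Brackets and their slots\<close>

text \<open>Arguments are exchanged one at a time.\<close>

lemma slotwise_eq:
  assumes fs: "fs \<in> function_lists n C" and gs: "gs \<in> function_lists n C"
    and step: "\<And>hs k. hs \<in> function_lists n C \<Longrightarrow> k < n \<Longrightarrow> hs ! k = fs ! k \<Longrightarrow> \<Phi> (hs[k := gs ! k]) = \<Phi> hs"
  shows "\<Phi> gs = \<Phi> fs"
proof -
  have len: "length fs = n" "length gs = n" and sub: "set fs \<subseteq> C" "set gs \<subseteq> C"
    using fs gs by (auto simp: function_lists_def)
  have "m \<le> n \<Longrightarrow> \<Phi> (take m gs @ drop m fs) = \<Phi> fs" for m
  proof (induction m)
    case (Suc m)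
    let ?hs = "take m gs @ drop m fs"
    have "set ?hs \<subseteq> C" using sub set_take_subset[of m gs] set_drop_subset[of m fs] by auto
    then have hs: "?hs \<in> function_lists n C" using len Suc.prems by (simp add: function_lists_def)
    have "?hs ! m = fs ! m" using len Suc.prems by (simp add: nth_append)
    then have "\<Phi> (?hs[m := gs ! m]) = \<Phi> ?hs" using Suc.prems by (intro step[OF hs]) auto
    moreover have "?hs[m := gs ! m] = take (Suc m) gs @ drop (Suc m) fs"
      using len Suc.prems
      by (intro nth_equalityI) (auto simp: nth_append nth_list_update less_Suc_eq)
    ultimately show ?case using Suc by simp
  qed simp
  from this[of n] show ?thesis using len by simp
qed

lemma function_lists_update:
  "fs \<in> function_lists n C \<Longrightarrow> g \<in> C \<Longrightarrow> fs[k := g] \<in> function_lists n C"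
  by (auto simp: function_lists_def dest!: subsetD[OF set_update_subset_insert])

lemma function_lists_nth: "fs \<in> function_lists n C \<Longrightarrow> k < n \<Longrightarrow> fs ! k \<in> C"
  by (auto simp: function_lists_def)

lemma function_lists_mono: "fs \<in> function_lists n C \<Longrightarrow> C \<subseteq> C' \<Longrightarrow> fs \<in> function_lists n C'"
  by (auto simp: function_lists_def)

lemma function_lists_map:
  "fs \<in> function_lists n C \<Longrightarrow> (\<And>f. f \<in> C \<Longrightarrow> h f \<in> C') \<Longrightarrow> map h fs \<in> function_lists n C'"
  by (auto simp: function_lists_def)

lemma function_lists_snoc:
  "gs \<in> function_lists (n - 1) C \<Longrightarrow> 1 \<le> n \<Longrightarrow> h \<in> C \<Longrightarrow> gs @ [h] \<in> function_lists n C"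
  by (auto simp: function_lists_def)

lemma differential_apply: "v \<in> tangent_space M p \<Longrightarrow> differential M p f v = v f"
  by (simp add: differential_def)

lemma differential_cotangent: "f \<in> smooth_functions M \<Longrightarrow> differential M p f \<in> cotangent_space M p"
proof -
  assume f: "f \<in> smooth_functions M"
  have "u + v \<in> tangent_space M p" "c *\<^sub>R v \<in> tangent_space M p"
    if "u \<in> tangent_space M p" "v \<in> tangent_space M p" for u v c
    using that by (auto simp: tangent_space_def algebra_simps)
  then show ?thesis by (auto simp: cotangent_space_def differential_def)
qed

locale nambu =
  fixes n :: nat and M :: "('a, 'e::euclidean_space) manifold" and B :: "'a bracket"
  assumes nambu: "nambu_poisson_manifold n M B"
begin

abbreviation "C \<equiv> smooth_functions M"

lemma M: "smooth_manifold M" and n: "1 \<le> n" and br: "nambu_bracket n M B"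
  using nambu by (simp_all add: nambu_poisson_manifold_def)

lemma bracket_smooth: "fs \<in> function_lists n C \<Longrightarrow> B fs \<in> C"
  using br by (simp add: nambu_bracket_def)

lemma bracket_linear:
  assumes "fs \<in> function_lists n C" "k < n" "g \<in> C" "h \<in> C"
  shows "B (fs[k := a *\<^sub>R g + b *\<^sub>R h]) = a *\<^sub>R B (fs[k := g]) + b *\<^sub>R B (fs[k := h])"
  using br assms unfolding nambu_bracket_def by blast

lemma bracket_skew:
  assumes "fs \<in> function_lists n C" "i < n" "j < n" "i \<noteq> j"
  shows "B (fs[i := fs ! j, j := fs ! i]) = - B fs"
  using br assms unfolding nambu_bracket_def by blast

lemma fundamental_identity:
  assumes "gs \<in> function_lists (n - 1) C" "fs \<in> function_lists n C"
  shows "B (gs @ [B fs]) = (\<Sum>k<n. B (fs[k := B (gs @ [fs ! k])]))"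
  using br assms unfolding nambu_bracket_def by blast

lemma bracket_add:
  assumes "fs \<in> function_lists n C" "k < n" "g \<in> C" "h \<in> C"
  shows "B (fs[k := g + h]) = B (fs[k := g]) + B (fs[k := h])"
  using bracket_linear[OF assms, of 1 1] by simp

lemma bracket_scale:
  assumes "fs \<in> function_lists n C" "k < n" "g \<in> C"
  shows "B (fs[k := c *\<^sub>R g]) = c *\<^sub>R B (fs[k := g])"
  using bracket_linear[OF assms assms(3), of c 0] by simp

text \<open>Every argument can be moved to the last place, where the Leibniz rule and the anchor
  $\Pi^\sharp$ apply; \<open>c\<close> is the sign of the exchange.\<close>

lemma bracket_slot_last:
  assumes fs: "fs \<in> function_lists n C" and k: "k < n"
  obtains c :: real and gs where "gs \<in> function_lists (n - 1) C"
    "set gs \<subseteq> {fs ! j |j. j < n \<and> j \<noteq> k}"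
    "\<And>x. x \<in> C \<Longrightarrow> B (fs[k := x]) = c *\<^sub>R B (gs @ [x])"
proof (cases "k = n - 1")
  case True
  have len: "length fs = n" using fs by (simp add: function_lists_def)
  have "fs[k := x] = take (n - 1) fs @ [x]" for x
    using len n True by (simp add: upd_conv_take_nth_drop)
  moreover have "set (take (n - 1) fs) \<subseteq> {fs ! j |j. j < n \<and> j \<noteq> k}"
  proof
    fix g assume "g \<in> set (take (n - 1) fs)"
    then obtain i where "i < n - 1" "g = fs ! i" using len by (auto simp: in_set_conv_nth)
    then show "g \<in> {fs ! j |j. j < n \<and> j \<noteq> k}"
      using True by (intro CollectI exI[of _ i]) simp
  qed
  moreover have "take (n - 1) fs \<in> function_lists (n - 1) C"
    using fs n by (auto simp: function_lists_def dest: in_set_takeD)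
  ultimately show thesis using that[of "take (n - 1) fs" 1] by simp
next
  case False
  have len: "length fs = n" using fs by (simp add: function_lists_def)
  let ?gs = "take (n - 1) (fs[k := fs ! (n - 1)])"
  have kn: "k < n - 1" using k False by linarith
  have "B (fs[k := x]) = - 1 *\<^sub>R B (?gs @ [x])" if x: "x \<in> C" for x
  proof -
    have "fs[k := x, k := fs[k := x] ! (n - 1), n - 1 := fs[k := x] ! k] = ?gs @ [x]"
      using len n kn by (intro nth_equalityI) (auto simp: nth_append nth_list_update)
    moreover have "B (fs[k := x, k := fs[k := x] ! (n - 1), n - 1 := fs[k := x] ! k]) = - B (fs[k := x])"
      by (rule bracket_skew[OF function_lists_update[OF fs x] k]) (use kn in auto)
    ultimately have "B (?gs @ [x]) = - B (fs[k := x])" by (simp only:)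
    then show ?thesis by (simp add: fun_eq_iff)
  qed
  moreover have *: "set ?gs \<subseteq> {fs ! j |j. j < n \<and> j \<noteq> k}"
  proof
    fix g assume "g \<in> set ?gs"
    then obtain i where i: "i < n - 1" "g = fs[k := fs ! (n - 1)] ! i"
      using len by (auto simp: in_set_conv_nth)
    show "g \<in> {fs ! j |j. j < n \<and> j \<noteq> k}"
    proof (cases "i = k")
      case True
      then have "g = fs ! (n - 1)" using i len k by simp
      then show ?thesis using kn by (intro CollectI exI[of _ "n - 1"]) simp
    next
      case False
      then have "g = fs ! i" using i by simp
      then show ?thesis using i False by (intro CollectI exI[of _ i]) simp
    qed
  qed
  moreover have "?gs \<in> function_lists (n - 1) C"
    using * function_lists_nth[OF fs] len by (auto simp: function_lists_def)
  ultimately show thesis using that[of ?gs "- 1"] by blast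
qed

lemma bracket_leibniz:
  assumes fs: "fs \<in> function_lists n C" and k: "k < n" and g: "g \<in> C" and h: "h \<in> C"
  shows "B (fs[k := g * h]) = g * B (fs[k := h]) + B (fs[k := g]) * h"
proof -
  obtain c gs where gs: "gs \<in> function_lists (n - 1) C"
    "\<And>x. x \<in> C \<Longrightarrow> B (fs[k := x]) = c *\<^sub>R B (gs @ [x])"
    by (rule bracket_slot_last[OF fs k]) (rule that)
  have "B (gs @ [g * h]) = g * B (gs @ [h]) + B (gs @ [g]) * h"
    using br gs(1) g h unfolding nambu_bracket_def by blast
  then show ?thesis
    using gs(2)[OF g] gs(2)[OF h] gs(2)[OF smooth_functions_mult[OF M g h]]
    by (simp add: fun_eq_iff algebra_simps)
qed

definition slot_vector :: "('a \<Rightarrow> real) list \<Rightarrow> nat \<Rightarrow> 'a \<Rightarrow> 'a tvector"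
  where "slot_vector fs k p = (\<lambda>g. if g \<in> C then B (fs[k := g]) p else 0)"

lemma slot_vector_tangent:
  assumes fs: "fs \<in> function_lists n C" and k: "k < n"
  shows "slot_vector fs k p \<in> tangent_space M p"
  unfolding tangent_space_def slot_vector_def
  using smooth_functions_add[OF M] smooth_functions_mult[OF M] smooth_functions_scale[OF M]
  by (simp add: bracket_add[OF fs k] bracket_scale[OF fs k] bracket_leibniz[OF fs k])

text \<open>Tangent vectors take equal values on functions with equal differentials, so that the arguments can be
  replaced one by one. This is what makes the Nambu tensor and its Lie derivative independent of the
  chosen primitives.\<close>

lemma multiderivation_cong:
  assumes fs: "fs \<in> function_lists n C" and gs: "gs \<in> function_lists n C"
    and d: "\<And>k. k < n \<Longrightarrow> differential M p (fs ! k) = differential M p (gs ! k)"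
    and der: "\<And>hs k. hs \<in> function_lists n C \<Longrightarrow> k < n \<Longrightarrow>
      (\<lambda>g. if g \<in> C then \<Phi> (hs[k := g]) else 0) \<in> tangent_space M p"
  shows "\<Phi> gs = \<Phi> fs"
proof (rule slotwise_eq[OF fs gs])
  fix hs k assume hs: "hs \<in> function_lists n C" "k < n" "hs ! k = fs ! k"
  let ?v = "\<lambda>g. if g \<in> C then \<Phi> (hs[k := g]) else 0"
  have "?v (gs ! k) = ?v (fs ! k)"
    using fun_cong[OF d[OF hs(2)], of ?v] der[OF hs(1,2)] by (simp add: differential_def)
  then have "\<Phi> (hs[k := gs ! k]) = \<Phi> (hs[k := fs ! k])"
    using function_lists_nth[OF fs hs(2)] function_lists_nth[OF gs hs(2)] by simp
  then show "\<Phi> (hs[k := gs ! k]) = \<Phi> hs" using list_update_id[of hs k] hs(3) by simp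
qed

lemma primitive:
  assumes "f \<in> C"
  shows "primitive M p (differential M p f) \<in> C"
    and "differential M p (primitive M p (differential M p f)) = differential M p f"
proof -
  have "\<exists>g. g \<in> C \<and> differential M p g = differential M p f" using assms by blast
  from someI_ex[OF this]
  show "primitive M p (differential M p f) \<in> C"
    "differential M p (primitive M p (differential M p f)) = differential M p f"
    by (simp_all add: primitive_def)
qed

text \<open>The functions that replace \<open>fs\<close> when a multivector field is evaluated at \<open>p\<close>; they agree with \<open>fs\<close>
  to first order at \<open>p\<close> only.\<close>

abbreviation prims :: "'a \<Rightarrow> ('a \<Rightarrow> real) list \<Rightarrow> ('a \<Rightarrow> real) list"
  where "prims p fs \<equiv> map (primitive M p) (map (differential M p) fs)"

lemma prims:
  assumes "fs \<in> function_lists n C"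
  shows "prims p fs \<in> function_lists n C"
    and "k < n \<Longrightarrow> differential M p (fs ! k) = differential M p (prims p fs ! k)"
proof -
  show "prims p fs \<in> function_lists n C"
    unfolding map_map by (rule function_lists_map[OF assms]) (simp add: primitive(1))
  assume k: "k < n"
  then have "length fs > k" using assms by (simp add: function_lists_def)
  then show "differential M p (fs ! k) = differential M p (prims p fs ! k)"
    by (simp add: primitive(2)[OF function_lists_nth[OF assms k]])
qed

lemma differentials_cotangent:
  "fs \<in> function_lists m C \<Longrightarrow>
    length (map (differential M p) fs) = m \<and> set (map (differential M p) fs) \<subseteq> cotangent_space M p"
  by (auto simp: function_lists_def intro: differential_cotangent)

lemma nambu_tensor_differentials:
  assumes fs: "fs \<in> function_lists n C"
  shows "nambu_tensor n M B p (map (differential M p) fs) = B fs p"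
proof -
  have "B (prims p fs) p = B fs p"
    by (rule multiderivation_cong[OF fs prims[OF fs], where \<Phi> = "\<lambda>fs. B fs p"])
      (use slot_vector_tangent in \<open>auto simp: slot_vector_def\<close>)
  then show ?thesis
    using differentials_cotangent[OF fs] unfolding nambu_tensor_def by simp
qed

text \<open>The right-hand side involves second derivatives of the arguments, but they cancel: by the Leibniz rules
  of \<open>X\<close> and of the bracket it is a derivation at \<open>p\<close> in each argument.\<close>

lemma lie_derivative_differentials:
  assumes X: "X \<in> sections M M W" and p: "p \<in> points M" and fs: "fs \<in> function_lists n C"
  shows "lie_derivative n M X (nambu_tensor n M B) p (map (differential M p) fs)
    = X p (B fs) - (\<Sum>k<n. B (fs[k := apply_field M X (fs ! k)]) p)"
proof -
  let ?X = "apply_field M X"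
  have Xp: "X p \<in> tangent_space M p" using X p by (simp add: sections_def)
  have XC: "?X f \<in> C" if "f \<in> C" for f
    using X that by (simp add: sections_def apply_field_def)
  have Xadd: "?X (f + g) = ?X f + ?X g" and Xmult: "?X (f * g) = f * ?X g + g * ?X f"
    and Xscale: "?X (c *\<^sub>R f) = c *\<^sub>R ?X f" if "f \<in> C" "g \<in> C" for f g c
    using X that
    by (auto simp: sections_def apply_field_def fun_eq_iff tangent_add[OF M] tangent_mult[OF M]
        tangent_scale[OF M])
  let ?\<Phi> = "\<lambda>fs. X p (B fs) - (\<Sum>k<n. B (fs[k := ?X (fs ! k)]) p)"
  have der: "(\<lambda>g. if g \<in> C then ?\<Phi> (hs[j := g]) else 0) \<in> tangent_space M p"
    if hs: "hs \<in> function_lists n C" and j: "j < n" for hs j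
  proof -
    have len: "length hs = n" using hs by (simp add: function_lists_def)
    let ?hk = "\<lambda>k. hs[k := ?X (hs ! k)]"
    have hk: "?hk k \<in> function_lists n C" if "k < n" for k
      using hs that by (intro function_lists_update XC function_lists_nth)
    \<comment> \<open>The summand in which \<open>X\<close> differentiates the varying argument itself is split off.\<close>
    have eq: "?\<Phi> (hs[j := g]) = X p (B (hs[j := g])) - B (hs[j := ?X g]) p
        - (\<Sum>k\<in>{..<n} - {j}. B ((?hk k)[j := g]) p)" for g
    proof -
      have "(\<Sum>k<n. B (hs[j := g, k := ?X (hs[j := g] ! k)]) p)
        = B (hs[j := g, j := ?X (hs[j := g] ! j)]) p
          + (\<Sum>k\<in>{..<n} - {j}. B (hs[j := g, k := ?X (hs[j := g] ! k)]) p)"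
        using j by (intro sum.remove) auto
      also have "\<dots> = B (hs[j := ?X g]) p + (\<Sum>k\<in>{..<n} - {j}. B ((?hk k)[j := g]) p)"
        using j len by (intro arg_cong2[where f = "(+)"] sum.cong)
          (auto simp: list_update_swap)
      finally show ?thesis by simp
    qed
    note sm = bracket_smooth[OF function_lists_update[OF hs]]
    note smC = smooth_functions_add[OF M] smooth_functions_mult[OF M] smooth_functions_scale[OF M]
    have add: "?\<Phi> (hs[j := f + g]) = ?\<Phi> (hs[j := f]) + ?\<Phi> (hs[j := g])" if fg: "f \<in> C" "g \<in> C" for f g
    proof -
      have "(\<Sum>k\<in>{..<n} - {j}. B ((?hk k)[j := f + g]) p)
        = (\<Sum>k\<in>{..<n} - {j}. B ((?hk k)[j := f]) p + B ((?hk k)[j := g]) p)"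
        by (intro sum.cong refl) (simp add: bracket_add[OF hk j fg])
      then have s: "(\<Sum>k\<in>{..<n} - {j}. B ((?hk k)[j := f + g]) p)
        = (\<Sum>k\<in>{..<n} - {j}. B ((?hk k)[j := f]) p) + (\<Sum>k\<in>{..<n} - {j}. B ((?hk k)[j := g]) p)"
        by (simp add: sum.distrib)
      show ?thesis
        unfolding eq unfolding s Xadd[OF fg] bracket_add[OF hs j fg]
          bracket_add[OF hs j XC[OF fg(1)] XC[OF fg(2)]] tangent_add[OF M Xp sm[OF fg(1)] sm[OF fg(2)]]
        by simp
    qed
    have scale: "?\<Phi> (hs[j := c *\<^sub>R f]) = c * ?\<Phi> (hs[j := f])" if f: "f \<in> C" for c f
    proof -
      have "(\<Sum>k\<in>{..<n} - {j}. B ((?hk k)[j := c *\<^sub>R f]) p)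
        = (\<Sum>k\<in>{..<n} - {j}. c * B ((?hk k)[j := f]) p)"
        by (intro sum.cong refl) (simp add: bracket_scale[OF hk j f])
      then have s: "(\<Sum>k\<in>{..<n} - {j}. B ((?hk k)[j := c *\<^sub>R f]) p)
        = c * (\<Sum>k\<in>{..<n} - {j}. B ((?hk k)[j := f]) p)"
        by (simp add: sum_distrib_left)
      show ?thesis
        unfolding eq unfolding s Xscale[OF f f] bracket_scale[OF hs j f] bracket_scale[OF hs j XC[OF f]]
          tangent_scale[OF M Xp sm[OF f]]
        by (simp add: right_diff_distrib)
    qed
    have mult: "?\<Phi> (hs[j := f * g]) = f p * ?\<Phi> (hs[j := g]) + g p * ?\<Phi> (hs[j := f])"
      if fg: "f \<in> C" "g \<in> C" for f g
    proof -
      have "(\<Sum>k\<in>{..<n} - {j}. B ((?hk k)[j := f * g]) p)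
        = (\<Sum>k\<in>{..<n} - {j}. f p * B ((?hk k)[j := g]) p + g p * B ((?hk k)[j := f]) p)"
        by (intro sum.cong refl) (simp add: bracket_leibniz[OF hk j fg])
      then have s: "(\<Sum>k\<in>{..<n} - {j}. B ((?hk k)[j := f * g]) p)
        = f p * (\<Sum>k\<in>{..<n} - {j}. B ((?hk k)[j := g]) p) + g p * (\<Sum>k\<in>{..<n} - {j}. B ((?hk k)[j := f]) p)"
        by (simp add: sum.distrib sum_distrib_left)
      have Xf: "?X f p = X p f" "?X g p = X p g" using p by (simp_all add: apply_field_def)
      have b: "B (hs[j := f * ?X g + g * ?X f]) p
          = f p * B (hs[j := ?X g]) p + B (hs[j := f]) p * X p g
            + (g p * B (hs[j := ?X f]) p + B (hs[j := g]) p * X p f)"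
        using fg by (simp add: bracket_add[OF hs j] bracket_leibniz[OF hs j] smC XC Xf)
      have x: "X p (B (hs[j := f * g])) = f p * X p (B (hs[j := g])) + B (hs[j := g]) p * X p f
          + (B (hs[j := f]) p * X p g + g p * X p (B (hs[j := f])))"
        using fg by (simp add: bracket_leibniz[OF hs j] tangent_add[OF M Xp] tangent_mult[OF M Xp] smC sm)
      show ?thesis unfolding eq unfolding Xmult[OF fg] s b x by (simp add: algebra_simps)
    qed
    show ?thesis unfolding tangent_space_def
      using smC by (simp add: add mult scale del: sum_subtractf)
  qed
  have "?\<Phi> (prims p fs) = ?\<Phi> fs"
    by (rule multiderivation_cong[OF fs prims[OF fs] der])
  moreover have "lie_derivative n M X (nambu_tensor n M B) p (map (differential M p) fs) = ?\<Phi> (prims p fs)"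
  proof -
    let ?gs = "prims p fs"
    have gs: "?gs \<in> function_lists n C" by (rule prims(1)[OF fs])
    have "(\<lambda>q. if q \<in> points M then nambu_tensor n M B q (map (differential M q) ?gs) else 0) = B ?gs"
      using smooth_function_off[OF bracket_smooth[OF gs]]
      by (simp add: fun_eq_iff nambu_tensor_differentials[OF gs] del: map_map)
    moreover have "nambu_tensor n M B p (map (differential M p) (?gs[k := ?X (?gs ! k)]))
        = B (?gs[k := ?X (?gs ! k)]) p" if "k < n" for k
      using gs that by (intro nambu_tensor_differentials function_lists_update XC function_lists_nth)
    ultimately show ?thesis
      using differentials_cotangent[OF fs] unfolding lie_derivative_def Let_def by simp
  qed
  ultimately show ?thesis by simp
qed

end

section \<open>Reduction\<close>

text \<open>Every term of the determinant has one factor from each row and one from each column.\<close>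

lemma wedge_zero_left:
  assumes "i < length as" "\<And>j. j < length as \<Longrightarrow> pair (as ! i) (bs ! j) = 0"
  shows "wedge pair V as bs = 0"
proof -
  have "(\<Prod>i<length as. pair (as ! i) (bs ! \<sigma> i)) = 0" if "\<sigma> permutes {..<length as}" for \<sigma>
    using assms permutes_in_image[OF that, of i] by (intro prod_zero) auto
  then have "(\<Sum>\<sigma> | \<sigma> permutes {..<length as}.
      of_int (sign \<sigma>) * (\<Prod>i<length as. pair (as ! i) (bs ! \<sigma> i))) = 0"
    by (intro sum.neutral ballI) (simp only: mem_Collect_eq mult_zero_right)
  then show ?thesis unfolding wedge_def by (simp only: if_cancel)
qed

lemma wedge_zero_right:
  assumes "j < length as" "\<And>i. i < length as \<Longrightarrow> pair (as ! i) (bs ! j) = 0"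
  shows "wedge pair V as bs = 0"
proof -
  have "(\<Prod>i<length as. pair (as ! i) (bs ! \<sigma> i)) = 0" if \<sigma>: "\<sigma> permutes {..<length as}" for \<sigma>
  proof (rule prod_zero)
    have "inv \<sigma> j \<in> {..<length as}" "\<sigma> (inv \<sigma> j) = j"
      using assms(1) permutes_in_image[OF permutes_inv[OF \<sigma>], of j] permutes_inverses(1)[OF \<sigma>] by auto
    then show "\<exists>i\<in>{..<length as}. pair (as ! i) (bs ! \<sigma> i) = 0" using assms(2) by (metis lessThan_iff)
  qed simp
  then have "(\<Sum>\<sigma> | \<sigma> permutes {..<length as}.
      of_int (sign \<sigma>) * (\<Prod>i<length as. pair (as ! i) (bs ! \<sigma> i))) = 0"
    by (intro sum.neutral ballI) (simp only: mem_Collect_eq mult_zero_right)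
  then show ?thesis unfolding wedge_def by (simp only: if_cancel)
qed

lemma wedge_subspace_vanishes:
  assumes T: "T \<in> wedge_subspace n M E p" and n: "1 \<le> n"
    and \<alpha>s: "\<forall>\<alpha>\<in>set \<alpha>s. \<forall>e\<in>E p. \<alpha> e = 0"
  shows "T \<alpha>s = 0"
proof -
  let ?G = "{wedge_vectors M p (e # ws) |e ws. e \<in> E p \<and> length ws = n - 1 \<and> set ws \<subseteq> tangent_space M p}"
  have "subspace {T :: 'a covector list \<Rightarrow> real. T \<alpha>s = 0}" by (simp add: subspace_def)
  moreover have "?G \<subseteq> {T. T \<alpha>s = 0}"
  proof clarify
    fix e ws assume e: "e \<in> E p"
    show "wedge_vectors M p (e # ws) \<alpha>s = 0"
    proof (cases "length \<alpha>s = length (e # ws)")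
      case True
      then show ?thesis unfolding wedge_vectors_def using \<alpha>s e by (intro wedge_zero_left[of 0]) auto
    qed (simp add: wedge_vectors_def wedge_def)
  qed
  ultimately have "span ?G \<subseteq> {T. T \<alpha>s = 0}" by (intro span_minimal)
  with T show ?thesis unfolding wedge_subspace_def by blast
qed

lemma wedge_covectors_Ann1:
  assumes "length \<alpha>s = n - 1" "set \<alpha>s \<subseteq> cotangent_space M p"
    and \<alpha>s: "\<forall>\<alpha>\<in>set \<alpha>s. \<forall>e\<in>E p. \<alpha> e = 0"
  shows "wedge_covectors M p \<alpha>s \<in> Ann1 n M E p"
  unfolding Ann1_def
proof (intro CollectI conjI ballI ext)
  show "wedge_covectors M p \<alpha>s \<in> forms M (n - 1) p"
    unfolding forms_def using assms by (intro span_base) blast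
  fix v vs assume v: "v \<in> E p"
  show "wedge_covectors M p \<alpha>s (v # vs) = 0"
  proof (cases "length \<alpha>s = length (v # vs)")
    case True
    then show ?thesis unfolding wedge_covectors_def using \<alpha>s v by (intro wedge_zero_right[of 0]) auto
  qed (simp add: wedge_covectors_def wedge_def)
qed

locale reduction = nambu n M B + foliation N "tangential_part M N E" Q
  for n :: nat and M N :: "('a, 'e::euclidean_space) manifold" and B :: "'a bracket"
    and E \<theta> :: "'a \<Rightarrow> 'a tvector set" and Q :: "('a set, 'e) manifold" +
  assumes NM: "submanifold N M"
    and E: "vector_subbundle M N E"
    and \<theta>: "smooth_family M M \<theta>"
    and F_\<theta>: "\<And>p. p \<in> points N \<Longrightarrow> incl N M ` tangential_part M N E p \<subseteq> \<theta> p"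
    and \<theta>_E: "\<And>p. p \<in> points N \<Longrightarrow> \<theta> p \<subseteq> E p"
    and comp: "compatible M N E \<theta>"
    and anchor: "\<And>p. p \<in> points N \<Longrightarrow> sharp_graph n M (nambu_tensor n M B) p `` Ann1 n M E p
           \<subseteq> {incl N M u + d |u d. u \<in> tangent_space N p \<and> d \<in> \<theta> p}"
    and lie: "\<And>X p. X \<in> sections M M \<theta> \<Longrightarrow> p \<in> points N \<Longrightarrow>
           lie_derivative n M X (nambu_tensor n M B) p \<in> wedge_subspace n M E p"
begin

abbreviation "C_E \<equiv> annihilated_functions M (points N) E"
abbreviation "C_D \<equiv> annihilated_functions M (points N) \<theta>"
abbreviation "C_\<theta> \<equiv> annihilated_functions M (points M) \<theta>"
abbreviation "C_F \<equiv> annihilated_functions N (points N) (tangential_part M N E)"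
abbreviation "\<rho> \<equiv> restrict_to N"

lemma points_NM: "p \<in> points N \<Longrightarrow> p \<in> points M"
  using NM by (auto simp: submanifold_def)

lemma \<theta>_tangent: "p \<in> points M \<Longrightarrow> \<theta> p \<subseteq> tangent_space M p"
  using \<theta> by (simp add: smooth_family_def)

lemma E_tangent: "p \<in> points N \<Longrightarrow> E p \<subseteq> tangent_space M p"
  using E by (simp add: vector_subbundle_def smooth_family_def)

lemma annihilated_smooth: "annihilated_functions M A W \<subseteq> C"
  by (auto simp: annihilated_functions_def)

lemma C_E_C_D: "C_E \<subseteq> C_D"
  using \<theta>_E by (fastforce simp: annihilated_functions_def)

lemma annihilated_iff:
  assumes "\<And>p. p \<in> A \<Longrightarrow> W p \<subseteq> tangent_space M p"
  shows "f \<in> annihilated_functions M A W \<longleftrightarrow> f \<in> C \<and> (\<forall>p\<in>A. \<forall>v\<in>W p. v f = 0)"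
proof -
  have "differential M p f v = v f" if "p \<in> A" "v \<in> W p" for p v
    using assms that by (intro differential_apply) blast
  then show ?thesis by (auto simp: annihilated_functions_def)
qed

lemmas C_E_iff = annihilated_iff[of "points N" E, OF E_tangent]
  and C_D_iff = annihilated_iff[of "points N" \<theta>, OF \<theta>_tangent[OF points_NM]]
  and C_\<theta>_iff = annihilated_iff[of "points M" \<theta>, OF \<theta>_tangent]

lemma C_E_linear:
  assumes "g \<in> C_E" "h \<in> C_E"
  shows "a *\<^sub>R g + b *\<^sub>R h \<in> C_E"
proof -
  have "v (a *\<^sub>R g + b *\<^sub>R h) = 0" if "p \<in> points N" "v \<in> E p" for p v
  proof -
    have v: "v \<in> tangent_space M p" using E_tangent that by blast
    have "v g = 0" "v h = 0" "g \<in> C" "h \<in> C" using assms that by (auto simp: C_E_iff)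
    then show ?thesis
      by (simp add: tangent_add[OF M v] tangent_scale[OF M v] smooth_functions_scale[OF M])
  qed
  then show ?thesis
    using assms by (simp add: C_E_iff smooth_functions_add[OF M] smooth_functions_scale[OF M])
qed

lemma C_E_mult:
  assumes "g \<in> C_E" "h \<in> C_E"
  shows "g * h \<in> C_E"
proof -
  have "v (g * h) = 0" if "p \<in> points N" "v \<in> E p" for p v
  proof -
    have v: "v \<in> tangent_space M p" using E_tangent that by blast
    have "v g = 0" "v h = 0" "g \<in> C" "h \<in> C" using assms that by (auto simp: C_E_iff)
    then show ?thesis by (simp add: tangent_mult[OF M v])
  qed
  then show ?thesis using assms by (simp add: C_E_iff smooth_functions_mult[OF M])
qed

lemma differentials_kill:
  assumes "Fs \<in> function_lists m C_E" "p \<in> points N"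
  shows "\<forall>\<alpha>\<in>set (map (differential M p) Fs). \<forall>e\<in>E p. \<alpha> e = 0"
  using assms by (auto simp: function_lists_def annihilated_functions_def)

text \<open>The condition on the anchor says that the vector $\{G_1, \ldots, G_{n-1}, \cdot\}$ is the sum
  of a vector tangent to \<open>N\<close> and a vector in \<open>D\<close>.\<close>

lemma bracket_last_restrict:
  assumes Gs: "Gs \<in> function_lists (n - 1) C_E" and H: "H \<in> C_D" "H' \<in> C_D" and eq: "\<rho> H = \<rho> H'"
    and p: "p \<in> points N"
  shows "B (Gs @ [H]) p = B (Gs @ [H']) p"
proof -
  have GC: "Gs \<in> function_lists (n - 1) C" by (rule function_lists_mono[OF Gs annihilated_smooth])
  let ?\<alpha>s = "map (differential M p) Gs"
  let ?w = "\<lambda>f. if f \<in> C then nambu_tensor n M B p (?\<alpha>s @ [differential M p f]) else 0"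
  note \<alpha>s = conjunct1[OF differentials_cotangent[OF GC, of p]] conjunct2[OF differentials_cotangent[OF GC, of p]]
  have "(wedge_covectors M p ?\<alpha>s, ?w) \<in> sharp_graph n M (nambu_tensor n M B) p"
    unfolding sharp_graph_def
    by (rule span_base, rule CollectI, rule exI[of _ ?\<alpha>s], rule conjI[OF refl conjI[OF \<alpha>s]])
  moreover have "wedge_covectors M p ?\<alpha>s \<in> Ann1 n M E p"
    by (rule wedge_covectors_Ann1[where E = E and p = p and M = M, OF \<alpha>s differentials_kill[OF Gs p]])
  ultimately have "?w \<in> sharp_graph n M (nambu_tensor n M B) p `` Ann1 n M E p"
    by (rule ImageI)
  then have "?w \<in> {incl N M u + d |u d. u \<in> tangent_space N p \<and> d \<in> \<theta> p}"
    by (rule subsetD[OF anchor[OF p]])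
  then obtain u d where w: "?w = incl N M u + d" "d \<in> \<theta> p"
    unfolding mem_Collect_eq by (elim exE conjE) (rule that)
  have "B (Gs @ [f]) p = u (\<rho> f)" if f: "f \<in> C_D" for f
  proof -
    have fC: "f \<in> C" using f annihilated_smooth by blast
    have "B (Gs @ [f]) p = ?w f"
      using nambu_tensor_differentials[OF function_lists_snoc[OF GC n fC], of p] fC by simp
    also have "\<dots> = (incl N M u + d) f" by (rule fun_cong[OF w(1)])
    also have "\<dots> = u (\<rho> f) + d f" by (simp add: incl_apply[OF fC])
    also have "d f = 0" using f w(2) p by (simp add: C_D_iff)
    finally show ?thesis by simp
  qed
  from this[OF H(1)] this[OF H(2)] eq show ?thesis by simp
qed

text \<open>The exchanged functions are required to be annihilated by \<open>D\<close>, and not by \<open>E\<close>, because one of them is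
  going to be a bracket.\<close>

lemma bracket_slot_restrict:
  assumes fs: "fs \<in> function_lists n C_E" and k: "k < n"
    and H: "H \<in> C_D" "H' \<in> C_D" and eq: "\<rho> H = \<rho> H'" and p: "p \<in> points N"
  shows "B (fs[k := H]) p = B (fs[k := H']) p"
proof -
  obtain c gs where gs: "gs \<in> function_lists (n - 1) C" "set gs \<subseteq> {fs ! j |j. j < n \<and> j \<noteq> k}"
    "\<And>x. x \<in> C \<Longrightarrow> B (fs[k := x]) = c *\<^sub>R B (gs @ [x])"
    by (rule bracket_slot_last[OF function_lists_mono[OF fs annihilated_smooth] k]) (rule that)
  have "gs \<in> function_lists (n - 1) C_E"
    using gs(1,2) function_lists_nth[OF fs] by (auto simp: function_lists_def)
  from bracket_last_restrict[OF this H eq p] show ?thesis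
    using gs(3)[OF subsetD[OF annihilated_smooth H(1)]] gs(3)[OF subsetD[OF annihilated_smooth H(2)]]
    by simp
qed

text \<open>Because of this, the reduced bracket may be computed with any extensions annihilated by \<open>E\<close>.\<close>

lemma bracket_restrict_cong:
  assumes Fs: "Fs \<in> function_lists n C_E" and Gs: "Gs \<in> function_lists n C_E"
    and eq: "\<And>k. k < n \<Longrightarrow> \<rho> (Fs ! k) = \<rho> (Gs ! k)"
  shows "\<rho> (B Fs) = \<rho> (B Gs)"
proof
  fix p
  show "\<rho> (B Fs) p = \<rho> (B Gs) p"
  proof (cases "p \<in> points N")
    case p: True
    have "B Gs p = B Fs p"
    proof (rule slotwise_eq[OF Fs Gs])
      fix hs k assume hs: "hs \<in> function_lists n C_E" "k < n" "hs ! k = Fs ! k"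
      have "B (hs[k := Gs ! k]) p = B (hs[k := hs ! k]) p"
        using function_lists_nth[OF Gs hs(2)] function_lists_nth[OF hs(1,2)] C_E_C_D eq[OF hs(2)] hs(3)
        by (intro bracket_slot_restrict[OF hs(1,2) _ _ _ p]) auto
      then show "B (hs[k := Gs ! k]) p = B hs p" by simp
    qed
    then show ?thesis using p by (simp add: pullback_def)
  qed (simp add: pullback_def)
qed

text \<open>For a section \<open>X\<close> of \<open>\<theta>\<close> and functions annihilated by \<open>\<theta>\<close>, only the term \<open>X{F\<^sub>1, \<dots>, F\<^sub>n}\<close> of the Lie
  derivative survives.\<close>

lemma bracket_C_D:
  assumes Fs: "Fs \<in> function_lists n (C_E \<inter> C_\<theta>)"
  shows "B Fs \<in> C_D"
proof -
  have FE: "Fs \<in> function_lists n C_E" and F\<theta>: "Fs \<in> function_lists n C_\<theta>"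
    using Fs by (auto simp: function_lists_def)
  have FC: "Fs \<in> function_lists n C" by (rule function_lists_mono[OF FE annihilated_smooth])
  have "v (B Fs) = 0" if p: "p \<in> points N" and v: "v \<in> \<theta> p" for p v
  proof -
    have pM: "p \<in> points M" by (rule points_NM[OF p])
    obtain X where X: "X \<in> sections M M \<theta>" "X p = v"
      using \<theta> pM v unfolding smooth_family_def by blast
    have "B (Fs[k := apply_field M X (Fs ! k)]) = 0" if k: "k < n" for k
    proof -
      have "apply_field M X (Fs ! k) = 0 *\<^sub>R Fs ! k"
        using X(1) function_lists_nth[OF F\<theta> k]
        by (auto simp: apply_field_def sections_def C_\<theta>_iff fun_eq_iff)
      then show ?thesis
        using bracket_scale[OF FC k function_lists_nth[OF FC k], of 0] by simp
    qed
    then have "v (B Fs) = lie_derivative n M X (nambu_tensor n M B) p (map (differential M p) Fs)"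
      using lie_derivative_differentials[OF X(1) pM FC] X(2) by simp
    also have "\<dots> = 0"
      by (rule wedge_subspace_vanishes[OF lie[OF X(1) p] n differentials_kill[OF FE p]])
    finally show ?thesis .
  qed
  then show ?thesis using bracket_smooth[OF FC] by (simp add: C_D_iff)
qed

text \<open>This is where \<open>F \<subseteq> D\<close> is needed.\<close>

lemma restrict_C_D: "H \<in> C_D \<Longrightarrow> \<rho> H \<in> C_F"
proof -
  assume H: "H \<in> C_D"
  have HC: "H \<in> C" using H annihilated_smooth by blast
  have "\<rho> H \<in> smooth_functions N"
    using NM by (intro pullback_smooth[OF N M _ HC]) (simp add: submanifold_def)
  moreover have "v (\<rho> H) = 0" if p: "p \<in> points N" and v: "v \<in> tangential_part M N E p" for p v
  proof -
    have "incl N M v \<in> \<theta> p" using F_\<theta>[OF p] v by blast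
    then have "incl N M v H = 0" using H p by (simp add: C_D_iff)
    then show ?thesis by (simp add: incl_apply[OF HC])
  qed
  ultimately show "\<rho> H \<in> C_F" by (simp add: annihilated_functions_def differential_def)
qed

definition extension :: "('a set \<Rightarrow> real) \<Rightarrow> 'a \<Rightarrow> real"
  where "extension f = (SOME F. F \<in> C_E \<inter> C_\<theta> \<and> \<rho> F = pullback N proj f)"

lemma extension:
  assumes "f \<in> smooth_functions Q"
  shows "extension f \<in> C_E \<inter> C_\<theta>" and "\<rho> (extension f) = pullback N proj f"
proof -
  have "pullback N proj f \<in> \<rho> ` (C_E \<inter> C_\<theta>)"
    using pullback_kills[OF assms] comp by (simp add: compatible_def)
  then have "\<exists>F. F \<in> C_E \<inter> C_\<theta> \<and> \<rho> F = pullback N proj f" by (auto simp del: Int_iff)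
  from someI_ex[OF this] show "extension f \<in> C_E \<inter> C_\<theta>" "\<rho> (extension f) = pullback N proj f"
    unfolding extension_def by blast+
qed

definition reduced :: "'a set bracket"
  where "reduced fs = (SOME f. f \<in> smooth_functions Q \<and> pullback N proj f = \<rho> (B (map extension fs)))"

abbreviation lift :: "('a \<Rightarrow> real) \<Rightarrow> ('a set \<Rightarrow> real) \<Rightarrow> bool"
  where "lift F f \<equiv> F \<in> C_E \<and> f \<in> smooth_functions Q \<and> \<rho> F = pullback N proj f"

abbreviation lifts :: "('a \<Rightarrow> real) list \<Rightarrow> ('a set \<Rightarrow> real) list \<Rightarrow> bool"
  where "lifts \<equiv> list_all2 lift"

lemma lifts_extension:
  assumes "set fs \<subseteq> smooth_functions Q"
  shows "lifts (map extension fs) fs"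
proof -
  have "\<forall>f\<in>set fs. lift (extension f) f"
    using extension assms by blast
  then show ?thesis by (simp only: list_all2_map1 list_all2_same)
qed

lemma lifts_update:
  "lifts Fs fs \<Longrightarrow> G \<in> C_E \<Longrightarrow> g \<in> smooth_functions Q \<Longrightarrow> \<rho> G = pullback N proj g \<Longrightarrow>
    lifts (Fs[k := G]) (fs[k := g])"
  by (rule list_all2_update_cong) blast+

lemma lifts_snoc:
  "lifts Fs fs \<Longrightarrow> G \<in> C_E \<Longrightarrow> g \<in> smooth_functions Q \<Longrightarrow> \<rho> G = pullback N proj g \<Longrightarrow>
    lifts (Fs @ [G]) (fs @ [g])"
  by (rule list_all2_appendI) (blast intro: list_all2_Cons[THEN iffD2] list_all2_Nil[THEN iffD2])+

lemma lifts_lists: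
  assumes "lifts Fs fs" "length fs = m"
  shows "Fs \<in> function_lists m C_E" and "fs \<in> function_lists m (smooth_functions Q)"
proof -
  have "length Fs = length fs" "\<And>k. k < length fs \<Longrightarrow> lift (Fs ! k) (fs ! k)"
    using assms(1) by (simp_all only: list_all2_conv_all_nth)
  with assms(2) show "Fs \<in> function_lists m C_E" "fs \<in> function_lists m (smooth_functions Q)"
    by (auto simp: function_lists_def in_set_conv_nth)
qed

lemma reduced:
  assumes fs: "fs \<in> function_lists n (smooth_functions Q)"
  shows reduced_smooth: "reduced fs \<in> smooth_functions Q"
    and reduced_extension: "pullback N proj (reduced fs) = \<rho> (B (map extension fs))"
proof -
  have "map extension fs \<in> function_lists n (C_E \<inter> C_\<theta>)"
    using fs extension(1) by (rule function_lists_map)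
  then have "\<exists>f. f \<in> smooth_functions Q \<and> pullback N proj f = \<rho> (B (map extension fs))"
    using descend[OF restrict_C_D[OF bracket_C_D]] by blast
  from someI_ex[OF this] show "reduced fs \<in> smooth_functions Q"
    "pullback N proj (reduced fs) = \<rho> (B (map extension fs))"
    unfolding reduced_def by blast+
qed

lemma pullback_reduced:
  assumes "lifts Fs fs" "length fs = n"
  shows "pullback N proj (reduced fs) = \<rho> (B Fs)"
proof -
  note fs = lifts_lists[OF assms]
  have ext: "lifts (map extension fs) fs"
    using fs(2) by (intro lifts_extension) (simp add: function_lists_def)
  have "pullback N proj (reduced fs) = \<rho> (B (map extension fs))" by (rule reduced_extension[OF fs(2)])
  also have "\<dots> = \<rho> (B Fs)"
    using ext assms by (intro bracket_restrict_cong lifts_lists[OF ext assms(2)] fs(1))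
      (simp add: list_all2_conv_all_nth)
  finally show ?thesis .
qed

lemma pullback_arith:
  fixes f g :: "'b \<Rightarrow> real" and L :: "('c, 'd) manifold"
  shows "pullback L \<pi> (f + g) = pullback L \<pi> f + pullback L \<pi> g"
    and "pullback L \<pi> (f * g) = pullback L \<pi> f * pullback L \<pi> g"
    and "pullback L \<pi> (c *\<^sub>R f) = c *\<^sub>R pullback L \<pi> f"
    and "pullback L \<pi> (- f) = - pullback L \<pi> f"
    and "pullback L \<pi> (sum h I) = (\<Sum>i\<in>I. pullback L \<pi> (h i))"
  by (auto simp: pullback_def fun_eq_iff sum_fun_apply)

text \<open>Functions on the leaf space are compared after pulling them back to \<open>N\<close>, where every reduced bracket
  may be computed with arbitrary extensions annihilated by \<open>E\<close>. Sums and products of such extensions are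
  of the same kind, which settles all axioms but the fundamental identity. There the inner bracket of the
  extensions is annihilated by \<open>D\<close> only; it is nevertheless interchangeable with an extension of the
  reduced inner bracket, by the condition on the anchor.\<close>

lemma reduced_nambu: "nambu_bracket n Q reduced"
proof -
  let ?C = "smooth_functions Q"
  let ?p = "pullback N proj"
  note smQ = smooth_functions_add[OF Q] smooth_functions_mult[OF Q] smooth_functions_scale[OF Q]
    smooth_functions_sum[OF Q]
  have ext: "extension f \<in> C_E" "\<rho> (extension f) = ?p f" if "f \<in> ?C" for f
    using extension[OF that] by simp_all
  have exts: "lifts (map extension fs) fs" "length fs = m" "map extension fs \<in> function_lists m C"
    if fs: "fs \<in> function_lists m ?C" for fs m
  proof -
    show "lifts (map extension fs) fs" "length fs = m"
      using fs lifts_extension by (simp_all add: function_lists_def)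
    show "map extension fs \<in> function_lists m C"
      using fs by (rule function_lists_map) (rule subsetD[OF annihilated_smooth ext(1)])
  qed
  have ups: "fs[k := g] \<in> function_lists n ?C" if "fs \<in> function_lists n ?C" "g \<in> ?C" for fs k g
    using that by (rule function_lists_update)
  have multilinear: "reduced (fs[k := a *\<^sub>R g + b *\<^sub>R h]) = a *\<^sub>R reduced (fs[k := g]) + b *\<^sub>R reduced (fs[k := h])"
    if fs: "fs \<in> function_lists n ?C" and k: "k < n" and g: "g \<in> ?C" and h: "h \<in> ?C" for fs k g h a b
  proof (rule pullback_inj)
    let ?Fs = "map extension fs"
    show "reduced (fs[k := a *\<^sub>R g + b *\<^sub>R h]) \<in> ?C"
      "a *\<^sub>R reduced (fs[k := g]) + b *\<^sub>R reduced (fs[k := h]) \<in> ?C"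
      by (intro smQ reduced_smooth ups fs g h)+
    have len: "length (fs[k := x]) = n" for x using exts(2)[OF fs] by simp
    have gh: "\<rho> (a *\<^sub>R extension g + b *\<^sub>R extension h) = ?p (a *\<^sub>R g + b *\<^sub>R h)"
      by (simp add: pullback_arith ext g h)
    have "?p (reduced (fs[k := a *\<^sub>R g + b *\<^sub>R h])) = \<rho> (B (?Fs[k := a *\<^sub>R extension g + b *\<^sub>R extension h]))"
      by (intro pullback_reduced len lifts_update exts(1)[OF fs] C_E_linear ext g h gh smQ)
    also have "\<dots> = a *\<^sub>R \<rho> (B (?Fs[k := extension g])) + b *\<^sub>R \<rho> (B (?Fs[k := extension h]))"
      unfolding bracket_linear[OF exts(3)[OF fs] k subsetD[OF annihilated_smooth ext(1)[OF g]]
          subsetD[OF annihilated_smooth ext(1)[OF h]]]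
      by (simp add: pullback_arith)
    also have "\<rho> (B (?Fs[k := extension g])) = ?p (reduced (fs[k := g]))"
      by (intro pullback_reduced[symmetric] len lifts_update exts(1)[OF fs] ext g)
    also have "\<rho> (B (?Fs[k := extension h])) = ?p (reduced (fs[k := h]))"
      by (intro pullback_reduced[symmetric] len lifts_update exts(1)[OF fs] ext h)
    finally show "?p (reduced (fs[k := a *\<^sub>R g + b *\<^sub>R h]))
        = ?p (a *\<^sub>R reduced (fs[k := g]) + b *\<^sub>R reduced (fs[k := h]))"
      by (simp only: pullback_arith)
  qed
  have skew: "reduced (fs[i := fs ! j, j := fs ! i]) = - reduced fs"
    if fs: "fs \<in> function_lists n ?C" and ij: "i < n" "j < n" "i \<noteq> j" for fs i j
  proof (rule pullback_inj)
    let ?Fs = "map extension fs"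
    note nth = function_lists_nth[OF fs ij(1)] function_lists_nth[OF fs ij(2)]
    show "reduced (fs[i := fs ! j, j := fs ! i]) \<in> ?C"
      by (intro reduced_smooth ups fs nth)
    show "- reduced fs \<in> ?C"
      using smQ(3)[OF reduced_smooth[OF fs], of "- 1"] by (simp add: scaleR_fun_def fun_Compl_def)
    have Fs: "?Fs ! i = extension (fs ! i)" "?Fs ! j = extension (fs ! j)"
      using ij exts(2)[OF fs] by simp_all
    have "?p (reduced (fs[i := fs ! j, j := fs ! i])) = \<rho> (B (?Fs[i := ?Fs ! j, j := ?Fs ! i]))"
      unfolding Fs using exts(2)[OF fs]
      by (intro pullback_reduced lifts_update exts(1)[OF fs] ext nth) simp
    also have "\<dots> = - \<rho> (B ?Fs)" unfolding bracket_skew[OF exts(3)[OF fs] ij] by (simp add: pullback_arith)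
    also have "\<rho> (B ?Fs) = ?p (reduced fs)"
      by (intro pullback_reduced[symmetric] exts[OF fs])
    finally show "?p (reduced (fs[i := fs ! j, j := fs ! i])) = ?p (- reduced fs)"
      by (simp only: pullback_arith)
  qed
  have leibniz: "reduced (fs @ [g * h]) = g * reduced (fs @ [h]) + reduced (fs @ [g]) * h"
    if fs: "fs \<in> function_lists (n - 1) ?C" and g: "g \<in> ?C" and h: "h \<in> ?C" for fs g h
  proof (rule pullback_inj)
    let ?Fs = "map extension fs"
    note snoc = function_lists_snoc[OF fs n]
    show "reduced (fs @ [g * h]) \<in> ?C" "g * reduced (fs @ [h]) + reduced (fs @ [g]) * h \<in> ?C"
      by (intro smQ reduced_smooth snoc g h)+
    have len: "length (fs @ [x]) = n" for x using exts(2)[OF fs] n by simp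
    have gh: "\<rho> (extension g * extension h) = ?p (g * h)" by (simp add: pullback_arith ext g h)
    have EC: "extension g \<in> C" "extension h \<in> C"
      using ext(1)[OF g] ext(1)[OF h] annihilated_smooth by blast+
    have "?p (reduced (fs @ [g * h])) = \<rho> (B (?Fs @ [extension g * extension h]))"
      by (intro pullback_reduced len lifts_snoc exts(1)[OF fs] C_E_mult ext g h gh smQ)
    also have "B (?Fs @ [extension g * extension h])
        = extension g * B (?Fs @ [extension h]) + B (?Fs @ [extension g]) * extension h"
      using br exts(3)[OF fs] EC unfolding nambu_bracket_def by blast
    also have "\<rho> \<dots> = ?p g * \<rho> (B (?Fs @ [extension h])) + \<rho> (B (?Fs @ [extension g])) * ?p h"
      by (simp add: pullback_arith ext g h)
    also have "\<rho> (B (?Fs @ [extension h])) = ?p (reduced (fs @ [h]))"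
      by (intro pullback_reduced[symmetric] len lifts_snoc exts(1)[OF fs] ext h)
    also have "\<rho> (B (?Fs @ [extension g])) = ?p (reduced (fs @ [g]))"
      by (intro pullback_reduced[symmetric] len lifts_snoc exts(1)[OF fs] ext g)
    finally show "?p (reduced (fs @ [g * h])) = ?p (g * reduced (fs @ [h]) + reduced (fs @ [g]) * h)"
      by (simp only: pullback_arith)
  qed
  have fundamental: "reduced (gs @ [reduced fs]) = (\<Sum>k<n. reduced (fs[k := reduced (gs @ [fs ! k])]))"
    if gs: "gs \<in> function_lists (n - 1) ?C" and fs: "fs \<in> function_lists n ?C" for gs fs
  proof (rule pullback_inj)
    let ?Fs = "map extension fs" and ?Gs = "map extension gs"
    note snoc = function_lists_snoc[OF gs n]
    have FE: "?Fs \<in> function_lists n C_E" and GE: "?Gs \<in> function_lists (n - 1) C_E"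
      by (rule lifts_lists(1)[OF exts(1,2)[OF fs]] lifts_lists(1)[OF exts(1,2)[OF gs]])+
    have FD: "?Fs \<in> function_lists n (C_E \<inter> C_\<theta>)" and GD: "?Gs \<in> function_lists (n - 1) (C_E \<inter> C_\<theta>)"
      using fs gs extension(1) by (auto intro!: function_lists_map simp del: Int_iff)
    have nth: "fs ! k \<in> ?C" "reduced (gs @ [fs ! k]) \<in> ?C" if "k < n" for k
      using function_lists_nth[OF fs that] reduced_smooth[OF snoc] by blast+
    show "reduced (gs @ [reduced fs]) \<in> ?C"
      by (intro reduced_smooth snoc fs)
    show "(\<Sum>k<n. reduced (fs[k := reduced (gs @ [fs ! k])])) \<in> ?C"
      by (intro smQ reduced_smooth ups fs nth) simp
    have rf: "reduced fs \<in> ?C" by (rule reduced_smooth[OF fs])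
    have len: "length (gs @ [x]) = n" for x using exts(2)[OF gs] n by simp
    have "?p (reduced (gs @ [reduced fs])) = \<rho> (B (?Gs @ [extension (reduced fs)]))"
      by (intro pullback_reduced len lifts_snoc exts(1)[OF gs] ext rf)
    also have "\<dots> = \<rho> (B (?Gs @ [B ?Fs]))"
    proof
      have "\<rho> (extension (reduced fs)) = \<rho> (B ?Fs)"
        by (simp add: ext(2)[OF rf] reduced_extension[OF fs])
      then show "\<rho> (B (?Gs @ [extension (reduced fs)])) p = \<rho> (B (?Gs @ [B ?Fs])) p" for p
        using bracket_last_restrict[OF GE subsetD[OF C_E_C_D ext(1)[OF rf]] bracket_C_D[OF FD]]
        by (simp add: pullback_def)
    qed
    also have "\<dots> = (\<Sum>k<n. \<rho> (B (?Fs[k := B (?Gs @ [?Fs ! k])])))"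
      unfolding fundamental_identity[OF exts(3)[OF gs] exts(3)[OF fs]] by (rule pullback_arith)
    also have "\<dots> = (\<Sum>k<n. ?p (reduced (fs[k := reduced (gs @ [fs ! k])])))"
    proof (rule sum.cong[OF refl])
      fix k assume "k \<in> {..<n}"
      then have k: "k < n" by simp
      let ?r = "reduced (gs @ [fs ! k])"
      have Fk: "?Fs ! k = extension (fs ! k)" using k exts(2)[OF fs] by simp
      have GF: "?Gs @ [?Fs ! k] \<in> function_lists n (C_E \<inter> C_\<theta>)"
        by (rule function_lists_snoc[OF GD n function_lists_nth[OF FD k]])
      have eq: "\<rho> (B (?Gs @ [?Fs ! k])) = \<rho> (extension ?r)"
        using reduced_extension[OF snoc[OF nth(1)[OF k]]] by (simp add: ext(2)[OF nth(2)[OF k]] Fk)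
      have "\<rho> (B (?Fs[k := B (?Gs @ [?Fs ! k])])) = \<rho> (B (?Fs[k := extension ?r]))"
      proof
        show "\<rho> (B (?Fs[k := B (?Gs @ [?Fs ! k])])) p = \<rho> (B (?Fs[k := extension ?r])) p" for p
          using bracket_slot_restrict[OF FE k bracket_C_D[OF GF] subsetD[OF C_E_C_D ext(1)[OF nth(2)[OF k]]] eq]
          by (simp add: pullback_def)
      qed
      also have "\<dots> = ?p (reduced (fs[k := ?r]))"
        using exts(2)[OF fs] by (intro pullback_reduced[symmetric] lifts_update exts(1)[OF fs] ext nth k) simp
      finally show "\<rho> (B (?Fs[k := B (?Gs @ [?Fs ! k])])) = ?p (reduced (fs[k := ?r]))" .
    qed
    finally show "?p (reduced (gs @ [reduced fs])) = ?p (\<Sum>k<n. reduced (fs[k := reduced (gs @ [fs ! k])]))"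
      by (simp only: pullback_arith)
  qed
  show ?thesis
    unfolding nambu_bracket_def
    using reduced_smooth multilinear skew leibniz fundamental by blast
qed

lemma reducible: "reducible n M B N E Q"
  unfolding reducible_def
proof (intro exI conjI ballI impI)
  show "nambu_bracket n Q reduced" by (rule reduced_nambu)
  fix fs Fs
  assume fs: "fs \<in> function_lists n (smooth_functions Q)" and Fs: "Fs \<in> function_lists n C_E"
    and eq: "\<forall>k<n. \<rho> (Fs ! k) = pullback N proj (fs ! k)"
  have "lifts Fs fs"
    using fs Fs eq function_lists_nth[OF fs] function_lists_nth[OF Fs]
    by (simp add: list_all2_conv_all_nth function_lists_def)
  then show "pullback N proj (reduced fs) = \<rho> (B Fs)"
    using fs by (intro pullback_reduced) (simp_all add: function_lists_def)
qed

end

theorem proposition4p13: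
  fixes n :: nat
    and M N :: "('a, 'e::euclidean_space) manifold"
    and B :: "'a bracket"
    and E \<theta> :: "'a \<Rightarrow> 'a tvector set"
    and Q :: "('a set, 'e) manifold"
  assumes "nambu_poisson_manifold n M B"
    and "submanifold N M"
    and "vector_subbundle M N E"
    and "regular_integrable_distribution N (tangential_part M N E) Q"
    and "integrable_distribution M \<theta>"
    and "vector_subbundle M N \<theta>"
    and "\<forall>p\<in>points N. incl N M ` tangential_part M N E p \<subseteq> \<theta> p \<and> \<theta> p \<subseteq> E p"
    and "compatible M N E \<theta>"
    and "\<forall>p\<in>points N. sharp_graph n M (nambu_tensor n M B) p `` Ann1 n M E p
           \<subseteq> {incl N M u + d |u d. u \<in> tangent_space N p \<and> d \<in> \<theta> p}"
    and "\<forall>X\<in>sections M M \<theta>. \<forall>p\<in>points N.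
           lie_derivative n M X (nambu_tensor n M B) p \<in> wedge_subspace n M E p"
  shows "reducible n M B N E Q"
proof -
  interpret reduction n M N B E \<theta> Q
  proof
    show "smooth_manifold N" using assms(2) by (simp add: submanifold_def)
    show "smooth_family M M \<theta>" using assms(5) by (simp add: integrable_distribution_def)
  qed (use assms in blast)+
  show ?thesis by (rule reducible)
qed

end
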